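(* Let $\mathbf{g}$ be a Riemannian metric on $M$ whose Gauss curvature $K$ is positive, so that the isometric embedding system $\mathcal{I}$ of $(M,\mathbf{g})$ into Euclidean $\mathbb{R}^3$ is elliptic. Let $k=\sqrt{K}$ and $q=k^{-3/2}=K^{-3/4}$. Then $\mathcal{I}$ is Darboux integrable if and only if the function $q$ on $\mathcal{F}_M$ satisfies the differential equations $$q_{11}=q_{22}=3q^{-1/3},\qquad q_{12}=q_{21}=0,$$ where the functions $q_i$, $q_{ij}$ on the oriented orthonormal frame bundle $\mathcal{F}_M$ are defined by $dq=q_i\eta^i$ and $dq_i=q_j\eta^j_i+q_{ij}\eta^j$ ($1\le i,j\le 2$, summation convention).
   Context: $M$ is a connected, oriented smooth surface with Riemannian metric $\mathbf{g}$. $\mathcal{F}_M$ is its oriented orthonormal frame bundle, with canonical (dual) 1-forms $\eta^1,\eta^2$ and connection form $\eta^1_2=-\eta^2_1$ satisfying $d\eta^1=-\eta^1_2\wedge\eta^2$, $d\eta^2=-\eta^2_1\wedge\eta^1$, $d\eta^1_2=K\,\eta^1\wedge\eta^2$, where $K$ is the Gauss curvature; $\eta^1_1=\eta^2_2=0$. Functions on $M$ are pulled back to $\mathcal{F}_M$. $\mathcal{F}_{\mathbb{R}^3}$ is the orthonormal frame bundle of Euclidean $\mathbb{R}^3$, with basepoint map $\rho$ and frame vectors $e_1,e_2,e_3$ (as vector-valued functions), and canonical and connection forms $\omega^i$, $\omega^i_j=-\omega^j_i$ defined by $d\rho=e_i\omega^i$, $de_i=e_j\omega^j_i$. Isometric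 embedding system: $\mathcal{I}$ is the Pfaffian exterior differential system on $\mathcal{F}_M\times\mathcal{F}_{\mathbb{R}^3}$ generated by the 1-forms (pullbacks suppressed) $$\theta_0=\omega^3,\quad \theta_1=\omega^1-\eta^1,\quad \theta_2=\omega^2-\eta^2,\quad \theta_3=\omega^1_2-\eta^1_2 .$$ It is called hyperbolic if $K<0$ and elliptic if $K>0$. When $K>0$, put $k=\sqrt{K}$. The singular systems of $\mathcal{I}$ are the subbundle of the complexified cotangent bundle $$W=\operatorname{span}_{\mathbb{C}}\{\theta_0,\theta_1,\theta_2,\theta_3,\ \omega^3_1-\mathrm{i}k\eta^2,\ \omega^3_2+\mathrm{i}k\eta^1\}$$ and its complex conjugate $\overline{W}$. $\mathcal{I}$ is Darboux integrable if, locally, $W$ (hence also $\overline W$) contains a complex Frobenius subbundle $F$ (i.e. $d\alpha\equiv 0$ modulo $F$ for every section $\alpha$ of $F$) of complex rank at least $2$ that intersects $\operatorname{span}_{\mathbb{C}}\{\theta_0,\theta_1,\theta_2,\theta_3\}$ only in $0$. *)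

theory Defs
  imports "HOL-Analysis.Analysis"
begin

section \<open>Smooth maps on open subsets of Euclidean spaces\<close>

primrec Ck_on :: "nat \<Rightarrow> 'e::euclidean_space set \<Rightarrow> ('e \<Rightarrow> 'f::real_normed_vector) \<Rightarrow> bool" where
  "Ck_on 0 S f \<longleftrightarrow> continuous_on S f"
| "Ck_on (Suc n) S f \<longleftrightarrow>
     (\<forall>x\<in>S. f differentiable (at x)) \<and>
     (\<forall>v. Ck_on n S (\<lambda>x. frechet_derivative f (at x) v))"

definition smooth_on :: "'e::euclidean_space set \<Rightarrow> ('e \<Rightarrow> 'f::real_normed_vector) \<Rightarrow> bool" where
  "smooth_on S f \<longleftrightarrow> (\<forall>n. Ck_on n S f)"

section \<open>Connected oriented smooth surfaces\<close>

text \<open>A chart consists of its domain and its coordinate map.\<close>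

type_synonym 'a chart = "'a set \<times> ('a \<Rightarrow> real^2)"

definition chart_image :: "'a chart \<Rightarrow> (real^2) set" where
  "chart_image c = snd c ` fst c"

definition chart_inv :: "'a chart \<Rightarrow> real^2 \<Rightarrow> 'a" where
  "chart_inv c = inv_into (fst c) (snd c)"

definition is_chart :: "'a topology \<Rightarrow> 'a chart \<Rightarrow> bool" where
  "is_chart X c \<longleftrightarrow> openin X (fst c) \<and> open (chart_image c) \<and>
     homeomorphic_map (subtopology X (fst c)) (top_of_set (chart_image c)) (snd c)"

definition transition :: "'a chart \<Rightarrow> 'a chart \<Rightarrow> real^2 \<Rightarrow> real^2" where
  "transition c d = snd d \<circ> chart_inv c"

definition oriented_smooth_atlas :: "'a topology \<Rightarrow> 'a chart set \<Rightarrow> bool" where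
  "oriented_smooth_atlas X A \<longleftrightarrow>
     (\<forall>c\<in>A. is_chart X c) \<and> (\<Union>c\<in>A. fst c) = topspace X \<and>
     (\<forall>c\<in>A. \<forall>d\<in>A.
        smooth_on (snd c ` (fst c \<inter> fst d)) (transition c d) \<and>
        (\<forall>x\<in>snd c ` (fst c \<inter> fst d).
           0 < det (matrix (frechet_derivative (transition c d) (at x)))))"

definition connected_oriented_surface :: "'a topology \<Rightarrow> 'a chart set \<Rightarrow> bool" where
  "connected_oriented_surface X A \<longleftrightarrow>
     Hausdorff_space X \<and> second_countable X \<and> connected_space X \<and> oriented_smooth_atlas X A"

text \<open>
  A tangent vector at a point p is the family of its components in all charts of the atlas
  around p; the entries at other charts are irrelevant and set to 0.
\<close>

type_synonym 'a tvec = "'a chart \<Rightarrow> real^2"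

definition tangent_at :: "'a chart set \<Rightarrow> 'a \<Rightarrow> 'a tvec set" where
  "tangent_at A p = {v.
     (\<forall>c\<in>A. \<forall>d\<in>A. p \<in> fst c \<inter> fst d \<longrightarrow>
        v d = frechet_derivative (transition c d) (at (snd c p)) (v c)) \<and>
     (\<forall>c. \<not> (c \<in> A \<and> p \<in> fst c) \<longrightarrow> v c = 0)}"

definition tvec_of :: "'a chart set \<Rightarrow> 'a chart \<Rightarrow> 'a \<Rightarrow> real^2 \<Rightarrow> 'a tvec" where
  "tvec_of A c p u = (\<lambda>d. if d \<in> A \<and> p \<in> fst d
     then frechet_derivative (transition c d) (at (snd c p)) u else 0)"

section \<open>Riemannian metrics, Levi-Civita connection, Gauss curvature\<close>

type_synonym 'a metric = "'a \<Rightarrow> 'a tvec \<Rightarrow> 'a tvec \<Rightarrow> real"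

definition metric_in :: "'a chart set \<Rightarrow> 'a metric \<Rightarrow> 'a chart \<Rightarrow> real^2 \<Rightarrow> real^2 \<Rightarrow> real^2 \<Rightarrow> real" where
  "metric_in A g c x u w =
     g (chart_inv c x) (tvec_of A c (chart_inv c x) u) (tvec_of A c (chart_inv c x) w)"

definition riemannian_metric :: "'a chart set \<Rightarrow> 'a metric \<Rightarrow> bool" where
  "riemannian_metric A g \<longleftrightarrow> (\<forall>c\<in>A.
     (\<forall>x\<in>chart_image c. bilinear (metric_in A g c x) \<and>
        (\<forall>u w. metric_in A g c x u w = metric_in A g c x w u) \<and>
        (\<forall>u. u \<noteq> 0 \<longrightarrow> 0 < metric_in A g c x u u)) \<and>
     (\<forall>u w. smooth_on (chart_image c) (\<lambda>x. metric_in A g c x u w)))"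

definition metric_matrix :: "'a chart set \<Rightarrow> 'a metric \<Rightarrow> 'a chart \<Rightarrow> real^2 \<Rightarrow> real^2^2" where
  "metric_matrix A g c x = (\<chi> i j. metric_in A g c x (axis i 1) (axis j 1))"

definition partial :: "2 \<Rightarrow> (real^2 \<Rightarrow> real) \<Rightarrow> real^2 \<Rightarrow> real" where
  "partial i f x = frechet_derivative f (at x) (axis i 1)"

definition christoffel :: "'a chart set \<Rightarrow> 'a metric \<Rightarrow> 'a chart \<Rightarrow> 2 \<Rightarrow> 2 \<Rightarrow> 2 \<Rightarrow> real^2 \<Rightarrow> real" where
  "christoffel A g c l i j x = (let G = metric_matrix A g c in
     (\<Sum>m\<in>UNIV. matrix_inv (G x) $ l $ m *
        (partial i (\<lambda>y. G y $ j $ m) x + partial j (\<lambda>y. G y $ i $ m) x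
         - partial m (\<lambda>y. G y $ i $ j) x)) / 2)"

text \<open>The l-th component of \<open>R(\<partial>\<^sub>i, \<partial>\<^sub>j) \<partial>\<^sub>k\<close>, where
  \<open>R(X,Y) = [\<nabla>\<^sub>X, \<nabla>\<^sub>Y] - \<nabla>\<close> along the bracket of X and Y.\<close>

definition riemann_curvature ::
    "'a chart set \<Rightarrow> 'a metric \<Rightarrow> 'a chart \<Rightarrow> 2 \<Rightarrow> 2 \<Rightarrow> 2 \<Rightarrow> 2 \<Rightarrow> real^2 \<Rightarrow> real" where
  "riemann_curvature A g c l k i j x = (let \<Gamma> = christoffel A g c in
     partial i (\<Gamma> l j k) x - partial j (\<Gamma> l i k) x
     + (\<Sum>m\<in>UNIV. \<Gamma> m j k x * \<Gamma> l i m x - \<Gamma> m i k x * \<Gamma> l j m x))"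

definition gauss_curvature_in :: "'a chart set \<Rightarrow> 'a metric \<Rightarrow> 'a chart \<Rightarrow> real^2 \<Rightarrow> real" where
  "gauss_curvature_in A g c x =
     (\<Sum>l\<in>UNIV. metric_matrix A g c x $ 1 $ l * riemann_curvature A g c l 2 1 2 x)
     / det (metric_matrix A g c x)"

text \<open>The value of the Gauss curvature does not depend on the chart, so there is exactly one such
  function K on the surface.\<close>

definition is_gauss_curvature :: "'a chart set \<Rightarrow> 'a metric \<Rightarrow> ('a \<Rightarrow> real) \<Rightarrow> bool" where
  "is_gauss_curvature A g K \<longleftrightarrow>
     (\<forall>c\<in>A. \<forall>p\<in>fst c. K p = gauss_curvature_in A g c (snd c p))"

section \<open>The oriented orthonormal frame bundle of a surface\<close>

type_synonym 'a frame = "'a \<times> (2 \<Rightarrow> 'a tvec)"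

definition frame_bundle :: "'a topology \<Rightarrow> 'a chart set \<Rightarrow> 'a metric \<Rightarrow> 'a frame set" where
  "frame_bundle X A g = {(p, e). p \<in> topspace X \<and>
     (\<forall>i. e i \<in> tangent_at A p) \<and>
     (\<forall>i j. g p (e i) (e j) = (if i = j then 1 else 0)) \<and>
     (\<forall>c\<in>A. p \<in> fst c \<longrightarrow> 0 < det (\<chi> i. e i c))}"

text \<open>
  Over the domain of a chart c, the frame bundle is identified with an embedded 3-dimensional
  submanifold of the Euclidean space \<open>(real^2) \<times> (real^2^2)\<close>: the frame \<open>(p, e)\<close> corresponds to
  \<open>(x, E)\<close> where x is the coordinate vector of p and the rows of E are the components of
  the vectors of the frame.
\<close>

type_synonym surf_coords = "(real^2) \<times> (real^2^2)"

definition frame_coords :: "'a chart \<Rightarrow> 'a frame \<Rightarrow> surf_coords" where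
  "frame_coords c P = (snd c (fst P), \<chi> i. snd P i c)"

definition frames_over :: "'a topology \<Rightarrow> 'a chart set \<Rightarrow> 'a metric \<Rightarrow> 'a chart \<Rightarrow> 'a frame set" where
  "frames_over X A g c = {P \<in> frame_bundle X A g. fst P \<in> fst c}"

definition frame_patch :: "'a topology \<Rightarrow> 'a chart set \<Rightarrow> 'a metric \<Rightarrow> 'a chart \<Rightarrow> surf_coords set" where
  "frame_patch X A g c = frame_coords c ` frames_over X A g c"

definition frame_at ::
    "'a topology \<Rightarrow> 'a chart set \<Rightarrow> 'a metric \<Rightarrow> 'a chart \<Rightarrow> surf_coords \<Rightarrow> 'a frame" where
  "frame_at X A g c = inv_into (frames_over X A g c) (frame_coords c)"

text \<open>
  Differential forms on submanifolds of a Euclidean space are written as forms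
  \<open>P \<mapsto> v \<mapsto> \<alpha> P v\<close> of the ambient space and evaluated on tangent vectors of the submanifold.
  The canonical forms are \<open>\<eta>\<^sup>i = g(e\<^sub>i, dx)\<close>, and \<open>conn A g c i j\<close> is
  \<open>\<eta>\<^sup>i\<^sub>j = g(e\<^sub>i, \<nabla>e\<^sub>j)\<close>, with upper index i and lower index j.
\<close>

definition eta :: "'a chart set \<Rightarrow> 'a metric \<Rightarrow> 'a chart \<Rightarrow> 2 \<Rightarrow> surf_coords \<Rightarrow> surf_coords \<Rightarrow> real" where
  "eta A g c i P v = metric_in A g c (fst P) (snd P $ i) (fst v)"

definition conn ::
    "'a chart set \<Rightarrow> 'a metric \<Rightarrow> 'a chart \<Rightarrow> 2 \<Rightarrow> 2 \<Rightarrow> surf_coords \<Rightarrow> surf_coords \<Rightarrow> real" where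
  "conn A g c i j P v = metric_in A g c (fst P) (snd P $ i)
     (snd v $ j + (\<chi> l. \<Sum>m\<in>UNIV. \<Sum>n\<in>UNIV.
        christoffel A g c l m n (fst P) * fst v $ m * snd P $ j $ n))"

section \<open>The orthonormal frame bundle of Euclidean 3-space\<close>

text \<open>A point \<open>(\<rho>, E)\<close> has frame vectors \<open>e\<^sub>i = E $ i\<close>. From \<open>d\<rho> = e\<^sub>i \<omega>\<^sup>i\<close> and
  \<open>de\<^sub>i = e\<^sub>j \<omega>\<^sup>j\<^sub>i\<close> one has \<open>\<omega>\<^sup>i = e\<^sub>i \<bullet> d\<rho>\<close> and \<open>\<omega>\<^sup>i\<^sub>j = e\<^sub>i \<bullet> de\<^sub>j\<close>;
  the latter is \<open>omega_conn i j\<close>.\<close>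

type_synonym euc_frame = "(real^3) \<times> (real^3^3)"

definition euc_frame_bundle :: "euc_frame set" where
  "euc_frame_bundle = {(\<rho>, E). \<forall>i j. E $ i \<bullet> E $ j = (if i = j then 1 else 0)}"

definition omega :: "3 \<Rightarrow> euc_frame \<Rightarrow> euc_frame \<Rightarrow> real" where
  "omega i P v = snd P $ i \<bullet> fst v"

definition omega_conn :: "3 \<Rightarrow> 3 \<Rightarrow> euc_frame \<Rightarrow> euc_frame \<Rightarrow> real" where
  "omega_conn i j P v = snd P $ i \<bullet> snd v $ j"

section \<open>Exterior calculus on submanifolds of Euclidean spaces\<close>

definition curve_in :: "'e::euclidean_space set \<Rightarrow> 'e \<Rightarrow> 'e \<Rightarrow> (real \<Rightarrow> 'e) \<Rightarrow> bool" where
  "curve_in S P v \<gamma> \<longleftrightarrow> (\<forall>t. \<gamma> t \<in> S) \<and> \<gamma> 0 = P \<and> (\<gamma> has_vector_derivative v) (at 0)"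

definition tangent_space :: "'e::euclidean_space set \<Rightarrow> 'e \<Rightarrow> 'e set" where
  "tangent_space S P = {v. \<exists>\<gamma>. curve_in S P v \<gamma>}"

text \<open>For an embedded submanifold S, requiring this along all curves that are differentiable at 0
  is equivalent to differentiability of f on S at P with differential L on the tangent space.\<close>

definition has_differential_on ::
    "('e::euclidean_space \<Rightarrow> real) \<Rightarrow> ('e \<Rightarrow> real) \<Rightarrow> 'e set \<Rightarrow> 'e \<Rightarrow> bool" where
  "has_differential_on f L S P \<longleftrightarrow>
     (\<forall>v \<gamma>. curve_in S P v \<gamma> \<longrightarrow> ((\<lambda>t. f (\<gamma> t)) has_real_derivative L v) (at 0))"

type_synonym 'e cform = "'e \<Rightarrow> 'e \<Rightarrow> complex"

definition smooth_cform :: "'e::euclidean_space set \<Rightarrow> 'e cform \<Rightarrow> bool" where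
  "smooth_cform V \<alpha> \<longleftrightarrow> (\<forall>P\<in>V. linear (\<alpha> P)) \<and> (\<forall>v. smooth_on V (\<lambda>P. \<alpha> P v))"

definition ext_deriv :: "'e::euclidean_space cform \<Rightarrow> 'e \<Rightarrow> 'e \<Rightarrow> 'e \<Rightarrow> complex" where
  "ext_deriv \<alpha> P u v = frechet_derivative (\<lambda>Q. \<alpha> Q v) (at P) u
                     - frechet_derivative (\<lambda>Q. \<alpha> Q u) (at P) v"

text \<open>Complex covectors of S at P are represented by functionals on the ambient space, two of which
  are identified if they agree on the tangent space of S at P. The fibre at P of the
  complex span of a list of 1-forms:\<close>

definition cspan_at :: "'e::euclidean_space set \<Rightarrow> 'e cform list \<Rightarrow> 'e \<Rightarrow> ('e \<Rightarrow> complex) set" where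
  "cspan_at S \<alpha>s P = {\<phi>. linear \<phi> \<and>
     (\<exists>a::nat \<Rightarrow> complex. \<forall>v\<in>tangent_space S P. \<phi> v = (\<Sum>i<length \<alpha>s. a i * (\<alpha>s ! i) P v))}"

definition cindep_at :: "'e::euclidean_space set \<Rightarrow> 'e cform list \<Rightarrow> 'e \<Rightarrow> bool" where
  "cindep_at S \<alpha>s P \<longleftrightarrow>
     (\<forall>a::nat \<Rightarrow> complex. (\<forall>v\<in>tangent_space S P. (\<Sum>i<length \<alpha>s. a i * (\<alpha>s ! i) P v) = 0)
        \<longrightarrow> (\<forall>i<length \<alpha>s. a i = 0))"

text \<open>The smooth forms \<open>\<alpha>s\<close> restrict to a frame of a complex subbundle, over \<open>S \<inter> V\<close>, of the
  complexified cotangent bundle of S.\<close>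

definition subbundle_frame :: "'e::euclidean_space set \<Rightarrow> 'e set \<Rightarrow> 'e cform list \<Rightarrow> bool" where
  "subbundle_frame S V \<alpha>s \<longleftrightarrow>
     (\<forall>\<alpha>\<in>set \<alpha>s. smooth_cform V \<alpha>) \<and> (\<forall>P\<in>S \<inter> V. cindep_at S \<alpha>s P)"

definition section_of :: "'e::euclidean_space set \<Rightarrow> 'e set \<Rightarrow> 'e cform list \<Rightarrow> 'e cform \<Rightarrow> bool" where
  "section_of S V \<alpha>s \<alpha> \<longleftrightarrow> smooth_cform V \<alpha> \<and> (\<forall>P\<in>S \<inter> V. \<alpha> P \<in> cspan_at S \<alpha>s P)"

text \<open>\<open>d\<alpha> \<equiv> 0\<close> modulo \<open>\<alpha>s\<close> at P: the 2-form is a sum of \<open>\<beta>\<^sub>i \<and> \<alpha>\<^sub>i\<close>.\<close>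

definition ext_deriv_congruent_0 :: "'e::euclidean_space set \<Rightarrow> 'e cform list \<Rightarrow> 'e cform \<Rightarrow> 'e \<Rightarrow> bool" where
  "ext_deriv_congruent_0 S \<alpha>s \<alpha> P \<longleftrightarrow>
     (\<exists>\<beta>::nat \<Rightarrow> 'e \<Rightarrow> complex. (\<forall>i. linear (\<beta> i)) \<and>
        (\<forall>u\<in>tangent_space S P. \<forall>v\<in>tangent_space S P.
           ext_deriv \<alpha> P u v =
             (\<Sum>i<length \<alpha>s. \<beta> i u * (\<alpha>s ! i) P v - \<beta> i v * (\<alpha>s ! i) P u)))"

definition frobenius :: "'e::euclidean_space set \<Rightarrow> 'e set \<Rightarrow> 'e cform list \<Rightarrow> bool" where
  "frobenius S V \<alpha>s \<longleftrightarrow>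
     (\<forall>U \<alpha>. open U \<longrightarrow> U \<subseteq> V \<longrightarrow> section_of S U \<alpha>s \<alpha> \<longrightarrow>
        (\<forall>P\<in>S \<inter> U. ext_deriv_congruent_0 S \<alpha>s \<alpha> P))"

section \<open>The isometric embedding system\<close>

type_synonym coords = "surf_coords \<times> euc_frame"

definition embedding_forms :: "'a chart set \<Rightarrow> 'a metric \<Rightarrow> 'a chart \<Rightarrow> coords cform list" where
  "embedding_forms A g c =
    [\<lambda>P v. of_real (omega 3 (snd P) (snd v)),
     \<lambda>P v. of_real (omega 1 (snd P) (snd v) - eta A g c 1 (fst P) (fst v)),
     \<lambda>P v. of_real (omega 2 (snd P) (snd v) - eta A g c 2 (fst P) (fst v)),
     \<lambda>P v. of_real (omega_conn 1 2 (snd P) (snd v) - conn A g c 1 2 (fst P) (fst v))]"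

definition singular_forms ::
    "'a chart set \<Rightarrow> 'a metric \<Rightarrow> ('a \<Rightarrow> real) \<Rightarrow> 'a chart \<Rightarrow> coords cform list" where
  "singular_forms A g K c = (let k = \<lambda>P. sqrt (K (chart_inv c (fst (fst P)))) in
     embedding_forms A g c @
    [\<lambda>P v. of_real (omega_conn 3 1 (snd P) (snd v)) - \<i> * of_real (k P * eta A g c 2 (fst P) (fst v)),
     \<lambda>P v. of_real (omega_conn 3 2 (snd P) (snd v)) + \<i> * of_real (k P * eta A g c 1 (fst P) (fst v))])"

text \<open>Darboux integrability is local on the product of the two frame bundles and invariant under
  changes of coordinates; it is expressed in every chart around the base point. The subbundle
  F is given by a local frame, whose length is its complex rank.\<close>

definition darboux_integrable ::
    "'a topology \<Rightarrow> 'a chart set \<Rightarrow> 'a metric \<Rightarrow> ('a \<Rightarrow> real) \<Rightarrow> bool" where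
  "darboux_integrable X A g K \<longleftrightarrow>
     (\<forall>P\<in>frame_bundle X A g. \<forall>Q\<in>euc_frame_bundle. \<forall>c\<in>A. fst P \<in> fst c \<longrightarrow>
        (let S = frame_patch X A g c \<times> euc_frame_bundle in
         \<exists>V F. open V \<and> (frame_coords c P, Q) \<in> V \<and>
           subbundle_frame S V F \<and> 2 \<le> length F \<and> frobenius S V F \<and>
           (\<forall>z\<in>S \<inter> V.
              cspan_at S F z \<subseteq> cspan_at S (singular_forms A g K c) z \<and>
              (\<forall>\<phi>\<in>cspan_at S F z \<inter> cspan_at S (embedding_forms A g c) z.
                 \<forall>v\<in>tangent_space S z. \<phi> v = 0))))"

section \<open>Covariant derivatives of functions on the frame bundle\<close>

text \<open>\<open>df = f\<^sub>j \<eta>\<^sup>j\<close> and \<open>df\<^sub>i = f\<^sub>j \<eta>\<^sup>j\<^sub>i + f\<^sub>i\<^sub>j \<eta>\<^sup>j\<close> on the frame bundle;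
  these equations determine \<open>f1 i\<close> and \<open>f2 i j\<close> there uniquely.\<close>

definition covariant_derivatives ::
    "'a topology \<Rightarrow> 'a chart set \<Rightarrow> 'a metric \<Rightarrow> ('a frame \<Rightarrow> real) \<Rightarrow>
     (2 \<Rightarrow> 'a frame \<Rightarrow> real) \<Rightarrow> (2 \<Rightarrow> 2 \<Rightarrow> 'a frame \<Rightarrow> real) \<Rightarrow> bool" where
  "covariant_derivatives X A g f f1 f2 \<longleftrightarrow>
     (\<forall>c\<in>A. \<forall>P\<in>frames_over X A g c.
        has_differential_on (f \<circ> frame_at X A g c)
          (\<lambda>v. \<Sum>j\<in>UNIV. f1 j P * eta A g c j (frame_coords c P) v)
          (frame_patch X A g c) (frame_coords c P) \<and>
        (\<forall>i. has_differential_on (f1 i \<circ> frame_at X A g c)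
          (\<lambda>v. (\<Sum>j\<in>UNIV. f1 j P * conn A g c j i (frame_coords c P) v)
             + (\<Sum>j\<in>UNIV. f2 i j P * eta A g c j (frame_coords c P) v))
          (frame_patch X A g c) (frame_coords c P)))"

end

theory Submission
  imports Defs
begin

text \<open>
  Let \<open>s\<^sub>1 = \<omega>\<^sup>3\<^sub>1 - \<i>k\<eta>\<^sup>2\<close> and \<open>s\<^sub>2 = \<omega>\<^sup>3\<^sub>2 + \<i>k\<eta>\<^sup>1\<close>. A subbundle F as required is spanned by two
  forms \<open>\<phi>\<^sub>1 = s\<^sub>1 + \<Sum>a\<^sub>i \<theta>\<^sub>i\<close> and \<open>\<phi>\<^sub>2 = s\<^sub>2 + \<Sum>b\<^sub>i \<theta>\<^sub>i\<close>. If \<open>dk = k\<^sub>i \<eta>\<^sup>i\<close> and the equations for q hold, then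
  \<open>a\<^sub>3 = -\<i>k\<^sub>1/(2k\<^sup>2)\<close>, \<open>b\<^sub>3 = -\<i>k\<^sub>2/(2k\<^sup>2)\<close>, with all other coefficients 0, gives a Frobenius F.

  Conversely, the Frobenius condition for F prescribes the derivatives of all \<open>a\<^sub>i, b\<^sub>i\<close> in the two
  complex directions \<open>V\<^sub>1, V\<^sub>2\<close> that are dual to \<open>\<eta>\<^sup>1, \<eta>\<^sup>2\<close> and annihilated by the \<open>\<theta>\<^sub>i\<close> and by F, and forces
  \<open>k\<^sub>1/(2k) = a\<^sub>0 + \<i>k a\<^sub>3\<close>, \<open>k\<^sub>2/(2k) = b\<^sub>0 + \<i>k b\<^sub>3\<close>. Hence the second derivatives of k are polynomials
  in the coefficients. Differentiating the symmetry of the Hessian of k twice in the directions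
  \<open>V\<^sub>1, V\<^sub>2\<close> yields algebraic equations whose only solution is the stated one.
\<close>

section \<open>Calculus of smooth maps\<close>

text \<open>Modulo the \<theta>'s, W has rank 2, so a subbundle of rank at least 2 that meets their
  span only in 0 projects isomorphically to the quotient; Cramer's rule then normalises two of its
  sections to \<open>\<phi>\<^sub>1\<close>, \<open>\<phi>\<^sub>2\<close>. The obstacle in the
  converse: eight unknown coefficients live on a nine-dimensional manifold, and their derivatives
  are used in two directions only. The compatibility conditions come from k, which is pulled back
  from M and thus has a symmetric Hessian. The last algebraic equation is a perfect square, whence
  uniqueness. The exponent of q linearises the outcome: the Hessian of k is \<open>k\<^sub>i\<^sub>j
  = (5/2) k\<^sub>i k\<^sub>j / k - 2 k^3 \<delta>\<^sub>i\<^sub>j\<close>. In the Hessian of a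
  power k^a the products \<open>k\<^sub>i k\<^sub>j\<close> get the factor a (a + 3/2), which
  vanishes for a = -3/2, and -2 k^3 turns into 3 k^(1/2) = 3 q^(-1/3). Forms on a submanifold are
  given by ambient representatives, so exterior derivatives must be shown to depend, on tangent
  vectors, on the restrictions alone.\<close>

lemma bounded_linear_axis: "bounded_linear (axis i :: 'f::euclidean_space \<Rightarrow> 'f^'i)"
  unfolding linear_conv_bounded_linear[symmetric] by (rule linearI) (auto simp: axis_def vec_eq_iff)

lemma vec_lambda_sum_axis:
  fixes f :: "'i::finite \<Rightarrow> 'f::euclidean_space"
  shows "(\<chi> i. f i) = (\<Sum>i\<in>UNIV. axis i (f i))"
  by (simp add: vec_eq_iff axis_def)

lemma has_derivative_vec_lambda:
  fixes f :: "'e::real_normed_vector \<Rightarrow> 'i::finite \<Rightarrow> 'f::euclidean_space"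
  assumes "\<And>i. ((\<lambda>x. f x i) has_derivative (\<lambda>h. f' h i)) F"
  shows "((\<lambda>x. \<chi> i. f x i) has_derivative (\<lambda>h. \<chi> i. f' h i)) F"
  unfolding vec_lambda_sum_axis
  by (intro has_derivative_sum bounded_linear.has_derivative[OF bounded_linear_axis] assms)

text \<open>Differentiability and the value of \<open>frechet_derivative\<close> at a point are
  local, so openness of S lets the induction replace f by h in every derivative.\<close>

lemma Ck_on_cong_aux:
  fixes f h :: "'e::euclidean_space \<Rightarrow> 'f::real_normed_vector"
  assumes "open S" "\<And>x. x \<in> S \<Longrightarrow> f x = h x" "Ck_on n S f"
  shows "Ck_on n S h"
  using assms(2,3)
proof (induction n arbitrary: f h)
  case 0
  then show ?case by (metis Ck_on.simps(1) continuous_on_cong)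
next
  case (Suc n)
  have eq: "frechet_derivative f (at x) = frechet_derivative h (at x)" and dh: "h differentiable (at x)" if "x \<in> S" for x
  proof -
    have "f differentiable (at x)"
      using Suc.prems(2) that by auto
    then have *: "(f has_derivative frechet_derivative f (at x)) (at x)"
      by (simp add: frechet_derivative_works)
    have **: "(h has_derivative frechet_derivative f (at x)) (at x)"
      by (rule has_derivative_transform_within_open[OF * assms(1) that]) (use Suc.prems in auto)
    show "h differentiable (at x)"
      using ** by (auto simp: differentiable_def)
    show "frechet_derivative f (at x) = frechet_derivative h (at x)"
      using frechet_derivative_at[OF **] by simp
  qed
  have "Ck_on n S (\<lambda>x. frechet_derivative h (at x) v)" for v
    by (rule Suc.IH[of "\<lambda>x. frechet_derivative f (at x) v"]) (use eq Suc.prems in auto)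
  then show ?case
    using dh by auto
qed

lemma Ck_on_SucD: "Ck_on (Suc n) S f \<Longrightarrow> Ck_on n S f"
proof (induction n arbitrary: f)
  case 0
  then show ?case
    by (auto intro!: continuous_at_imp_continuous_on differentiable_imp_continuous_within)
next
  case (Suc n)
  then show ?case by simp
qed

lemma Ck_on_subset: "Ck_on n S f \<Longrightarrow> T \<subseteq> S \<Longrightarrow> Ck_on n T f"
proof (induction n arbitrary: f)
  case 0
  then show ?case by (auto intro: continuous_on_subset)
next
  case (Suc n)
  then show ?case by (auto)
qed

text \<open>\<open>frechet_derivative\<close> is a choice operator; this rule trades it for an
  explicit derivative, which is what the inductions for sums, products, inverses and powers
  supply.\<close>

lemma Ck_on_SucI:
  fixes f :: "'e::euclidean_space \<Rightarrow> 'f::real_normed_vector"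
  assumes "open S" "\<And>x. x \<in> S \<Longrightarrow> (f has_derivative f' x) (at x)"
    and "\<And>v. Ck_on n S (\<lambda>x. f' x v)"
  shows "Ck_on (Suc n) S f"
proof -
  have "frechet_derivative f (at x) = f' x" if "x \<in> S" for x
    using frechet_derivative_at[OF assms(2)[OF that]] by simp
  then have "Ck_on n S (\<lambda>x. frechet_derivative f (at x) v)" for v
    by (intro Ck_on_cong_aux[OF assms(1) _ assms(3)[of v]]) auto
  moreover have "\<forall>x\<in>S. f differentiable (at x)"
    using assms(2) by (auto simp: differentiable_def)
  ultimately show ?thesis by simp
qed

lemma Ck_on_SucE:
  assumes "Ck_on (Suc n) S f"
  shows "\<And>x. x \<in> S \<Longrightarrow> (f has_derivative frechet_derivative f (at x)) (at x)"
    and "\<And>v. Ck_on n S (\<lambda>x. frechet_derivative f (at x) v)" "Ck_on n S f"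
proof -
  show "\<And>x. x \<in> S \<Longrightarrow> (f has_derivative frechet_derivative f (at x)) (at x)"
    using assms by (simp add: frechet_derivative_works)
  show "\<And>v. Ck_on n S (\<lambda>x. frechet_derivative f (at x) v)"
    using assms by simp
  show "Ck_on n S f"
    using assms by (rule Ck_on_SucD)
qed

lemma Ck_on_const: "open S \<Longrightarrow> Ck_on n S (\<lambda>x. c)"
proof (induction n arbitrary: c)
  case (Suc n)
  show ?case
    by (rule Ck_on_SucI[where f' = "\<lambda>x v. 0"]) (use Suc in auto)
qed simp

lemma Ck_on_linear: "open S \<Longrightarrow> bounded_linear f \<Longrightarrow> Ck_on n S f"
proof (induction n)
  case 0
  then show ?case by (simp add: linear_continuous_on)
next
  case (Suc n)
  show ?case
    by (rule Ck_on_SucI[where f' = "\<lambda>x. f"])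
      (use Suc in \<open>auto intro: bounded_linear_imp_has_derivative Ck_on_const\<close>)
qed

lemma Ck_on_add: "open S \<Longrightarrow> Ck_on n S f \<Longrightarrow> Ck_on n S h \<Longrightarrow> Ck_on n S (\<lambda>x. f x + h x)"
proof (induction n arbitrary: f h)
  case 0
  then show ?case by (auto intro: continuous_on_add)
next
  case (Suc n)
  note f = Ck_on_SucE[OF Suc.prems(2)] and h = Ck_on_SucE[OF Suc.prems(3)]
  show ?case
    by (rule Ck_on_SucI[OF Suc.prems(1) has_derivative_add[OF f(1) h(1)]])
      (auto intro!: Suc.IH Suc.prems f h)
qed

lemma Ck_on_bounded_linear:
  "open S \<Longrightarrow> bounded_linear L \<Longrightarrow> Ck_on n S f \<Longrightarrow> Ck_on n S (\<lambda>x. L (f x))"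
proof (induction n arbitrary: f)
  case 0
  then show ?case by (auto intro: bounded_linear.continuous_on)
next
  case (Suc n)
  note f = Ck_on_SucE[OF Suc.prems(3)]
  show ?case
    by (rule Ck_on_SucI[OF Suc.prems(1) bounded_linear.has_derivative[OF Suc.prems(2) f(1)]])
      (auto intro!: Suc.IH Suc.prems f)
qed

lemma Ck_on_bounded_bilinear:
  assumes "open S" "bounded_bilinear B"
  shows "Ck_on n S f \<Longrightarrow> Ck_on n S h \<Longrightarrow> Ck_on n S (\<lambda>x. B (f x) (h x))"
proof (induction n arbitrary: f h)
  case 0
  then show ?case by (auto intro: bounded_bilinear.continuous_on[OF assms(2)])
next
  case (Suc n)
  note f = Ck_on_SucE[OF Suc.prems(1)] and h = Ck_on_SucE[OF Suc.prems(2)]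
  show ?case
    by (rule Ck_on_SucI[OF assms(1) bounded_bilinear.FDERIV[OF assms(2) f(1) h(1)]])
      (auto intro!: Ck_on_add Suc.IH assms f h)
qed

lemma Ck_on_comp_linear:
  fixes L :: "'d::euclidean_space \<Rightarrow> 'e::euclidean_space"
  assumes "bounded_linear L" "open S" "open T" "L ` T \<subseteq> S"
  shows "Ck_on n S f \<Longrightarrow> Ck_on n T (\<lambda>x. f (L x))"
proof (induction n arbitrary: f)
  case 0
  then show ?case
    using assms by (auto intro: continuous_on_compose2 linear_continuous_on)
next
  case (Suc n)
  note f = Ck_on_SucE[OF Suc.prems]
  have "((\<lambda>x. f (L x)) has_derivative (\<lambda>v. frechet_derivative f (at (L x)) (L v))) (at x)" if "x \<in> T" for x
    using has_derivative_compose[OF bounded_linear_imp_has_derivative[OF assms(1)] f(1)] that assms(4) by auto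
  then show ?case
    by (rule Ck_on_SucI[OF assms(3)]) (auto intro!: Suc.IH f)
qed

lemma Ck_on_inverse:
  fixes f :: "'e::euclidean_space \<Rightarrow> 'f::{real_normed_field}"
  assumes "open S" "\<And>x. x \<in> S \<Longrightarrow> f x \<noteq> 0"
  shows "Ck_on n S f \<Longrightarrow> Ck_on n S (\<lambda>x. inverse (f x))"
proof (induction n)
  case 0
  then show ?case using assms by (auto intro: continuous_on_inverse)
next
  case (Suc n)
  note f = Ck_on_SucE[OF Suc.prems(1)]
  have *: "((\<lambda>x. inverse (f x)) has_derivative
     (\<lambda>v. - (inverse (f x) * frechet_derivative f (at x) v * inverse (f x)))) (at x)" if "x \<in> S" for x
    using Deriv.has_derivative_inverse[OF assms(2)[OF that] f(1)[OF that]] .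
  show ?case
    by (rule Ck_on_SucI[OF assms(1) *])
      (auto intro!: Ck_on_bounded_linear[OF assms(1) bounded_linear_minus[OF bounded_linear_ident]]
        Ck_on_bounded_bilinear[OF assms(1) bounded_bilinear_mult] Suc.IH f)
qed

text \<open>The exponent is generalised in the induction because differentiation lowers it to
  \<open>a - 1\<close>.\<close>

lemma Ck_on_powr:
  fixes f :: "'e::euclidean_space \<Rightarrow> real"
  assumes "open S" "\<And>x. x \<in> S \<Longrightarrow> f x > 0"
  shows "Ck_on n S f \<Longrightarrow> Ck_on n S (\<lambda>x. f x powr a)"
proof (induction n arbitrary: a)
  case 0
  then show ?case using assms by (fastforce intro!: continuous_on_powr continuous_intros)
next
  case (Suc n)
  note f = Ck_on_SucE[OF Suc.prems(1)]
  have *: "((\<lambda>x. f x powr a) has_derivative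
     (\<lambda>v. (a * f x powr (a - 1)) * frechet_derivative f (at x) v)) (at x)" if "x \<in> S" for x
    by (rule has_derivative_eq_rhs[OF has_derivative_powr[OF f(1)[OF that] has_derivative_const assms(2)[OF that]]])
      (use assms(2)[OF that] that in \<open>auto simp: powr_diff field_simps\<close>)
  show ?case
    by (rule Ck_on_SucI[OF assms(1) *])
      (auto intro!: Ck_on_bounded_bilinear[OF assms(1) bounded_bilinear_mult] Ck_on_const assms Suc.IH f)
qed

section \<open>Closure properties of smooth maps\<close>

lemma smooth_on_cong:
  assumes "open S" "\<And>x. x \<in> S \<Longrightarrow> f x = h x" "smooth_on S f"
  shows "smooth_on S h"
  using assms Ck_on_cong_aux unfolding smooth_on_def by blast

lemma smooth_on_subset: "smooth_on S f \<Longrightarrow> T \<subseteq> S \<Longrightarrow> smooth_on T f"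
  unfolding smooth_on_def using Ck_on_subset by blast

lemma smooth_on_has_derivative:
  "smooth_on S f \<Longrightarrow> x \<in> S \<Longrightarrow> (f has_derivative frechet_derivative f (at x)) (at x)"
  unfolding smooth_on_def using Ck_on_SucE(1)[of 0 S f x] by blast

lemma smooth_on_frechet_derivative:
  "smooth_on S f \<Longrightarrow> smooth_on S (\<lambda>x. frechet_derivative f (at x) v)"
  unfolding smooth_on_def using Ck_on_SucE(2) by blast

lemma smooth_on_imp_continuous_on: "smooth_on S f \<Longrightarrow> continuous_on S f"
  unfolding smooth_on_def using Ck_on.simps(1) by blast

context
  fixes S :: "'e::euclidean_space set"
  assumes S: "open S"
begin

lemma smooth_on_const: "smooth_on S (\<lambda>x. c)"
  unfolding smooth_on_def using Ck_on_const[OF S] by blast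

lemma smooth_on_linear: "bounded_linear f \<Longrightarrow> smooth_on S f"
  unfolding smooth_on_def using Ck_on_linear[OF S] by blast

lemma smooth_on_add: "smooth_on S f \<Longrightarrow> smooth_on S h \<Longrightarrow> smooth_on S (\<lambda>x. f x + h x)"
  unfolding smooth_on_def using Ck_on_add[OF S] by blast

lemma smooth_on_bounded_linear:
  "bounded_linear L \<Longrightarrow> smooth_on S f \<Longrightarrow> smooth_on S (\<lambda>x. L (f x))"
  unfolding smooth_on_def using Ck_on_bounded_linear[OF S] by blast

lemma smooth_on_bounded_bilinear:
  "bounded_bilinear B \<Longrightarrow> smooth_on S f \<Longrightarrow> smooth_on S h \<Longrightarrow> smooth_on S (\<lambda>x. B (f x) (h x))"
  unfolding smooth_on_def using Ck_on_bounded_bilinear[OF S] by blast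

lemma smooth_on_minus: "smooth_on S f \<Longrightarrow> smooth_on S (\<lambda>x. - f x)"
  by (rule smooth_on_bounded_linear[OF bounded_linear_minus[OF bounded_linear_ident]])

lemma smooth_on_diff: "smooth_on S f \<Longrightarrow> smooth_on S h \<Longrightarrow> smooth_on S (\<lambda>x. f x - h x)"
  using smooth_on_add[OF _ smooth_on_minus, of f h] by simp

lemma smooth_on_mult:
  fixes f h :: "'e \<Rightarrow> 'f::real_normed_algebra"
  shows "smooth_on S f \<Longrightarrow> smooth_on S h \<Longrightarrow> smooth_on S (\<lambda>x. f x * h x)"
  by (rule smooth_on_bounded_bilinear[OF bounded_bilinear_mult])

lemma smooth_on_scaleR: "smooth_on S f \<Longrightarrow> smooth_on S h \<Longrightarrow> smooth_on S (\<lambda>x. f x *\<^sub>R h x)"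
  by (rule smooth_on_bounded_bilinear[OF bounded_bilinear_scaleR])

lemma smooth_on_of_real:
  "smooth_on S f \<Longrightarrow> smooth_on S (\<lambda>x. of_real (f x) :: 'f::{real_normed_algebra_1})"
  by (rule smooth_on_bounded_linear[OF bounded_linear_of_real])

lemma smooth_on_sum: "(\<And>i. i \<in> I \<Longrightarrow> smooth_on S (f i)) \<Longrightarrow> smooth_on S (\<lambda>x. \<Sum>i\<in>I. f i x)"
  by (induction I rule: infinite_finite_induct) (auto intro: smooth_on_const smooth_on_add)

lemma smooth_on_inverse:
  fixes f :: "'e \<Rightarrow> 'f::real_normed_field"
  shows "smooth_on S f \<Longrightarrow> (\<And>x. x \<in> S \<Longrightarrow> f x \<noteq> 0) \<Longrightarrow> smooth_on S (\<lambda>x. inverse (f x))"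
  unfolding smooth_on_def using Ck_on_inverse[OF S] by blast

lemma smooth_on_divide:
  fixes f h :: "'e \<Rightarrow> 'f::real_normed_field"
  shows "smooth_on S f \<Longrightarrow> smooth_on S h \<Longrightarrow> (\<And>x. x \<in> S \<Longrightarrow> h x \<noteq> 0) \<Longrightarrow> smooth_on S (\<lambda>x. f x / h x)"
  unfolding divide_inverse by (intro smooth_on_mult smooth_on_inverse) auto

lemma smooth_on_powr:
  fixes f :: "'e \<Rightarrow> real"
  shows "smooth_on S f \<Longrightarrow> (\<And>x. x \<in> S \<Longrightarrow> f x > 0) \<Longrightarrow> smooth_on S (\<lambda>x. f x powr a)"
  unfolding smooth_on_def by (intro allI Ck_on_powr[OF S]) auto

lemma smooth_on_sqrt:
  assumes "smooth_on S f" "\<And>x. x \<in> S \<Longrightarrow> f x > 0"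
  shows "smooth_on S (\<lambda>x. sqrt (f x))"
  by (rule smooth_on_cong[OF S _ smooth_on_powr[OF assms, where a = "1/2"]])
    (use assms(2) in \<open>auto simp: powr_half_sqrt less_imp_le\<close>)

lemma smooth_on_comp_linear:
  "bounded_linear L \<Longrightarrow> open T \<Longrightarrow> L ` S \<subseteq> T \<Longrightarrow> smooth_on T f \<Longrightarrow> smooth_on S (\<lambda>x. f (L x))"
  unfolding smooth_on_def using Ck_on_comp_linear[OF _ _ S] by blast

lemma smooth_on_vec_lambda:
  fixes f :: "'e \<Rightarrow> 'i::finite \<Rightarrow> 'f::euclidean_space"
  assumes "\<And>i. smooth_on S (\<lambda>x. f x i)"
  shows "smooth_on S (\<lambda>x. \<chi> i. f x i)"
proof -
  have "smooth_on S (\<lambda>x. axis i (f x i))" for i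
    using smooth_on_bounded_linear[OF bounded_linear_axis assms] by blast
  from smooth_on_sum[of UNIV, OF this] show ?thesis
    by (simp only: vec_lambda_sum_axis)
qed

lemma smooth_on_Pair:
  fixes f :: "'e \<Rightarrow> 'f::real_normed_vector" and h :: "'e \<Rightarrow> 'g::real_normed_vector"
  assumes "smooth_on S f" "smooth_on S h"
  shows "smooth_on S (\<lambda>x. (f x, h x))"
proof -
  have 1: "bounded_linear (\<lambda>x. (x::'f, 0::'g))" "bounded_linear (\<lambda>x. (0::'f, x::'g))"
    by (auto intro: bounded_linear_Pair bounded_linear_ident bounded_linear_zero)
  have "(\<lambda>x. (f x, h x)) = (\<lambda>x. (f x, 0) + (0, h x))"
    by simp
  then show ?thesis
    using smooth_on_add[OF smooth_on_bounded_linear[OF 1(1) assms(1)] smooth_on_bounded_linear[OF 1(2) assms(2)]]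
    by simp
qed

end

section \<open>Symmetry of second derivatives\<close>

text \<open>Two applications of the mean value theorem: in direction u to the difference of f at
  points that differ by s v, then in direction v to the resulting difference of first
  derivatives.\<close>

lemma mixed_difference:
  fixes f :: "'e::euclidean_space \<Rightarrow> real"
  assumes S: "open S" "smooth_on S f" and s: "s > 0"
    and sub: "\<And>a b. a \<in> {0..s} \<Longrightarrow> b \<in> {0..s} \<Longrightarrow> x + a *\<^sub>R u + b *\<^sub>R v \<in> S"
  shows "\<exists>a\<in>{0..s}. \<exists>b\<in>{0..s}.
     f (x + s *\<^sub>R u + s *\<^sub>R v) - f (x + s *\<^sub>R u) - f (x + s *\<^sub>R v) + f x =
     s * s * frechet_derivative (\<lambda>y. frechet_derivative f (at y) u) (at (x + a *\<^sub>R u + b *\<^sub>R v)) v"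
proof -
  let ?D = "\<lambda>y. frechet_derivative f (at y) u"
  let ?D2 = "\<lambda>y. frechet_derivative ?D (at y) v"
  have f': "(f has_derivative frechet_derivative f (at y)) (at y)" if "y \<in> S" for y
    using smooth_on_has_derivative[OF S(2) that] .
  have D': "(?D has_derivative frechet_derivative ?D (at y)) (at y)" if "y \<in> S" for y
    using smooth_on_has_derivative[OF smooth_on_frechet_derivative[OF S(2)] that] .
  have 1: "((\<lambda>a. f (x + a *\<^sub>R u + b *\<^sub>R v)) has_real_derivative ?D (x + a *\<^sub>R u + b *\<^sub>R v)) (at a)"
    if "a \<in> {0..s}" "b \<in> {0..s}" for a b
  proof -
    note lin = linear_frechet_derivative[OF differentiableI[OF f'[OF sub[OF that]]]]
    have "((\<lambda>a. x + a *\<^sub>R u + b *\<^sub>R v) has_derivative (\<lambda>h. h *\<^sub>R u)) (at a)"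
      by (auto intro!: derivative_eq_intros)
    from has_derivative_compose[OF this f'[OF sub[OF that]]] show ?thesis
      unfolding has_field_derivative_def
      by (rule has_derivative_eq_rhs) (simp add: linear_scale[OF lin] mult.commute fun_eq_iff)
  qed
  have 2: "((\<lambda>b. ?D (x + a *\<^sub>R u + b *\<^sub>R v)) has_real_derivative ?D2 (x + a *\<^sub>R u + b *\<^sub>R v)) (at b)"
    if "a \<in> {0..s}" "b \<in> {0..s}" for a b
  proof -
    note lin = linear_frechet_derivative[OF differentiableI[OF D'[OF sub[OF that]]]]
    have "((\<lambda>b. x + a *\<^sub>R u + b *\<^sub>R v) has_derivative (\<lambda>h. h *\<^sub>R v)) (at b)"
      by (auto intro!: derivative_eq_intros)
    from has_derivative_compose[OF this D'[OF sub[OF that]]] show ?thesis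
      unfolding has_field_derivative_def
      by (rule has_derivative_eq_rhs) (simp add: linear_scale[OF lin] mult.commute fun_eq_iff)
  qed
  have "\<exists>a. 0 < a \<and> a < s \<and>
     (f (x + s *\<^sub>R u + s *\<^sub>R v) - f (x + s *\<^sub>R u + 0 *\<^sub>R v)) - (f (x + 0 *\<^sub>R u + s *\<^sub>R v) - f (x + 0 *\<^sub>R u + 0 *\<^sub>R v)) =
     (s - 0) * (?D (x + a *\<^sub>R u + s *\<^sub>R v) - ?D (x + a *\<^sub>R u + 0 *\<^sub>R v))"
    using s by (intro MVT2 DERIV_diff 1) auto
  then obtain a where a: "0 < a" "a < s"
    "f (x + s *\<^sub>R u + s *\<^sub>R v) - f (x + s *\<^sub>R u) - f (x + s *\<^sub>R v) + f x =
       s * (?D (x + a *\<^sub>R u + s *\<^sub>R v) - ?D (x + a *\<^sub>R u + 0 *\<^sub>R v))"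
    by (auto simp: algebra_simps)
  have "\<exists>b. 0 < b \<and> b < s \<and> ?D (x + a *\<^sub>R u + s *\<^sub>R v) - ?D (x + a *\<^sub>R u + 0 *\<^sub>R v) =
     (s - 0) * ?D2 (x + a *\<^sub>R u + b *\<^sub>R v)"
    using s a by (intro MVT2 2) auto
  then obtain b where b: "0 < b" "b < s"
    "?D (x + a *\<^sub>R u + s *\<^sub>R v) - ?D (x + a *\<^sub>R u + 0 *\<^sub>R v) = s * ?D2 (x + a *\<^sub>R u + b *\<^sub>R v)"
    by auto
  show ?thesis
    using a b by (intro bexI[of _ a] bexI[of _ b]) (auto simp: a(3) b(3))
qed

text \<open>The double difference over a parallelogram is symmetric in u and v, so the two mixed
  derivatives take one common value at two points near x; by continuity they cannot differ at
  x.\<close>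

lemma frechet_derivative_commute:
  fixes f :: "'e::euclidean_space \<Rightarrow> real"
  assumes S: "open S" "smooth_on S f" "x \<in> S"
  shows "frechet_derivative (\<lambda>y. frechet_derivative f (at y) u) (at x) v =
         frechet_derivative (\<lambda>y. frechet_derivative f (at y) v) (at x) u"
proof (rule ccontr)
  let ?E = "\<lambda>y. frechet_derivative (\<lambda>y. frechet_derivative f (at y) u) (at y) v"
  let ?F = "\<lambda>y. frechet_derivative (\<lambda>y. frechet_derivative f (at y) v) (at y) u"
  assume ne: "?E x \<noteq> ?F x"
  define e where "e = \<bar>?E x - ?F x\<bar> / 2"
  have e: "e > 0" using ne by (simp add: e_def)
  have cE: "continuous (at x) ?E" and cF: "continuous (at x) ?F"
    using smooth_on_imp_continuous_on[OF smooth_on_frechet_derivative[OF smooth_on_frechet_derivative[OF S(2)]]]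
      S(1,3) continuous_on_eq_continuous_at by blast+
  obtain d1 where d1: "d1 > 0" "\<And>y. dist y x < d1 \<Longrightarrow> dist (?E y) (?E x) < e"
    using cE e unfolding continuous_at_eps_delta by metis
  obtain d2 where d2: "d2 > 0" "\<And>y. dist y x < d2 \<Longrightarrow> dist (?F y) (?F x) < e"
    using cF e unfolding continuous_at_eps_delta by metis
  obtain d3 where d3: "d3 > 0" "ball x d3 \<subseteq> S"
    using S(1,3) open_contains_ball by blast
  define d where "d = min d1 (min d2 d3)"
  have d: "d > 0" using d1 d2 d3 by (simp add: d_def)
  \<comment> \<open>The parallelogram with sides s u and s v stays within distance d of x; the
    summand 1 covers u = v = 0.\<close>
  define s where "s = d / (norm u + norm v + 1)"
  have s: "s > 0" using d by (simp add: s_def add_nonneg_pos)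
  have near: "dist (x + a *\<^sub>R u + b *\<^sub>R v) x < d" if "a \<in> {0..s}" "b \<in> {0..s}" for a b
  proof -
    have "norm (a *\<^sub>R u + b *\<^sub>R v) \<le> a * norm u + b * norm v"
      using that by (intro order_trans[OF norm_triangle_ineq]) auto
    also have "\<dots> \<le> s * norm u + s * norm v"
      using that by (intro add_mono mult_right_mono) auto
    also have "\<dots> < s * (norm u + norm v + 1)"
      using s by (simp add: algebra_simps)
    also have "\<dots> = d"
      by (simp add: s_def add_nonneg_pos less_imp_neq[symmetric])
    finally show ?thesis by (simp add: dist_norm add.assoc)
  qed
  have sub: "x + a *\<^sub>R u + b *\<^sub>R v \<in> S" if "a \<in> {0..s}" "b \<in> {0..s}" for a b
    using near[OF that] d3 by (auto simp: d_def dist_commute)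
  have sub': "x + a *\<^sub>R v + b *\<^sub>R u \<in> S" if "a \<in> {0..s}" "b \<in> {0..s}" for a b
    using sub[OF that(2,1)] by (simp add: algebra_simps)
  obtain a b where 1: "a \<in> {0..s}" "b \<in> {0..s}"
     "f (x + s *\<^sub>R u + s *\<^sub>R v) - f (x + s *\<^sub>R u) - f (x + s *\<^sub>R v) + f x = s * s * ?E (x + a *\<^sub>R u + b *\<^sub>R v)"
    using mixed_difference[OF S(1,2) s, of x u v] sub by blast
  obtain a' b' where 2: "a' \<in> {0..s}" "b' \<in> {0..s}"
     "f (x + s *\<^sub>R v + s *\<^sub>R u) - f (x + s *\<^sub>R v) - f (x + s *\<^sub>R u) + f x = s * s * ?F (x + a' *\<^sub>R v + b' *\<^sub>R u)"
    using mixed_difference[OF S(1,2) s, of x v u] sub' by blast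
  have "?E (x + a *\<^sub>R u + b *\<^sub>R v) = ?F (x + a' *\<^sub>R v + b' *\<^sub>R u)"
    using 1(3) 2(3) s by (simp add: algebra_simps)
  moreover have "dist (?E (x + a *\<^sub>R u + b *\<^sub>R v)) (?E x) < e"
    using near[OF 1(1,2)] by (intro d1) (simp add: d_def)
  moreover have "dist (?F (x + a' *\<^sub>R v + b' *\<^sub>R u)) (?F x) < e"
    using near[OF 2(2,1)] by (intro d2) (simp add: d_def algebra_simps)
  ultimately show False
    unfolding e_def dist_real_def by (simp add: abs_if split: if_splits)
qed

section \<open>Local Riemannian geometry in a chart\<close>

lemma vec2_expansion: "(u::real^2) = (u$1) *\<^sub>R axis 1 1 + (u$2) *\<^sub>R axis 2 1"
  by (simp add: vec_eq_iff forall_2 axis_def)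

locale metric_chart =
  fixes A :: "'a chart set" and g :: "'a metric" and c :: "'a chart"
  assumes riemannian: "riemannian_metric A g" and chart: "c \<in> A"
    and open_image: "open (chart_image c)"
begin

abbreviation "U \<equiv> chart_image c"
abbreviation "G \<equiv> metric_in A g c"
abbreviation "gm i j x \<equiv> metric_in A g c x (axis i 1) (axis j 1)"
abbreviation "chr \<equiv> christoffel A g c"

definition dG :: "real^2 \<Rightarrow> real^2 \<Rightarrow> real^2 \<Rightarrow> real^2 \<Rightarrow> real" where
  "dG x h u w = frechet_derivative (\<lambda>y. G y u w) (at x) h"

text \<open>The Christoffel symbols as a bilinear map: the covariant derivative of a field w along u
  is its ordinary derivative plus \<open>Gam x u w\<close>.\<close>

definition Gam :: "real^2 \<Rightarrow> real^2 \<Rightarrow> real^2 \<Rightarrow> real^2" where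
  "Gam x u w = (\<chi> l. \<Sum>m\<in>UNIV. \<Sum>n\<in>UNIV. chr l m n x * u $ m * w $ n)"

definition dGam :: "real^2 \<Rightarrow> real^2 \<Rightarrow> real^2 \<Rightarrow> real^2 \<Rightarrow> real^2" where
  "dGam x h u w = (\<chi> l. \<Sum>m\<in>UNIV. \<Sum>n\<in>UNIV. frechet_derivative (chr l m n) (at x) h * u $ m * w $ n)"

text \<open>The curvature operator R(h, k) w on constant coordinate fields, whose brackets vanish,
  with the sign convention of \<open>riemann_curvature\<close>.\<close>

definition Rm :: "real^2 \<Rightarrow> real^2 \<Rightarrow> real^2 \<Rightarrow> real^2 \<Rightarrow> real^2" where
  "Rm x h k w = dGam x h k w - dGam x k h w + Gam x h (Gam x k w) - Gam x k (Gam x h w)"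

lemma smooth_G: "smooth_on U (\<lambda>x. G x u w)"
  using riemannian chart by (simp add: riemannian_metric_def)

lemma G_sym: "x \<in> U \<Longrightarrow> G x u w = G x w u"
  using riemannian chart by (simp add: riemannian_metric_def)

lemma G_pos: "x \<in> U \<Longrightarrow> u \<noteq> 0 \<Longrightarrow> 0 < G x u u"
  using riemannian chart by (simp add: riemannian_metric_def)

lemma bilinear_G: "x \<in> U \<Longrightarrow> bilinear (G x)"
  using riemannian chart by (simp add: riemannian_metric_def)

lemma G_simps:
  assumes "x \<in> U"
  shows "G x (u + v) w = G x u w + G x v w" "G x w (u + v) = G x w u + G x w v"
    "G x (r *\<^sub>R u) w = r * G x u w" "G x w (r *\<^sub>R u) = r * G x w u"
    "G x (u - v) w = G x u w - G x v w" "G x w (u - v) = G x w u - G x w v"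
    "G x (- u) w = - G x u w" "G x w (- u) = - G x w u"
    "G x 0 w = 0" "G x w 0 = 0"
  using bilinear_G[OF assms]
  by (simp_all add: bilinear_ladd bilinear_radd bilinear_lmul bilinear_rmul bilinear_lsub bilinear_rsub
      bilinear_lneg bilinear_rneg bilinear_lzero bilinear_rzero)

lemma G_expand:
  assumes "x \<in> U"
  shows "G x u w = (\<Sum>i\<in>UNIV. \<Sum>j\<in>UNIV. u $ i * w $ j * gm i j x)"
  by (subst vec2_expansion[of u], subst vec2_expansion[of w])
    (simp add: sum_2 G_simps[OF assms] algebra_simps)

lemma gm_has_derivative:
  "x \<in> U \<Longrightarrow> ((\<lambda>y. G y u w) has_derivative (\<lambda>h. dG x h u w)) (at x)"
  unfolding dG_def by (rule smooth_on_has_derivative[OF smooth_G])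

lemma dG_expand:
  assumes "x \<in> U"
  shows "dG x h u w = (\<Sum>i\<in>UNIV. \<Sum>j\<in>UNIV. u $ i * w $ j * dG x h (axis i 1) (axis j 1))"
proof -
  have 1: "((\<lambda>y. \<Sum>i\<in>UNIV. \<Sum>j\<in>UNIV. u $ i * w $ j * gm i j y) has_derivative
    (\<lambda>h. \<Sum>i\<in>UNIV. \<Sum>j\<in>UNIV. u $ i * w $ j * dG x h (axis i 1) (axis j 1))) (at x)"
    by (auto intro!: derivative_eq_intros gm_has_derivative assms)
  have 2: "((\<lambda>y. G y u w) has_derivative
    (\<lambda>h. \<Sum>i\<in>UNIV. \<Sum>j\<in>UNIV. u $ i * w $ j * dG x h (axis i 1) (axis j 1))) (at x)"
    by (rule has_derivative_transform_within_open[OF 1 open_image assms]) (rule G_expand[symmetric])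
  show ?thesis
    using has_derivative_unique[OF 2 gm_has_derivative[OF assms]] by (metis (no_types))
qed

lemma dG_linear: "x \<in> U \<Longrightarrow> linear (\<lambda>h. dG x h u w)"
  using has_derivative_linear[OF gm_has_derivative] .

lemma dG_simps:
  assumes "x \<in> U"
  shows "dG x (h + h') u w = dG x h u w + dG x h' u w" "dG x (r *\<^sub>R h) u w = r * dG x h u w"
    "dG x h (u + v) w = dG x h u w + dG x h v w" "dG x h w (u + v) = dG x h w u + dG x h w v"
    "dG x h (r *\<^sub>R u) w = r * dG x h u w" "dG x h w (r *\<^sub>R u) = r * dG x h w u"
proof -
  obtain d where "\<And>u w. dG x h u w = (\<Sum>i\<in>UNIV. \<Sum>j\<in>UNIV. u $ i * w $ j * d i j)"
    by (rule that[of "\<lambda>i j. dG x h (axis i 1) (axis j 1)"], rule dG_expand[OF assms])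
  then show "dG x h (u + v) w = dG x h u w + dG x h v w" "dG x h w (u + v) = dG x h w u + dG x h w v"
    "dG x h (r *\<^sub>R u) w = r * dG x h u w" "dG x h w (r *\<^sub>R u) = r * dG x h w u"
    by (simp_all add: sum_2 algebra_simps)
  show "dG x (h + h') u w = dG x h u w + dG x h' u w" "dG x (r *\<^sub>R h) u w = r * dG x h u w"
    using linear_add[OF dG_linear[OF assms]] linear_scale[OF dG_linear[OF assms]] by simp_all
qed

lemma dG_sym:
  assumes "x \<in> U"
  shows "dG x h u w = dG x h w u"
proof -
  have 2: "((\<lambda>y. G y u w) has_derivative (\<lambda>h. dG x h w u)) (at x)"
    by (rule has_derivative_transform_within_open[OF gm_has_derivative[OF assms] open_image assms]) (simp add: G_sym)
  show ?thesis
    using has_derivative_unique[OF 2 gm_has_derivative[OF assms]] by (metis (no_types))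
qed

lemma eventually_in_U:
  assumes "(a has_derivative a') (at z)" "a z \<in> U"
  shows "\<forall>\<^sub>F y in nhds z. a y \<in> U"
proof -
  have "(a \<longlongrightarrow> a z) (nhds z)"
    using has_derivative_continuous[OF assms(1)] by (simp add: isCont_def tendsto_at_iff_tendsto_nhds)
  then show ?thesis
    using open_image assms(2) by (rule topological_tendstoD)
qed

text \<open>\<open>G\<close> is bilinear over \<open>U\<close>, so the product rule is derived from
  the component expansion, which holds near z because \<open>a z\<close> lies in the open set
  \<open>U\<close>.\<close>

lemma has_derivative_G:
  assumes a: "(a has_derivative a') (at z)" "a z \<in> U"
    and u: "(u has_derivative u') (at z)" and w: "(w has_derivative w') (at z)"
  shows "((\<lambda>z. G (a z) (u z) (w z)) has_derivative
    (\<lambda>h. dG (a z) (a' h) (u z) (w z) + G (a z) (u' h) (w z) + G (a z) (u z) (w' h))) (at z)"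
proof -
  have Dg: "((\<lambda>y. G (a y) u w) has_derivative (\<lambda>h. dG (a z) (a' h) u w)) (at z)" for u w
    using has_derivative_compose[OF a(1) gm_has_derivative[OF a(2)]] .
  have Du: "((\<lambda>y. u y $ i) has_derivative (\<lambda>h. u' h $ i)) (at z)"
    and Dw: "((\<lambda>y. w y $ i) has_derivative (\<lambda>h. w' h $ i)) (at z)" for i
    using bounded_linear.has_derivative[OF bounded_linear_vec_nth] u w by auto
  obtain d where d: "\<And>u w. G (a z) u w = (\<Sum>i\<in>UNIV. \<Sum>j\<in>UNIV. u $ i * w $ j * d i j)"
      "\<And>i j. gm i j (a z) = d i j"
    by (rule that[of "\<lambda>i j. gm i j (a z)"], rule G_expand[OF a(2)]) (rule refl)
  obtain d' where d': "\<And>h u w. dG (a z) h u w = (\<Sum>i\<in>UNIV. \<Sum>j\<in>UNIV. u $ i * w $ j * d' h i j)"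
      "\<And>h i j. dG (a z) h (axis i 1) (axis j 1) = d' h i j"
    by (rule that[of "\<lambda>h i j. dG (a z) h (axis i 1) (axis j 1)"], rule dG_expand[OF a(2)]) (rule refl)
  have T: "((\<lambda>z. u z $ i * w z $ j * gm i j (a z)) has_derivative
    (\<lambda>h. u' h $ i * w z $ j * d i j + u z $ i * w' h $ j * d i j + u z $ i * w z $ j * d' (a' h) i j)) (at z)" for i j
    by (rule has_derivative_eq_rhs[OF has_derivative_mult[OF has_derivative_mult[OF Du Dw] Dg]])
      (simp add: d(2) d'(2) fun_eq_iff algebra_simps)
  have 1: "((\<lambda>z. \<Sum>i\<in>UNIV. \<Sum>j\<in>UNIV. u z $ i * w z $ j * gm i j (a z)) has_derivative
    (\<lambda>h. dG (a z) (a' h) (u z) (w z) + G (a z) (u' h) (w z) + G (a z) (u z) (w' h))) (at z)"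
    by (rule has_derivative_eq_rhs[OF has_derivative_sum[OF has_derivative_sum[OF T]]])
      (simp add: d(1) d'(1) sum.distrib fun_eq_iff)
  have "\<forall>\<^sub>F y in nhds z. (\<Sum>i\<in>UNIV. \<Sum>j\<in>UNIV. u y $ i * w y $ j * gm i j (a y)) = G (a y) (u y) (w y)"
    using eventually_in_U[OF a] by eventually_elim (rule G_expand[symmetric])
  then show ?thesis
    using has_derivative_transform_eventually[OF 1] by (simp add: eventually_nhds_conv_at)
qed

section \<open>Inverse metric and smoothness of the Christoffel symbols\<close>

lemma det_pos: "x \<in> U \<Longrightarrow> gm 1 1 x * gm 2 2 x - gm 1 2 x * gm 1 2 x > 0"
proof -
  assume x: "x \<in> U"
  have p: "gm 1 1 x > 0"
    using G_pos[OF x] by (metis axis_eq_0_iff zero_neq_one)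
  \<comment> \<open>This vector is orthogonal to the first coordinate vector, and its squared length
    is \<open>gm 1 1 x\<close> times the determinant.\<close>
  let ?u = "(- gm 1 2 x) *\<^sub>R axis 1 1 + gm 1 1 x *\<^sub>R axis 2 1 :: real^2"
  have "?u $ 2 \<noteq> 0" using p by (simp add: axis_def)
  then have "?u \<noteq> 0" by (metis zero_index)
  then have "0 < G x ?u ?u" using G_pos[OF x] by blast
  also have "G x ?u ?u = gm 1 1 x * (gm 1 1 x * gm 2 2 x - gm 1 2 x * gm 1 2 x)"
    using G_sym[OF x, of "axis 2 1" "axis 1 1"] by (simp add: G_simps[OF x] algebra_simps)
  finally show ?thesis using p by (simp add: zero_less_mult_iff)
qed

lemma det_metric: "x \<in> U \<Longrightarrow> det (metric_matrix A g c x) = gm 1 1 x * gm 2 2 x - gm 1 2 x * gm 1 2 x"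
  by (simp add: det_2 metric_matrix_def G_sym[of x "axis 2 1" "axis 1 1"])

text \<open>The adjugate formula. With it, smoothness of the Christoffel symbols reduces to that of
  the metric coefficients and the positivity of the determinant.\<close>

lemma metric_matrix_inv:
  assumes x: "x \<in> U"
  shows "matrix_inv (metric_matrix A g c x) =
    (\<chi> i j. (if i = j then (if i = 1 then gm 2 2 x else gm 1 1 x) else - gm 1 2 x)
      / (gm 1 1 x * gm 2 2 x - gm 1 2 x * gm 1 2 x))" (is "_ = ?B")
proof -
  let ?M = "metric_matrix A g c x"
  have d: "gm 1 1 x * gm 2 2 x - gm 1 2 x * gm 1 2 x \<noteq> 0"
    using det_pos[OF x] by simp
  define d where "d = gm 1 1 x * gm 2 2 x - gm 1 2 x * gm 1 2 x"
  have B: "?B ** ?M = mat 1"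
    unfolding d_def[symmetric] using d[folded d_def] by (simp add: vec_eq_iff forall_2 matrix_matrix_mult_def sum_2 mat_def metric_matrix_def
      G_sym[OF x, of "axis 2 1" "axis 1 1"] divide_simps) (simp add: d_def algebra_simps)
  then have "invertible ?M"
    using invertible_left_inverse by blast
  then have "?M ** matrix_inv ?M = mat 1"
    unfolding invertible_def matrix_inv_def by (rule someI2_ex) blast
  then have "?B ** (?M ** matrix_inv ?M) = ?B"
    by (simp only: matrix_mul_rid)
  then show ?thesis
    by (simp only: matrix_mul_assoc B matrix_mul_lid)
qed

lemma smooth_christoffel: "smooth_on U (chr l i j)"
proof -
  let ?d = "\<lambda>x. gm 1 1 x * gm 2 2 x - gm 1 2 x * gm 1 2 x"
  let ?B = "\<lambda>l m x. (if l = m then (if l = (1::2) then gm 2 2 x else gm 1 1 x) else - gm 1 2 x) / ?d x"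
  have B: "smooth_on U (?B l m)" for l m
    by (cases "l = m"; cases "l = 1";
      simp; intro smooth_on_divide smooth_on_mult smooth_on_diff smooth_on_minus open_image smooth_G)
      (use det_pos in \<open>force+\<close>)
  have P: "smooth_on U (partial k (\<lambda>y. gm i j y))" for k i j
    unfolding partial_def by (rule smooth_on_frechet_derivative[OF smooth_G])
  have "smooth_on U (\<lambda>x. (\<Sum>m\<in>UNIV. ?B l m x *
     (partial i (gm j m) x + partial j (gm i m) x - partial m (gm i j) x)) * (1/2))"
    by (intro smooth_on_mult smooth_on_sum smooth_on_add smooth_on_diff smooth_on_const open_image B P)
  then show ?thesis
    by (rule smooth_on_cong[OF open_image, rotated])
      (simp add: christoffel_def metric_matrix_inv Let_def, simp add: metric_matrix_def)
qed

section \<open>The Levi-Civita connection\<close>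

lemma partial_gm: "partial m (gm i j) x = dG x (axis m 1) (axis i 1) (axis j 1)"
  by (simp add: partial_def dG_def)

lemma christoffel_eq:
  "chr l i j x = (\<Sum>m\<in>UNIV. matrix_inv (metric_matrix A g c x) $ l $ m *
      (dG x (axis i 1) (axis j 1) (axis m 1) + dG x (axis j 1) (axis i 1) (axis m 1)
        - dG x (axis m 1) (axis i 1) (axis j 1))) / 2"
  by (simp add: christoffel_def Let_def metric_matrix_def partial_gm)

lemma christoffel_sym: "x \<in> U \<Longrightarrow> chr l i j x = chr l j i x"
  unfolding christoffel_eq by (simp add: dG_sym[of x _ "axis i 1" "axis j 1"] add.commute)

lemma Gam_simps:
  "Gam x (u + v) w = Gam x u w + Gam x v w" "Gam x w (u + v) = Gam x w u + Gam x w v"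
  "Gam x (r *\<^sub>R u) w = r *\<^sub>R Gam x u w" "Gam x w (r *\<^sub>R u) = r *\<^sub>R Gam x w u"
  "Gam x (u - v) w = Gam x u w - Gam x v w" "Gam x w (u - v) = Gam x w u - Gam x w v"
  "Gam x 0 w = 0" "Gam x w 0 = 0"
  by (simp_all add: Gam_def vec_eq_iff sum_2 algebra_simps)

lemma Gam_sym: "x \<in> U \<Longrightarrow> Gam x u w = Gam x w u"
  by (simp add: Gam_def vec_eq_iff sum_2 christoffel_sym[of x _ 2 1] algebra_simps)

lemma dGam_simps:
  assumes "x \<in> U"
  shows "dGam x (h + h') u w = dGam x h u w + dGam x h' u w" "dGam x (r *\<^sub>R h) u w = r *\<^sub>R dGam x h u w"
  "dGam x h (u + v) w = dGam x h u w + dGam x h v w" "dGam x h w (u + v) = dGam x h w u + dGam x h w v"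
  "dGam x h (r *\<^sub>R u) w = r *\<^sub>R dGam x h u w" "dGam x h w (r *\<^sub>R u) = r *\<^sub>R dGam x h w u"
proof -
  have l: "linear (\<lambda>h. frechet_derivative (chr l m n) (at x) h)" for l m n
    using has_derivative_linear[OF smooth_on_has_derivative[OF smooth_christoffel assms]] .
  show "dGam x (h + h') u w = dGam x h u w + dGam x h' u w" "dGam x (r *\<^sub>R h) u w = r *\<^sub>R dGam x h u w"
  "dGam x h (u + v) w = dGam x h u w + dGam x h v w" "dGam x h w (u + v) = dGam x h w u + dGam x h w v"
  "dGam x h (r *\<^sub>R u) w = r *\<^sub>R dGam x h u w" "dGam x h w (r *\<^sub>R u) = r *\<^sub>R dGam x h w u"
    by (simp_all add: dGam_def vec_eq_iff sum_2 algebra_simps linear_add[OF l] linear_scale[OF l])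
qed

text \<open>Lowering the index of the Christoffel symbols cancels the inverse metric and leaves an
  expression from which metric compatibility can be read off.\<close>

lemma koszul:
  assumes x: "x \<in> U"
  shows "2 * G x (Gam x h u) w = dG x h u w + dG x u h w - dG x w h u"
proof -
  let ?T = "\<lambda>i j m. dG x (axis i 1) (axis j 1) (axis m 1) + dG x (axis j 1) (axis i 1) (axis m 1)
        - dG x (axis m 1) (axis i 1) (axis j 1)"
  let ?d = "gm 1 1 x * gm 2 2 x - gm 1 2 x * gm 1 2 x"
  have d: "?d \<noteq> 0"
    using det_pos[OF x] by simp
  have chr: "chr 1 i j x = (gm 2 2 x * ?T i j 1 - gm 1 2 x * ?T i j 2) / ?d / 2"
    "chr 2 i j x = (- gm 1 2 x * ?T i j 1 + gm 1 1 x * ?T i j 2) / ?d / 2" for i j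
    unfolding christoffel_eq metric_matrix_inv[OF x] by (simp_all add: sum_2 add_divide_distrib diff_divide_distrib)
  \<comment> \<open>With p, q, r the metric coefficients, this is the product of the matrix with its
    inverse, written out by rows.\<close>
  have aux: "2 * (p * ((r * s - q * t) / d / 2) + q * ((- q * s + p * t) / d / 2)) = s"
    "2 * (q * ((r * s - q * t) / d / 2) + r * ((- q * s + p * t) / d / 2)) = t"
    if "d = p * r - q * q" "d \<noteq> 0" for p q r s t d :: real
    using that(2) by (simp_all add: divide_simps) (simp_all add: that(1) algebra_simps)
  have low1: "2 * (gm 1 1 x * chr 1 i j x + gm 1 2 x * chr 2 i j x) = ?T i j 1"
    and low2: "2 * (gm 1 2 x * chr 1 i j x + gm 2 2 x * chr 2 i j x) = ?T i j 2" for i j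
    unfolding chr by (rule aux[OF refl d])+
  have "2 * G x (Gam x h u) w =
     (\<Sum>i\<in>UNIV. \<Sum>j\<in>UNIV. h $ i * u $ j * (w $ 1 * (2 * (gm 1 1 x * chr 1 i j x + gm 1 2 x * chr 2 i j x)) +
       w $ 2 * (2 * (gm 1 2 x * chr 1 i j x + gm 2 2 x * chr 2 i j x))))"
    by (subst G_expand[OF x]) (simp add: Gam_def sum_2 G_sym[OF x, of "axis 2 1" "axis 1 1"] algebra_simps)
  also have "\<dots> = (\<Sum>i\<in>UNIV. \<Sum>j\<in>UNIV. h $ i * u $ j * (w $ 1 * ?T i j 1 + w $ 2 * ?T i j 2))"
    unfolding low1 low2 ..
  also have "\<dots> = dG x h u w + dG x u h w - dG x w h u"
  proof -
    have e: "dG x h u w = dG x (h $ 1 *\<^sub>R axis 1 1 + h $ 2 *\<^sub>R axis 2 1) (u $ 1 *\<^sub>R axis 1 1 + u $ 2 *\<^sub>R axis 2 1)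
       (w $ 1 *\<^sub>R axis 1 1 + w $ 2 *\<^sub>R axis 2 1)" for h u w
      by (simp add: vec2_expansion[symmetric])
    show ?thesis
      unfolding e[of h u w] e[of u h w] e[of w h u]
      by (simp add: dG_simps[OF x] sum_2) (simp add: algebra_simps)
  qed
  finally show ?thesis .
qed

text \<open>In the sum of the Koszul formulas for (u, w) and (w, u), the terms that are not
  derivatives along h cancel.\<close>

lemma metric_compatible:
  assumes x: "x \<in> U"
  shows "dG x h u w = G x (Gam x h u) w + G x u (Gam x h w)"
  using koszul[OF x, of h u w] koszul[OF x, of h w u] G_sym[OF x, of u] dG_sym[OF x]
  by (smt (verit))

lemma has_derivative_Gam:
  assumes a: "(a has_derivative a') (at z)" "a z \<in> U"
    and u: "(u has_derivative u') (at z)" and w: "(w has_derivative w') (at z)"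
  shows "((\<lambda>z. Gam (a z) (u z) (w z)) has_derivative
    (\<lambda>h. dGam (a z) (a' h) (u z) (w z) + Gam (a z) (u' h) (w z) + Gam (a z) (u z) (w' h))) (at z)"
proof -
  have Dc: "((\<lambda>y. chr l m n (a y)) has_derivative (\<lambda>h. frechet_derivative (chr l m n) (at (a z)) (a' h))) (at z)" for l m n
    using has_derivative_compose[OF a(1) smooth_on_has_derivative[OF smooth_christoffel a(2)]] .
  have Du: "((\<lambda>y. u y $ i) has_derivative (\<lambda>h. u' h $ i)) (at z)"
    and Dw: "((\<lambda>y. w y $ i) has_derivative (\<lambda>h. w' h $ i)) (at z)" for i
    using bounded_linear.has_derivative[OF bounded_linear_vec_nth] u w by auto
  show ?thesis
    unfolding Gam_def
    by (rule has_derivative_eq_rhs[OF has_derivative_vec_lambda[OF has_derivative_sum[OF has_derivative_sum[OF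
          has_derivative_mult[OF has_derivative_mult[OF Dc Du] Dw]]]]])
      (simp add: dGam_def sum_2 algebra_simps vec_eq_iff fun_eq_iff)
qed

text \<open>Differentiate metric compatibility along h and antisymmetrise in h and k: the second
  derivatives of \<open>G\<close> commute, and the skewness of the curvature is what
  remains.\<close>

lemma curvature_antisym:
  assumes x: "x \<in> U"
  shows "G x (Rm x h k u) w + G x u (Rm x h k w) = 0"
proof -
  have D: "frechet_derivative (\<lambda>y. dG y k u w) (at x) h =
     dG x h (Gam x k u) w + G x (dGam x h k u) w + dG x h u (Gam x k w) + G x u (dGam x h k w)" for h k
  proof -
    have d: "((\<lambda>y. G y (Gam y k u) w + G y u (Gam y k w)) has_derivative
      (\<lambda>h. dG x h (Gam x k u) w + G x (dGam x h k u) w + dG x h u (Gam x k w) + G x u (dGam x h k w))) (at x)"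
      by (rule has_derivative_eq_rhs,
          rule has_derivative_add[OF has_derivative_G[OF has_derivative_ident x has_derivative_Gam[OF has_derivative_ident x has_derivative_const has_derivative_const] has_derivative_const]
            has_derivative_G[OF has_derivative_ident x has_derivative_const has_derivative_Gam[OF has_derivative_ident x has_derivative_const has_derivative_const]]])
        (simp add: G_simps[OF x] Gam_simps add.assoc)
    have "((\<lambda>y. dG y k u w) has_derivative
      (\<lambda>h. dG x h (Gam x k u) w + G x (dGam x h k u) w + dG x h u (Gam x k w) + G x u (dGam x h k w))) (at x)"
      by (rule has_derivative_transform_within_open[OF d open_image x]) (simp add: metric_compatible)
    from fun_cong[OF frechet_derivative_at[OF this], of h] show ?thesis by (rule sym)
  qed
  have "frechet_derivative (\<lambda>y. dG y k u w) (at x) h = frechet_derivative (\<lambda>y. dG y h u w) (at x) k"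
    unfolding dG_def by (rule frechet_derivative_commute[OF open_image smooth_G x])
  then show ?thesis
    unfolding D metric_compatible[OF x] Rm_def
    by (simp add: G_simps[OF x])
qed

section \<open>Curvature in dimension two\<close>

lemma Rm_simps:
  assumes x: "x \<in> U"
  shows "Rm x (h + h') k u = Rm x h k u + Rm x h' k u" "Rm x (r *\<^sub>R h) k u = r *\<^sub>R Rm x h k u"
    "Rm x h (k + k') u = Rm x h k u + Rm x h k' u" "Rm x h (r *\<^sub>R k) u = r *\<^sub>R Rm x h k u"
    "Rm x h k (u + u') = Rm x h k u + Rm x h k u'" "Rm x h k (r *\<^sub>R u) = r *\<^sub>R Rm x h k u"
  unfolding Rm_def by (simp_all add: dGam_simps[OF x] Gam_simps algebra_simps)

lemma Rm_swap: "Rm x h k u = - Rm x k h u"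
  unfolding Rm_def by simp

lemma gauss_curvature_Rm:
  assumes x: "x \<in> U"
  shows "gauss_curvature_in A g c x * (gm 1 1 x * gm 2 2 x - gm 1 2 x * gm 1 2 x) =
    G x (axis 1 1) (Rm x (axis 1 1) (axis 2 1) (axis 2 1))"
proof -
  have "riemann_curvature A g c l 2 1 2 x = Rm x (axis 1 1) (axis 2 1) (axis 2 1) $ l" for l
    unfolding riemann_curvature_def Rm_def Gam_def dGam_def Let_def partial_def
    by (simp add: sum_2 axis_def algebra_simps)
  moreover have "G x (axis 1 1) r = (\<Sum>l\<in>UNIV. metric_matrix A g c x $ 1 $ l * r $ l)" for r
    by (subst vec2_expansion[of r]) (simp add: metric_matrix_def sum_2 G_simps[OF x] algebra_simps)
  ultimately show ?thesis
    using det_pos[OF x] unfolding gauss_curvature_in_def det_metric[OF x]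
    by simp
qed

text \<open>In dimension two an expression that is skew in (h, k) and in (a, b) is a multiple of the
  product of the two determinants; the factor is its value on the coordinate vectors.\<close>

lemma curvature_det:
  assumes x: "x \<in> U"
  shows "G x a (Rm x h k b) = gauss_curvature_in A g c x * (gm 1 1 x * gm 2 2 x - gm 1 2 x * gm 1 2 x) *
    (h$1 * k$2 - h$2 * k$1) * (a$1 * b$2 - a$2 * b$1)"
proof -
  let ?e = "\<lambda>i. axis i (1::real) :: real^2"
  let ?r = "\<lambda>a b. G x a (Rm x (?e 1) (?e 2) b)"
  have anti: "?r a b + ?r b a = 0" for a b
    using curvature_antisym[OF x, of "?e 1" "?e 2" b a] G_sym[OF x] by (simp add: add.commute)
  have z: "Rm x h h b = 0" for h b
    unfolding Rm_def by simp
  have "G x a (Rm x h k b) = (h$1 * k$2 - h$2 * k$1) * ?r a b"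
    by (subst vec2_expansion[of h], subst vec2_expansion[of k])
      (simp add: Rm_simps[OF x] G_simps[OF x] z Rm_swap[of x "?e 2" "?e 1"] algebra_simps)
  also have "?r a b = (a$1 * b$2 - a$2 * b$1) * ?r (?e 1) (?e 2)"
    using anti[of "?e 1" "?e 1"] anti[of "?e 2" "?e 2"] eq_neg_iff_add_eq_0[THEN iffD2, OF anti[of "?e 2" "?e 1"]]
    by (subst vec2_expansion[of a], subst vec2_expansion[of b])
      (simp add: Rm_simps[OF x] G_simps[OF x] algebra_simps)
  finally show ?thesis
    unfolding gauss_curvature_Rm[OF x, symmetric] by (simp add: mult_ac)
qed

lemma smooth_gauss_curvature: "smooth_on U (gauss_curvature_in A g c)"
proof -
  let ?d = "\<lambda>x. gm 1 1 x * gm 2 2 x - gm 1 2 x * gm 1 2 x"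
  have "smooth_on U (riemann_curvature A g c l a i j)" for l a i j
    unfolding riemann_curvature_def Let_def partial_def
    by (intro smooth_on_add smooth_on_diff smooth_on_sum smooth_on_mult open_image smooth_christoffel
      smooth_on_frechet_derivative[OF smooth_christoffel])
  then have "smooth_on U (\<lambda>x. (\<Sum>l\<in>UNIV. gm 1 l x * riemann_curvature A g c l 2 1 2 x) / ?d x)"
    by (intro smooth_on_divide smooth_on_diff smooth_on_sum smooth_on_mult open_image smooth_G)
      (use det_pos in force)+
  then show ?thesis
    by (rule smooth_on_cong[OF open_image, rotated])
      (simp add: gauss_curvature_in_def det_metric, simp add: metric_matrix_def)
qed

end

section \<open>Coordinates on the frame bundle\<close>

locale surface =
  fixes X :: "'a topology" and A :: "'a chart set" and g :: "'a metric"
  assumes surface: "connected_oriented_surface X A" and metric: "riemannian_metric A g"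
begin

lemma atlas: "oriented_smooth_atlas X A"
  using surface by (simp add: connected_oriented_surface_def)

lemma is_chart: "c \<in> A \<Longrightarrow> is_chart X c"
  using atlas by (simp add: oriented_smooth_atlas_def)

lemma topspace_cover: "p \<in> topspace X \<Longrightarrow> \<exists>c\<in>A. p \<in> fst c"
  using atlas by (auto simp: oriented_smooth_atlas_def)

lemma chart_subset: "c \<in> A \<Longrightarrow> fst c \<subseteq> topspace X"
  using is_chart[of c] openin_subset[of X "fst c"] by (simp add: is_chart_def)

lemma open_chart_image: "c \<in> A \<Longrightarrow> open (chart_image c)"
  using is_chart by (auto simp: is_chart_def)

lemma chart_homeo: "c \<in> A \<Longrightarrow> homeomorphic_map (subtopology X (fst c)) (top_of_set (chart_image c)) (snd c)"
  using is_chart by (auto simp: is_chart_def)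

lemma inj_on_chart: "c \<in> A \<Longrightarrow> inj_on (snd c) (fst c)"
  using homeomorphic_imp_injective_map[OF chart_homeo] chart_subset
  by (simp add: Int_absorb1)

lemma chart_inv_chart: "c \<in> A \<Longrightarrow> p \<in> fst c \<Longrightarrow> chart_inv c (snd c p) = p"
  by (simp add: chart_inv_def inj_on_chart)

lemma chart_chart_inv: "x \<in> chart_image c \<Longrightarrow> snd c (chart_inv c x) = x"
  by (simp add: chart_inv_def chart_image_def f_inv_into_f)

lemma chart_inv_in: "x \<in> chart_image c \<Longrightarrow> chart_inv c x \<in> fst c"
  by (simp add: chart_inv_def chart_image_def inv_into_into)

lemma chart_in_image: "p \<in> fst c \<Longrightarrow> snd c p \<in> chart_image c"
  by (simp add: chart_image_def)

lemma open_overlap: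
  assumes "c \<in> A" "d \<in> A"
  shows "open (snd c ` (fst c \<inter> fst d))"
proof -
  have "openin (subtopology X (fst c)) (fst c \<inter> fst d)"
    using is_chart[OF assms(2)] by (auto simp: is_chart_def openin_subtopology_Int2)
  then have "openin (top_of_set (chart_image c)) (snd c ` (fst c \<inter> fst d))"
    using homeomorphic_map_openness[OF chart_homeo[OF assms(1)]] openin_subset by blast
  then show ?thesis
    using open_chart_image[OF assms(1)] openin_open_eq by blast
qed

lemma transition_has_derivative:
  assumes "c \<in> A" "d \<in> A" "p \<in> fst c" "p \<in> fst d"
  shows "(transition c d has_derivative frechet_derivative (transition c d) (at (snd c p))) (at (snd c p))"
proof (rule smooth_on_has_derivative)
  show "smooth_on (snd c ` (fst c \<inter> fst d)) (transition c d)"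
    using atlas assms by (auto simp: oriented_smooth_atlas_def)
qed (use assms in auto)

lemma det_transition_pos:
  assumes "c \<in> A" "d \<in> A" "p \<in> fst c" "p \<in> fst d"
  shows "0 < det (matrix (frechet_derivative (transition c d) (at (snd c p))))"
  using atlas assms by (auto simp: oriented_smooth_atlas_def)

lemma transition_apply: "c \<in> A \<Longrightarrow> p \<in> fst c \<Longrightarrow> transition c d (snd c p) = snd d p"
  by (simp add: transition_def chart_inv_chart)

lemma transition_chain:
  assumes "c \<in> A" "d \<in> A" "e \<in> A" "p \<in> fst c" "p \<in> fst d" "p \<in> fst e"
  shows "frechet_derivative (transition c e) (at (snd c p)) u =
    frechet_derivative (transition d e) (at (snd d p)) (frechet_derivative (transition c d) (at (snd c p)) u)"
proof -
  have "((\<lambda>x. transition d e (transition c d x)) has_derivative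
    (\<lambda>u. frechet_derivative (transition d e) (at (snd d p)) (frechet_derivative (transition c d) (at (snd c p)) u))) (at (snd c p))"
    by (rule has_derivative_compose[OF transition_has_derivative])
      (use assms transition_has_derivative[of d e p] transition_apply[of c p d] in auto)
  then have "(transition c e has_derivative
    (\<lambda>u. frechet_derivative (transition d e) (at (snd d p)) (frechet_derivative (transition c d) (at (snd c p)) u))) (at (snd c p))"
    by (rule has_derivative_transform_within_open[OF _ open_overlap[OF assms(1,2)]])
      (use assms transition_apply[of c _ d] transition_apply[of c _ e] transition_apply[of d _ e] in \<open>auto simp del: split_paired_All\<close>)
  from fun_cong[OF frechet_derivative_at[OF this], of u] show ?thesis by (rule sym)
qed

lemma transition_self:
  assumes "c \<in> A" "p \<in> fst c"
  shows "frechet_derivative (transition c c) (at (snd c p)) u = u"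
proof -
  have "(transition c c has_derivative (\<lambda>u. u)) (at (snd c p))"
    by (rule has_derivative_transform_within_open[OF has_derivative_ident open_chart_image[OF assms(1)] chart_in_image[OF assms(2)]])
      (simp add: transition_def chart_chart_inv)
  from fun_cong[OF frechet_derivative_at[OF this], of u] show ?thesis by (rule sym)
qed

section \<open>Tangent vectors and change of chart\<close>

lemma tvec_of_tangent:
  assumes "c \<in> A" "p \<in> fst c"
  shows "tvec_of A c p u \<in> tangent_at A p"
proof -
  have "tvec_of A c p u e = frechet_derivative (transition d e) (at (snd d p)) (tvec_of A c p u d)"
    if "d \<in> A" "e \<in> A" "p \<in> fst d" "p \<in> fst e" for d e
    using transition_chain[OF assms(1) that(1,2) assms(2) that(3,4), of u] that
    unfolding tvec_of_def by presburger
  moreover have "tvec_of A c p u d = 0" if "\<not> (d \<in> A \<and> p \<in> fst d)" for d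
    using that unfolding tvec_of_def by presburger
  ultimately show ?thesis
    unfolding tangent_at_def by blast
qed

lemma tvec_of_self: "c \<in> A \<Longrightarrow> p \<in> fst c \<Longrightarrow> tvec_of A c p u c = u"
  by (simp add: tvec_of_def transition_self)

lemma tangent_atD:
  assumes "v \<in> tangent_at A p"
  shows "c \<in> A \<Longrightarrow> d \<in> A \<Longrightarrow> p \<in> fst c \<Longrightarrow> p \<in> fst d \<Longrightarrow>
      v d = frechet_derivative (transition c d) (at (snd c p)) (v c)"
    and "\<not> (d \<in> A \<and> p \<in> fst d) \<Longrightarrow> v d = 0"
  using assms unfolding tangent_at_def by blast+

lemma tvec_of_component:
  assumes "c \<in> A" "p \<in> fst c" "v \<in> tangent_at A p"
  shows "tvec_of A c p (v c) = v"
proof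
  fix d
  show "tvec_of A c p (v c) d = v d"
    using tangent_atD(1)[OF assms(3,1) _ assms(2), of d] tangent_atD(2)[OF assms(3), of d]
    unfolding tvec_of_def by presburger
qed

text \<open>The component matrix is multiplied by the transposed Jacobian of the transition map,
  whose determinant is positive in an oriented atlas; hence one chart decides the orientation of a
  frame.\<close>

lemma det_frame_change:
  assumes "c \<in> A" "d \<in> A" "p \<in> fst c" "p \<in> fst d" "\<And>i. e i \<in> tangent_at A p" "0 < det (\<chi> i. e i c)"
  shows "0 < det (\<chi> i. e i d)"
proof -
  let ?f = "frechet_derivative (transition c d) (at (snd c p))"
  let ?D = "matrix ?f"
  have "e i d = ?D *v e i c" for i
    using tangent_atD(1)[OF assms(5,1-4), of i] fun_cong[OF matrix_vector_mul(2)[OF has_derivative_linear[OF transition_has_derivative[OF assms(1-4)]]], of "e i c"]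
    by presburger
  then have "(\<chi> i. e i d) = (\<chi> i. e i c) ** transpose ?D"
    by (simp add: vec_eq_iff matrix_matrix_mult_def matrix_vector_mult_def transpose_def mult.commute)
  then show ?thesis
    using assms(6) det_transition_pos[OF assms(1-4)] by (simp add: det_mul det_transpose)
qed

end

locale surface_chart = surface +
  fixes c :: "'a chart"
  assumes chart: "c \<in> A"

sublocale surface_chart \<subseteq> metric_chart A g c
  by unfold_locales (rule metric, rule chart, rule open_chart_image[OF chart])

context surface_chart
begin

abbreviation "FP \<equiv> frame_patch X A g c"

text \<open>Describes the patch by equations and open conditions in the ambient space, so that
  curves can be shown to stay in it. For the converse inclusion, \<open>tvec_of\<close> extends
  components in the chart c to tangent vectors.\<close>

lemma frame_patch_eq:
  "FP = {(x, E). x \<in> U \<and> (\<forall>i j. G x (E $ i) (E $ j) = (if i = j then 1 else 0)) \<and> 0 < det E}"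
  (is "_ = ?R")
proof (rule set_eqI, rule iffI)
  fix z assume "z \<in> FP"
  then obtain p e where P: "(p, e) \<in> frame_bundle X A g" "p \<in> fst c" and z: "z = (snd c p, \<chi> i. e i c)"
    by (auto simp: frame_patch_def frames_over_def frame_coords_def)
  have "tvec_of A c p (e i c) = e i" for i
    by (rule tvec_of_component[OF chart P(2)]) (use P in \<open>auto simp: frame_bundle_def\<close>)
  then show "z \<in> ?R"
    using P by (auto simp: z chart_in_image frame_bundle_def metric_in_def chart chart_inv_chart)
next
  fix z assume "z \<in> ?R"
  then obtain x E where z: "z = (x, E)" "x \<in> U" "\<And>i j. G x (E $ i) (E $ j) = (if i = j then 1 else 0)" "0 < det E"
    by auto
  define p where "p = chart_inv c x"
  define e where "e i = tvec_of A c p (E $ i)" for i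
  have p: "p \<in> fst c" "snd c p = x"
    unfolding p_def using chart_inv_in[OF z(2)] chart_chart_inv[OF z(2)] by auto
  have t: "e i \<in> tangent_at A p" for i
    unfolding e_def by (rule tvec_of_tangent[OF chart p(1)])
  have ec: "e i c = E $ i" for i
    unfolding e_def by (rule tvec_of_self[OF chart p(1)])
  have "(p, e) \<in> frame_bundle X A g"
    unfolding frame_bundle_def
    using p chart_subset[OF chart] t z(3) det_frame_change[OF chart _ p(1) _ t] z(4)
    by (auto simp: metric_in_def e_def[symmetric] p_def[symmetric] ec)
  then have "(p, e) \<in> frames_over X A g c" "frame_coords c (p, e) = z"
    using p by (auto simp: frames_over_def frame_coords_def ec z)
  then show "z \<in> FP"
    unfolding frame_patch_def by (metis imageI)
qed

lemma frame_coords_in: "P \<in> frames_over X A g c \<Longrightarrow> frame_coords c P \<in> FP"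
  by (simp add: frame_patch_def)

lemma frame_at_in: "z \<in> FP \<Longrightarrow> frame_at X A g c z \<in> frames_over X A g c"
  "z \<in> FP \<Longrightarrow> frame_coords c (frame_at X A g c z) = z"
  unfolding frame_at_def frame_patch_def by (auto intro: inv_into_into f_inv_into_f)

lemma frame_at_base: "z \<in> FP \<Longrightarrow> fst (frame_at X A g c z) = chart_inv c (fst z)"
  using frame_at_in[of z] chart_inv_chart[OF chart, of "fst (frame_at X A g c z)"]
  by (simp add: frame_coords_def frames_over_def prod_eq_iff)

end

section \<open>Tangent spaces and exterior derivatives\<close>

text \<open>\<open>curve_in\<close> asks for a curve in S at all times. A curve that is in S near 0
  is set to P wherever it is outside, which leaves its velocity at 0 unchanged.\<close>

lemma tangent_spaceI:
  assumes \<gamma>: "(\<gamma> has_vector_derivative v) (at 0)" "\<gamma> 0 = P"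
    and S: "\<forall>\<^sub>F t in nhds 0. \<gamma> t \<in> S"
  shows "v \<in> tangent_space S P"
proof -
  define \<delta> where "\<delta> t = (if \<gamma> t \<in> S then \<gamma> t else P)" for t
  have PS: "P \<in> S"
    using eventually_nhds_x_imp_x[OF S] \<gamma> by simp
  have "(\<delta> has_vector_derivative v) (at 0)"
    unfolding has_vector_derivative_def
    by (rule has_derivative_transform_eventually[OF \<gamma>(1)[unfolded has_vector_derivative_def]])
      (use S in \<open>auto simp: \<delta>_def \<gamma>(2) eventually_nhds_conv_at elim!: eventually_mono\<close>)
  then have "curve_in S P v \<delta>"
    unfolding curve_in_def using PS \<gamma>(2) by (auto simp: \<delta>_def)
  then show ?thesis
    unfolding tangent_space_def by blast
qed

lemma tangent_spaceE:
  assumes "v \<in> tangent_space S P"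
  obtains \<gamma> where "(\<gamma> has_vector_derivative v) (at 0)" "\<gamma> 0 = P" "\<And>t. \<gamma> t \<in> S"
  using assms unfolding tangent_space_def curve_in_def by blast

text \<open>Along a curve in S two extensions of the same function coincide. This gives ambient
  derivatives a meaning for functions on S, in tangent directions.\<close>

lemma tangent_derivative_eq:
  assumes v: "v \<in> tangent_space S P" and V: "open V" "P \<in> V"
    and eq: "\<And>Q. Q \<in> S \<inter> V \<Longrightarrow> f Q = h Q"
    and f: "(f has_derivative f') (at P)" and h: "(h has_derivative h') (at P)"
  shows "f' v = h' v"
proof -
  obtain \<gamma> where \<gamma>: "(\<gamma> has_vector_derivative v) (at 0)" "\<gamma> 0 = P" "\<And>t. \<gamma> t \<in> S"
    by (rule tangent_spaceE[OF v]) (rule that)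
  note \<gamma>' = \<gamma>(1)[unfolded has_vector_derivative_def]
  have "(\<gamma> \<longlongrightarrow> \<gamma> 0) (nhds 0)"
    using has_derivative_continuous[OF \<gamma>'] by (simp add: isCont_def tendsto_at_iff_tendsto_nhds)
  then have "\<forall>\<^sub>F t in nhds 0. \<gamma> t \<in> V"
    using V \<gamma>(2) topological_tendstoD by metis
  then have ev: "\<forall>\<^sub>F t in nhds 0. f (\<gamma> t) = h (\<gamma> t)"
    by eventually_elim (use eq \<gamma>(3) in auto)
  have 1: "((\<lambda>t. f (\<gamma> t)) has_derivative (\<lambda>t. f' (t *\<^sub>R v))) (at 0)"
    using has_derivative_compose[OF \<gamma>'] f \<gamma>(2) by auto
  have 2: "((\<lambda>t. h (\<gamma> t)) has_derivative (\<lambda>t. h' (t *\<^sub>R v))) (at 0)"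
    using has_derivative_compose[OF \<gamma>'] h \<gamma>(2) by auto
  have "((\<lambda>t. h (\<gamma> t)) has_derivative (\<lambda>t. f' (t *\<^sub>R v))) (at 0)"
    using has_derivative_transform_eventually[OF 1] ev by (simp add: eventually_nhds_conv_at)
  from has_derivative_unique[OF this 2] have "f' (1 *\<^sub>R v) = h' (1 *\<^sub>R v)"
    by (rule fun_cong)
  then show ?thesis by simp
qed

lemma tangent_derivative_0:
  assumes "v \<in> tangent_space S P" "open V" "P \<in> V" "\<And>Q. Q \<in> S \<inter> V \<Longrightarrow> f Q = a"
    and "(f has_derivative f') (at P)"
  shows "f' v = 0"
  using tangent_derivative_eq[OF assms(1-4) assms(5) has_derivative_const] by simp

lemma tangent_space_Times:
  "tangent_space (S \<times> T) P = tangent_space S (fst P) \<times> tangent_space T (snd P)"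
proof (intro set_eqI iffI)
  fix v assume "v \<in> tangent_space (S \<times> T) P"
  then obtain \<gamma> where \<gamma>: "(\<gamma> has_vector_derivative v) (at 0)" "\<gamma> 0 = P" "\<And>t. \<gamma> t \<in> S \<times> T"
    using tangent_spaceE by blast
  have "fst v \<in> tangent_space S (fst P)"
    by (rule tangent_spaceI[OF bounded_linear.has_vector_derivative[OF bounded_linear_fst \<gamma>(1)]])
      (use \<gamma> in \<open>auto simp: mem_Times_iff\<close>)
  moreover have "snd v \<in> tangent_space T (snd P)"
    by (rule tangent_spaceI[OF bounded_linear.has_vector_derivative[OF bounded_linear_snd \<gamma>(1)]])
      (use \<gamma> in \<open>auto simp: mem_Times_iff\<close>)
  ultimately show "v \<in> tangent_space S (fst P) \<times> tangent_space T (snd P)"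
    by (simp add: mem_Times_iff)
next
  fix v assume v: "v \<in> tangent_space S (fst P) \<times> tangent_space T (snd P)"
  obtain \<gamma> where \<gamma>: "(\<gamma> has_vector_derivative fst v) (at 0)" "\<gamma> 0 = fst P" "\<And>t. \<gamma> t \<in> S"
    using tangent_spaceE v by (metis mem_Times_iff)
  obtain \<delta> where \<delta>: "(\<delta> has_vector_derivative snd v) (at 0)" "\<delta> 0 = snd P" "\<And>t. \<delta> t \<in> T"
    using tangent_spaceE v by (metis mem_Times_iff)
  have "((\<lambda>t. (\<gamma> t, \<delta> t)) has_vector_derivative v) (at 0)"
    using has_derivative_Pair[OF \<gamma>(1)[unfolded has_vector_derivative_def] \<delta>(1)[unfolded has_vector_derivative_def]]
    unfolding has_vector_derivative_def by (simp add: scaleR_prod_def)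
  then show "v \<in> tangent_space (S \<times> T) P"
    by (rule tangent_spaceI) (use \<gamma> \<delta> in auto)
qed

section \<open>Exterior derivatives of forms on the ambient space\<close>

definition form_differentiable :: "('e::euclidean_space \<Rightarrow> 'e \<Rightarrow> 'b::real_normed_vector) \<Rightarrow> 'e \<Rightarrow> bool" where
  "form_differentiable \<alpha> P \<longleftrightarrow> (\<forall>v. (\<lambda>Q. \<alpha> Q v) differentiable (at P))"

text \<open>\<open>ext_deriv\<close> for values in any normed space, so that the real coframe and
  the complex forms obey one set of rules.\<close>

definition ext_d :: "('e::euclidean_space \<Rightarrow> 'e \<Rightarrow> 'b::real_normed_vector) \<Rightarrow> 'e \<Rightarrow> 'e \<Rightarrow> 'e \<Rightarrow> 'b" where
  "ext_d \<alpha> P u v = frechet_derivative (\<lambda>Q. \<alpha> Q v) (at P) u - frechet_derivative (\<lambda>Q. \<alpha> Q u) (at P) v"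

lemma ext_deriv_eq: "ext_deriv \<alpha> = ext_d \<alpha>"
  by (intro ext) (simp add: ext_deriv_def ext_d_def)

lemma form_differentiableD:
  "form_differentiable \<alpha> P \<Longrightarrow> ((\<lambda>Q. \<alpha> Q v) has_derivative frechet_derivative (\<lambda>Q. \<alpha> Q v) (at P)) (at P)"
  unfolding form_differentiable_def by (simp add: frechet_derivative_works)

lemma ext_dI:
  assumes "\<And>v. ((\<lambda>Q. \<alpha> Q v) has_derivative (\<lambda>u. D u v)) (at P)"
  shows "ext_d \<alpha> P u v = D u v - D v u" "form_differentiable \<alpha> P"
proof -
  show "ext_d \<alpha> P u v = D u v - D v u"
    unfolding ext_d_def
    using fun_cong[OF frechet_derivative_at[OF assms[of v]], of u] fun_cong[OF frechet_derivative_at[OF assms[of u]], of v]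
    by simp
  show "form_differentiable \<alpha> P"
    unfolding form_differentiable_def using assms differentiableI by blast
qed

lemma ext_d_add:
  assumes "form_differentiable \<alpha> P" "form_differentiable \<beta> P"
  shows "ext_d (\<lambda>P v. \<alpha> P v + \<beta> P v) P u v = ext_d \<alpha> P u v + ext_d \<beta> P u v"
    "form_differentiable (\<lambda>P v. \<alpha> P v + \<beta> P v) P"
  using ext_dI[of "\<lambda>P v. \<alpha> P v + \<beta> P v", OF has_derivative_add[OF assms(1)[THEN form_differentiableD] assms(2)[THEN form_differentiableD]]]
  by (simp_all add: ext_d_def)

lemma ext_d_diff:
  assumes "form_differentiable \<alpha> P" "form_differentiable \<beta> P"
  shows "ext_d (\<lambda>P v. \<alpha> P v - \<beta> P v) P u v = ext_d \<alpha> P u v - ext_d \<beta> P u v"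
    "form_differentiable (\<lambda>P v. \<alpha> P v - \<beta> P v) P"
  using ext_dI[of "\<lambda>P v. \<alpha> P v - \<beta> P v", OF has_derivative_diff[OF assms(1)[THEN form_differentiableD] assms(2)[THEN form_differentiableD]]]
  by (simp_all add: ext_d_def)

lemma ext_d_bounded_linear:
  assumes "bounded_linear L" "form_differentiable \<alpha> P"
  shows "ext_d (\<lambda>P v. L (\<alpha> P v)) P u v = L (ext_d \<alpha> P u v)"
    "form_differentiable (\<lambda>P v. L (\<alpha> P v)) P"
  using ext_dI[OF bounded_linear.has_derivative[OF assms(1) form_differentiableD[OF assms(2)]]]
  by (simp_all add: ext_d_def bounded_linear.linear[OF assms(1)] linear_diff)

lemma ext_d_fmult:
  fixes \<alpha> :: "'e::euclidean_space \<Rightarrow> 'e \<Rightarrow> 'b::real_normed_field"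
  assumes "(f has_derivative f') (at P)" "form_differentiable \<alpha> P"
  shows "ext_d (\<lambda>P v. f P * \<alpha> P v) P u v = f' u * \<alpha> P v - f' v * \<alpha> P u + f P * ext_d \<alpha> P u v"
    "form_differentiable (\<lambda>P v. f P * \<alpha> P v) P"
  using ext_dI[OF has_derivative_mult[OF assms(1) form_differentiableD[OF assms(2)]]]
  by (simp_all add: ext_d_def algebra_simps)

lemma ext_d_pullback:
  assumes L: "bounded_linear L" and \<alpha>: "form_differentiable \<alpha> (L P)"
  shows "ext_d (\<lambda>P v. \<alpha> (L P) (L v)) P u v = ext_d \<alpha> (L P) (L u) (L v)"
    "form_differentiable (\<lambda>P v. \<alpha> (L P) (L v)) P"
  using ext_dI[OF has_derivative_compose[OF bounded_linear_imp_has_derivative[OF L] form_differentiableD[OF \<alpha>]]]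
  by (simp_all add: ext_d_def)

lemma has_derivative_form_apply:
  fixes \<alpha> :: "'e::euclidean_space \<Rightarrow> 'e \<Rightarrow> 'b::real_normed_vector"
  assumes V: "open V" "z \<in> V" and lin: "\<And>P. P \<in> V \<Longrightarrow> linear (\<alpha> P)"
    and diff: "form_differentiable \<alpha> z" and Y: "(Y has_derivative Y') (at z)"
  shows "((\<lambda>Q. \<alpha> Q (Y Q)) has_derivative
    (\<lambda>h. frechet_derivative (\<lambda>Q. \<alpha> Q (Y z)) (at z) h + \<alpha> z (Y' h))) (at z)"
proof -
  have exp: "\<alpha> Q w = (\<Sum>b\<in>Basis. (w \<bullet> b) *\<^sub>R \<alpha> Q b)" if "Q \<in> V" for Q w
  proof -
    have "\<alpha> Q w = \<alpha> Q (\<Sum>b\<in>Basis. (w \<bullet> b) *\<^sub>R b)"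
      by (simp add: euclidean_representation)
    then show ?thesis
      by (simp add: linear_sum[OF lin[OF that]] linear_scale[OF lin[OF that]])
  qed
  let ?D = "\<lambda>v. frechet_derivative (\<lambda>Q. \<alpha> Q v) (at z)"
  have Dexp: "?D w h = (\<Sum>b\<in>Basis. (w \<bullet> b) *\<^sub>R ?D b h)" for w h
  proof -
    have "((\<lambda>Q. \<Sum>b\<in>Basis. (w \<bullet> b) *\<^sub>R \<alpha> Q b) has_derivative (\<lambda>h. \<Sum>b\<in>Basis. (w \<bullet> b) *\<^sub>R ?D b h)) (at z)"
      by (intro has_derivative_sum has_derivative_scaleR_right form_differentiableD[OF diff])
    then have "((\<lambda>Q. \<alpha> Q w) has_derivative (\<lambda>h. \<Sum>b\<in>Basis. (w \<bullet> b) *\<^sub>R ?D b h)) (at z)"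
      by (rule has_derivative_transform_within_open[OF _ V]) (rule exp[symmetric])
    from fun_cong[OF frechet_derivative_at[OF this], of h] show ?thesis by (rule sym)
  qed
  have "((\<lambda>Q. (Y Q \<bullet> b) *\<^sub>R \<alpha> Q b) has_derivative (\<lambda>h. (Y z \<bullet> b) *\<^sub>R ?D b h + (Y' h \<bullet> b) *\<^sub>R \<alpha> z b)) (at z)" for b
    by (rule has_derivative_scaleR[OF has_derivative_inner_left[OF Y] form_differentiableD[OF diff]])
  then have "((\<lambda>Q. \<Sum>b\<in>Basis. (Y Q \<bullet> b) *\<^sub>R \<alpha> Q b) has_derivative
     (\<lambda>h. \<Sum>b\<in>Basis. (Y z \<bullet> b) *\<^sub>R ?D b h + (Y' h \<bullet> b) *\<^sub>R \<alpha> z b)) (at z)"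
    by (rule has_derivative_sum)
  moreover have "(\<lambda>h. \<Sum>b\<in>Basis. (Y z \<bullet> b) *\<^sub>R ?D b h + (Y' h \<bullet> b) *\<^sub>R \<alpha> z b) = (\<lambda>h. ?D (Y z) h + \<alpha> z (Y' h))"
    by (rule ext, subst Dexp, subst exp[OF V(2)]) (rule sum.distrib)
  ultimately have "((\<lambda>Q. \<Sum>b\<in>Basis. (Y Q \<bullet> b) *\<^sub>R \<alpha> Q b) has_derivative (\<lambda>h. ?D (Y z) h + \<alpha> z (Y' h))) (at z)"
    by simp
  then show ?thesis
    by (rule has_derivative_transform_within_open[OF _ V]) (rule exp[symmetric])
qed

text \<open>If \<open>Y\<close>, \<open>Z\<close> are tangent fields extending v and u, the closed forms in N kill the bracket of
  \<open>Z\<close> and \<open>Y\<close> at z, so the bracket is tangent and \<open>\<alpha>\<close> kills it; hence \<open>d\<alpha>(u, v) = 0\<close>.\<close>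

lemma ext_d_eq_0_if_zero_on_tangent:
  fixes \<alpha> :: "'e::euclidean_space \<Rightarrow> 'e \<Rightarrow> 'b::real_normed_vector" and N :: "('e \<Rightarrow> 'e \<Rightarrow> real) set"
  assumes V: "open V" "z \<in> V" and z: "z \<in> S"
    and lin: "\<And>P. P \<in> V \<Longrightarrow> linear (\<alpha> P)" and diff: "form_differentiable \<alpha> z"
    and zero: "\<And>P v. P \<in> S \<inter> V \<Longrightarrow> v \<in> tangent_space S P \<Longrightarrow> \<alpha> P v = 0"
    and N: "\<And>P. P \<in> S \<inter> V \<Longrightarrow> tangent_space S P = {v. \<forall>\<nu>\<in>N. \<nu> P v = 0}"
    and Nlin: "\<And>P \<nu>. P \<in> V \<Longrightarrow> \<nu> \<in> N \<Longrightarrow> linear (\<nu> P)"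
    and Ndiff: "\<And>\<nu>. \<nu> \<in> N \<Longrightarrow> form_differentiable \<nu> z"
    and Nclosed: "\<And>\<nu> u v. \<nu> \<in> N \<Longrightarrow> u \<in> tangent_space S z \<Longrightarrow> v \<in> tangent_space S z \<Longrightarrow> ext_d \<nu> z u v = 0"
    and fields: "\<And>v. v \<in> tangent_space S z \<Longrightarrow> \<exists>Y Y'. (Y has_derivative Y') (at z) \<and> Y z = v \<and>
      (\<forall>P\<in>S \<inter> V. Y P \<in> tangent_space S P)"
    and u: "u \<in> tangent_space S z" and v: "v \<in> tangent_space S z"
  shows "ext_d \<alpha> z u v = 0"
proof -
  obtain Y Y' where Y: "(Y has_derivative Y') (at z)" "Y z = v" "\<And>P. P \<in> S \<inter> V \<Longrightarrow> Y P \<in> tangent_space S P"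
    using fields[OF v] by blast
  obtain Z Z' where Z: "(Z has_derivative Z') (at z)" "Z z = u" "\<And>P. P \<in> S \<inter> V \<Longrightarrow> Z P \<in> tangent_space S P"
    using fields[OF u] by blast
  \<comment> \<open>Differentiate \<beta>(Y) = 0 along u and \<beta>(Z) = 0 along v, and
    subtract.\<close>
  have *: "ext_d \<beta> z u v = - \<beta> z (Y' u - Z' v)"
    if \<beta>: "\<And>P. P \<in> V \<Longrightarrow> linear (\<beta> P)" "form_differentiable \<beta> z"
      "\<And>P v. P \<in> S \<inter> V \<Longrightarrow> v \<in> tangent_space S P \<Longrightarrow> \<beta> P v = 0"
    for \<beta> :: "'e \<Rightarrow> 'e \<Rightarrow> 'c::real_normed_vector"
  proof -
    have "frechet_derivative (\<lambda>Q. \<beta> Q (Y z)) (at z) u + \<beta> z (Y' u) = 0"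
      by (rule tangent_derivative_0[OF u V _ has_derivative_form_apply[OF V \<beta>(1,2) Y(1)], where a = 0])
        (use \<beta>(3) Y(3) in auto)
    moreover have "frechet_derivative (\<lambda>Q. \<beta> Q (Z z)) (at z) v + \<beta> z (Z' v) = 0"
      by (rule tangent_derivative_0[OF v V _ has_derivative_form_apply[OF V \<beta>(1,2) Z(1)], where a = 0])
        (use \<beta>(3) Z(3) in auto)
    ultimately show ?thesis
      using Y(2) Z(2) linear_diff[OF \<beta>(1)[OF V(2)]]
      by (simp add: ext_d_def eq_neg_iff_add_eq_0[symmetric])
  qed
  have "\<nu> z (Y' u - Z' v) = 0" if "\<nu> \<in> N" for \<nu>
  proof -
    have "ext_d \<nu> z u v = - \<nu> z (Y' u - Z' v)"
      by (rule *) (use N Nlin Ndiff that in auto)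
    then show ?thesis
      using Nclosed[OF that u v] by simp
  qed
  then have "Y' u - Z' v \<in> tangent_space S z"
    using N z V by auto
  then have "\<alpha> z (Y' u - Z' v) = 0"
    using zero z V by auto
  then show ?thesis
    using *[OF lin diff zero] by auto
qed

section \<open>The orthonormal frame bundle of Euclidean space\<close>

lemma orthonormal_expand:
  fixes F :: "real^3^3"
  assumes "\<forall>i j. F $ i \<bullet> F $ j = (if i = j then 1 else 0)"
  shows "a = (\<Sum>l\<in>UNIV. (F $ l \<bullet> a) *\<^sub>R F $ l)" "a \<bullet> b = (\<Sum>l\<in>UNIV. (F $ l \<bullet> a) * (F $ l \<bullet> b))"
proof -
  have "F ** transpose F = mat 1"
    using assms by (simp add: vec_eq_iff matrix_matrix_mult_def transpose_def mat_def inner_vec_def)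
  then have "transpose F ** F = mat 1"
    using matrix_left_right_inverse by blast
  then have "a = (transpose F ** F) *v a"
    by simp
  also have "\<dots> = transpose F *v (F *v a)"
    by (simp add: matrix_vector_mul_assoc)
  also have "\<dots> = (\<Sum>l\<in>UNIV. (F $ l \<bullet> a) *\<^sub>R F $ l)"
    by (simp add: vec_eq_iff matrix_vector_mult_def transpose_def inner_vec_def mult.commute)
  finally show 1: "a = (\<Sum>l\<in>UNIV. (F $ l \<bullet> a) *\<^sub>R F $ l)" .
  have "a \<bullet> b = (\<Sum>l\<in>UNIV. (F $ l \<bullet> a) *\<^sub>R F $ l) \<bullet> b"
    using 1 by simp
  then show "a \<bullet> b = (\<Sum>l\<in>UNIV. (F $ l \<bullet> a) * (F $ l \<bullet> b))"
    by (simp add: inner_sum_left)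
qed

text \<open>Rotation of the frame vectors i and j in their plane. Such rotations preserve
  orthonormality and their velocities span the skew matrices, so they provide curves in the frame
  bundle.\<close>

definition rot :: "3 \<Rightarrow> 3 \<Rightarrow> real \<Rightarrow> real^3^3 \<Rightarrow> real^3^3" where
  "rot i j \<theta> F = (\<chi> l. if l = i then cos \<theta> *\<^sub>R F $ i - sin \<theta> *\<^sub>R F $ j
     else if l = j then sin \<theta> *\<^sub>R F $ i + cos \<theta> *\<^sub>R F $ j else F $ l)"

lemma rot_orthonormal:
  assumes "\<forall>a b. F $ a \<bullet> F $ b = (if a = b then 1 else 0)" "i \<noteq> j"
  shows "\<forall>a b. rot i j \<theta> F $ a \<bullet> rot i j \<theta> F $ b = (if a = b then 1 else 0)"
proof -
  have "sin \<theta> * sin \<theta> + cos \<theta> * cos \<theta> = 1"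
    using sin_cos_squared_add[of \<theta>] by (simp add: power2_eq_square)
  then show ?thesis
    using assms by (simp add: rot_def algebra_simps inner_simps)
qed

lemma rot_has_derivative:
  assumes "(F has_derivative F') (at 0)" "i \<noteq> j"
  shows "((\<lambda>t. rot i j (s * t) (F t)) has_derivative
    (\<lambda>h. F' h + (\<chi> l. if l = i then - (s * h) *\<^sub>R F 0 $ j else if l = j then (s * h) *\<^sub>R F 0 $ i else 0))) (at (0::real))"
proof -
  have F: "((\<lambda>t. F t $ l) has_derivative (\<lambda>h. F' h $ l)) (at 0)" for l
    using bounded_linear.has_derivative[OF bounded_linear_vec_nth assms(1)] .
  have s: "((\<lambda>t. sin (s * t)) has_derivative (\<lambda>h. s * h)) (at 0)"
    "((\<lambda>t. cos (s * t)) has_derivative (\<lambda>h. 0)) (at 0)"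
    by (auto intro!: derivative_eq_intros)
  have "((\<lambda>t. if l = i then cos (s * t) *\<^sub>R F t $ i - sin (s * t) *\<^sub>R F t $ j
     else if l = j then sin (s * t) *\<^sub>R F t $ i + cos (s * t) *\<^sub>R F t $ j else F t $ l) has_derivative
    (\<lambda>h. (F' h + (\<chi> l. if l = i then - (s * h) *\<^sub>R F 0 $ j else if l = j then (s * h) *\<^sub>R F 0 $ i else 0)) $ l)) (at 0)" for l
  proof -
    consider "l = i" | "l = j" "l \<noteq> i" | "l \<noteq> i" "l \<noteq> j" by blast
    then show ?thesis
    proof cases
      case 1
      then show ?thesis
        using has_derivative_diff[OF has_derivative_scaleR[OF s(2) F[of i]] has_derivative_scaleR[OF s(1) F[of j]]]
        by (simp add: fun_eq_iff)
    next
      case 2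
      then show ?thesis
        using has_derivative_add[OF has_derivative_scaleR[OF s(1) F[of i]] has_derivative_scaleR[OF s(2) F[of j]]]
        by (simp add: fun_eq_iff add.commute)
    next
      case 3
      then show ?thesis
        using F[of l] by simp
    qed
  qed
  then show ?thesis
    unfolding rot_def
    by (intro has_derivative_eq_rhs[OF has_derivative_vec_lambda]) (assumption, simp add: vec_eq_iff fun_eq_iff)
qed

lemma rot_0: "i \<noteq> j \<Longrightarrow> rot i j 0 F = F"
  by (simp add: rot_def vec_eq_iff)

text \<open>The vector on which \<open>\<omega>\<^sup>i\<close> takes the values
  \<open>fst r\<close> and \<open>\<omega>\<^sup>1\<^sub>2\<close>,
  \<open>\<omega>\<^sup>3\<^sub>1\<close>, \<open>\<omega>\<^sup>3\<^sub>2\<close> the values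
  \<open>snd r\<close>, read off from
  \<open>de\<^sub>i = e\<^sub>j \<omega>\<^sup>j\<^sub>i\<close>. For fixed r it is a field on the
  whole ambient space.\<close>

definition euc_field :: "euc_frame \<Rightarrow> (real^3) \<times> (real^3) \<Rightarrow> euc_frame" where
  "euc_field Q r = (let F = snd Q; a = snd r $ 1; b = snd r $ 2; c = snd r $ 3 in
    (\<Sum>i\<in>UNIV. fst r $ i *\<^sub>R F $ i,
     \<chi> i. if i = 1 then b *\<^sub>R F $ 3 - a *\<^sub>R F $ 2 else if i = 2 then a *\<^sub>R F $ 1 + c *\<^sub>R F $ 3
       else - (b *\<^sub>R F $ 1) - c *\<^sub>R F $ 2))"

definition euc_coeff :: "euc_frame \<Rightarrow> euc_frame \<Rightarrow> (real^3) \<times> (real^3)" where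
  "euc_coeff Q v = (\<chi> i. omega i Q v,
     \<chi> i. if i = 1 then omega_conn 1 2 Q v else if i = 2 then omega_conn 3 1 Q v else omega_conn 3 2 Q v)"

lemma euc_frameD: "Q \<in> euc_frame_bundle \<Longrightarrow> \<forall>i j. snd Q $ i \<bullet> snd Q $ j = (if i = j then 1 else 0)"
  by (auto simp: euc_frame_bundle_def)

lemma euc_field_coeff:
  assumes Q: "Q \<in> euc_frame_bundle" and v: "\<forall>i j. omega_conn i j Q v + omega_conn j i Q v = 0"
  shows "euc_field Q (euc_coeff Q v) = v"
proof -
  let ?F = "snd Q"
  have 1: "(\<Sum>i\<in>UNIV. (?F $ i \<bullet> fst v) *\<^sub>R ?F $ i) = fst v"
    using orthonormal_expand(1)[OF euc_frameD[OF Q]] by metis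
  have e: "snd v $ j = (\<Sum>i\<in>UNIV. omega_conn i j Q v *\<^sub>R ?F $ i)" for j
    unfolding omega_conn_def by (rule orthonormal_expand(1)[OF euc_frameD[OF Q]])
  have v': "omega_conn i i Q v = 0" "omega_conn 2 1 Q v = - omega_conn 1 2 Q v"
     "omega_conn 1 3 Q v = - omega_conn 3 1 Q v" "omega_conn 2 3 Q v = - omega_conn 3 2 Q v" for i
    using v[rule_format, of i i] v[rule_format, of 2 1] v[rule_format, of 1 3] v[rule_format, of 2 3] by simp_all
  have "snd (euc_field Q (euc_coeff Q v)) $ j = snd v $ j" for j
    unfolding e using exhaust_3[of j] by (auto simp: euc_field_def euc_coeff_def Let_def sum_3 v')
  then show ?thesis
    using 1 by (simp add: prod_eq_iff vec_eq_iff[of "snd _"] euc_field_def euc_coeff_def omega_def Let_def)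
qed

lemma omega_euc_field:
  assumes Q: "Q \<in> euc_frame_bundle"
  shows "omega i Q (euc_field Q r) = fst r $ i"
    "omega_conn 1 2 Q (euc_field Q r) = snd r $ 1" "omega_conn 2 1 Q (euc_field Q r) = - snd r $ 1"
    "omega_conn 3 1 Q (euc_field Q r) = snd r $ 2" "omega_conn 1 3 Q (euc_field Q r) = - snd r $ 2"
    "omega_conn 3 2 Q (euc_field Q r) = snd r $ 3" "omega_conn 2 3 Q (euc_field Q r) = - snd r $ 3"
    "omega_conn j j Q (euc_field Q r) = 0"
  using euc_frameD[OF Q] exhaust_3[of i] exhaust_3[of j]
  by (auto simp: omega_def omega_conn_def euc_field_def Let_def inner_simps sum_3)

lemma euc_field_skew:
  assumes Q: "Q \<in> euc_frame_bundle"
  shows "omega_conn i j Q (euc_field Q r) + omega_conn j i Q (euc_field Q r) = 0"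
  using exhaust_3[of i] exhaust_3[of j] by (auto simp: omega_euc_field[OF Q])

text \<open>One inclusion differentiates the orthonormality relations. For the other, a composition
  of three plane rotations with suitable speeds has the given skew matrix as its velocity.\<close>

lemma euc_tangent:
  assumes Q: "Q \<in> euc_frame_bundle"
  shows "tangent_space euc_frame_bundle Q = {v. \<forall>i j. omega_conn i j Q v + omega_conn j i Q v = 0}"
proof (intro set_eqI iffI)
  fix v assume v: "v \<in> tangent_space euc_frame_bundle Q"
  have "omega_conn i j Q v + omega_conn j i Q v = 0" for i j
  proof -
    have nth: "((\<lambda>P. snd P $ i) has_derivative (\<lambda>u. snd u $ i)) (at Q)" for i :: 3 and Q :: euc_frame
      by (auto intro!: bounded_linear_imp_has_derivative bounded_linear_compose[OF bounded_linear_vec_nth bounded_linear_snd])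
    have "((\<lambda>P. snd P $ i \<bullet> snd P $ j) has_derivative (\<lambda>u. snd Q $ i \<bullet> snd u $ j + snd u $ i \<bullet> snd Q $ j)) (at Q)"
      by (rule has_derivative_inner[OF nth nth])
    from tangent_derivative_0[OF v open_UNIV UNIV_I _ this, of "if i = j then 1 else 0"] show ?thesis
      using euc_frameD by (simp add: omega_conn_def inner_commute)
  qed
  then show "v \<in> {v. \<forall>i j. omega_conn i j Q v + omega_conn j i Q v = 0}" by simp
next
  fix v assume v: "v \<in> {v. \<forall>i j. omega_conn i j Q v + omega_conn j i Q v = 0}"
  define r where "r = snd (euc_coeff Q v)"
  have veq: "v = euc_field Q (euc_coeff Q v)"
    using euc_field_coeff[OF Q] v by simp
  have sv: "snd v = (\<chi> i. if i = 1 then r $ 2 *\<^sub>R snd Q $ 3 - r $ 1 *\<^sub>R snd Q $ 2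
      else if i = 2 then r $ 1 *\<^sub>R snd Q $ 1 + r $ 3 *\<^sub>R snd Q $ 3
      else - (r $ 2 *\<^sub>R snd Q $ 1) - r $ 3 *\<^sub>R snd Q $ 2)"
    using arg_cong[OF veq, of snd] by (simp add: euc_field_def r_def[symmetric] Let_def)
  define F where "F t = rot 1 2 (r $ 1 * t) (rot 1 3 (- r $ 2 * t) (rot 2 3 (- r $ 3 * t) (snd Q)))" for t
  have "(F has_derivative (\<lambda>h. h *\<^sub>R snd v)) (at 0)"
    unfolding F_def
    by (rule has_derivative_eq_rhs[OF rot_has_derivative[OF rot_has_derivative[OF rot_has_derivative[OF has_derivative_const]]]])
      (simp_all add: rot_0 sv fun_eq_iff vec_eq_iff forall_3 algebra_simps)
  then have "((\<lambda>t. (fst Q + t *\<^sub>R fst v, F t)) has_vector_derivative v) (at 0)"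
    unfolding has_vector_derivative_def
    by (auto intro!: derivative_eq_intros simp: fun_eq_iff prod_eq_iff)
  then show "v \<in> tangent_space euc_frame_bundle Q"
  proof (rule tangent_spaceI)
    show "(fst Q + 0 *\<^sub>R fst v, F 0) = Q"
      by (simp add: F_def rot_0)
    have "\<forall>i j. F t $ i \<bullet> F t $ j = (if i = j then 1 else 0)" for t
      unfolding F_def by (intro rot_orthonormal euc_frameD[OF Q]) simp_all
    then show "\<forall>\<^sub>F t in nhds 0. (fst Q + t *\<^sub>R fst v, F t) \<in> euc_frame_bundle"
      by (simp add: euc_frame_bundle_def)
  qed
qed

text \<open>Differentiating \<open>omega i\<close> leaves inner products of velocities; expanded in
  the orthonormal frame they give the structure equation.\<close>

lemma ext_d_omega:
  assumes Q: "Q \<in> euc_frame_bundle"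
  shows "ext_d (omega i) Q u v =
      (\<Sum>j\<in>UNIV. omega_conn j i Q u * omega j Q v - omega_conn j i Q v * omega j Q u)"
    "form_differentiable (omega i) Q"
proof -
  have d: "((\<lambda>Q. omega i Q v) has_derivative (\<lambda>u. snd u $ i \<bullet> fst v)) (at Q)" for v
    unfolding omega_def
    by (auto intro!: bounded_linear_imp_has_derivative bounded_linear_compose[OF bounded_linear_inner_left]
      bounded_linear_compose[OF bounded_linear_vec_nth bounded_linear_snd])
  show "form_differentiable (omega i) Q"
    using ext_dI(2)[OF d] .
  show "ext_d (omega i) Q u v = (\<Sum>j\<in>UNIV. omega_conn j i Q u * omega j Q v - omega_conn j i Q v * omega j Q u)"
    unfolding ext_dI(1)[OF d] orthonormal_expand(2)[OF euc_frameD[OF Q], of "snd _ $ i"]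
    by (simp add: omega_def omega_conn_def sum_subtractf)
qed

lemma ext_d_omega_conn:
  assumes Q: "Q \<in> euc_frame_bundle"
  shows "ext_d (omega_conn i j) Q u v =
      (\<Sum>l\<in>UNIV. omega_conn l i Q u * omega_conn l j Q v - omega_conn l i Q v * omega_conn l j Q u)"
    "form_differentiable (omega_conn i j) Q"
proof -
  have d: "((\<lambda>Q. omega_conn i j Q v) has_derivative (\<lambda>u. snd u $ i \<bullet> snd v $ j)) (at Q)" for v
    unfolding omega_conn_def
    by (auto intro!: bounded_linear_imp_has_derivative bounded_linear_compose[OF bounded_linear_inner_left]
      bounded_linear_compose[OF bounded_linear_vec_nth bounded_linear_snd])
  show "form_differentiable (omega_conn i j) Q"
    using ext_dI(2)[OF d] .
  show "ext_d (omega_conn i j) Q u v =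
      (\<Sum>l\<in>UNIV. omega_conn l i Q u * omega_conn l j Q v - omega_conn l i Q v * omega_conn l j Q u)"
    unfolding ext_dI(1)[OF d] orthonormal_expand(2)[OF euc_frameD[OF Q], of "snd _ $ i"]
    by (simp add: omega_conn_def sum_subtractf)
qed

lemma linear_omega: "linear (omega i Q)" "linear (omega_conn i j Q)"
  by (auto intro!: linearI simp: omega_def omega_conn_def inner_simps)

section \<open>The orthonormal frame bundle of the surface in a chart\<close>

context surface_chart
begin

abbreviation "et \<equiv> eta A g c"
abbreviation "cn \<equiv> conn A g c"

lemma conn_eq: "cn i j z v = G (fst z) (snd z $ i) (snd v $ j + Gam (fst z) (fst v) (snd z $ j))"
  by (simp add: conn_def Gam_def)

lemma frame_patchD:
  assumes "z \<in> FP"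
  shows "fst z \<in> U" "G (fst z) (snd z $ i) (snd z $ j) = (if i = j then 1 else 0)"
  using assms unfolding frame_patch_eq by auto

lemma linear_eta: "fst z \<in> U \<Longrightarrow> linear (et i z)"
  by (rule linearI) (simp_all add: eta_def G_simps)

lemma linear_conn: "fst z \<in> U \<Longrightarrow> linear (cn i j z)"
  by (rule linearI) (simp_all add: conn_eq G_simps Gam_simps scaleR_right_distrib[symmetric])

text \<open>With E the frame and g the metric matrix, orthonormality says that E has the right
  inverse g E^T; that this is also a left inverse is the expansion in the frame.\<close>

lemma frame_expand:
  assumes z: "z \<in> FP"
  shows "a = (\<Sum>l\<in>UNIV. G (fst z) (snd z $ l) a *\<^sub>R snd z $ l)"
    "G (fst z) a b = (\<Sum>l\<in>UNIV. G (fst z) (snd z $ l) a * G (fst z) (snd z $ l) b)"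
proof -
  note U = frame_patchD(1)[OF z]
  let ?E = "snd z" and ?M = "\<chi> i j. gm i j (fst z)"
  obtain d where d: "\<And>u w. G (fst z) u w = (\<Sum>i\<in>UNIV. \<Sum>j\<in>UNIV. u $ i * w $ j * d i j)"
      "\<And>i j. gm i j (fst z) = d i j"
    by (rule that[of "\<lambda>i j. gm i j (fst z)"], rule G_expand[OF U]) (rule refl)
  have s: "d 2 1 = d 1 2"
    unfolding d(2)[symmetric] by (rule G_sym[OF U])
  have "?E ** (?M ** transpose ?E) = mat 1"
    using frame_patchD(2)[OF z, of 1 1] frame_patchD(2)[OF z, of 1 2] frame_patchD(2)[OF z, of 2 1]
      frame_patchD(2)[OF z, of 2 2]
    by (simp add: vec_eq_iff forall_2 matrix_matrix_mult_def transpose_def mat_def d(2))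
      (simp add: d(1) sum_2 algebra_simps)
  then have "(?M ** transpose ?E) ** ?E = mat 1"
    using matrix_left_right_inverse by blast
  then have "transpose ((?M ** transpose ?E) ** ?E) *v a = a"
    by (simp add: transpose_mat)
  moreover have "transpose ((?M ** transpose ?E) ** ?E) *v a = (\<Sum>l\<in>UNIV. G (fst z) (snd z $ l) a *\<^sub>R snd z $ l)"
    by (simp add: vec_eq_iff matrix_vector_mult_def matrix_matrix_mult_def transpose_def d(2))
      (simp add: d(1) s sum_2 algebra_simps)
  ultimately show 1: "a = (\<Sum>l\<in>UNIV. G (fst z) (snd z $ l) a *\<^sub>R snd z $ l)" by simp
  have "G (fst z) a b = G (fst z) (\<Sum>l\<in>UNIV. G (fst z) (snd z $ l) a *\<^sub>R snd z $ l) b"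
    using 1 by simp
  then show "G (fst z) a b = (\<Sum>l\<in>UNIV. G (fst z) (snd z $ l) a * G (fst z) (snd z $ l) b)"
    by (simp add: sum_2 G_simps[OF U])
qed

text \<open>The numbers \<open>et i z u\<close>, \<open>et i z v\<close> form the product of the
  matrices of the frame, the metric and the pair (u, v); its determinant is the product of the three
  determinants in \<open>curvature_det\<close>.\<close>

lemma frame_curvature:
  assumes z: "z \<in> FP"
  shows "G (fst z) (snd z $ 1) (Rm (fst z) (fst u) (fst v) (snd z $ 2)) =
    gauss_curvature_in A g c (fst z) * (et 1 z u * et 2 z v - et 1 z v * et 2 z u)"
proof -
  note U = frame_patchD(1)[OF z]
  obtain d where d: "\<And>u w. G (fst z) u w = (\<Sum>i\<in>UNIV. \<Sum>j\<in>UNIV. u $ i * w $ j * d i j)"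
      "\<And>i j. gm i j (fst z) = d i j"
    by (rule that[of "\<lambda>i j. gm i j (fst z)"], rule G_expand[OF U]) (rule refl)
  have s: "d 2 1 = d 1 2"
    unfolding d(2)[symmetric] by (rule G_sym[OF U])
  show ?thesis
    unfolding curvature_det[OF U] eta_def d(2) unfolding d(1) sum_2 s by algebra
qed

text \<open>The analogue of \<open>euc_field\<close>, with prescribed \<open>\<eta>\<^sup>1\<close>,
  \<open>\<eta>\<^sup>2\<close>, \<open>\<eta>\<^sup>1\<^sub>2\<close>. The \<open>Gam\<close> term
  is subtracted because \<open>conn\<close> measures covariant derivatives of the frame
  vectors.\<close>

definition surf_field :: "surf_coords \<Rightarrow> (real^2) \<times> real \<Rightarrow> surf_coords" where
  "surf_field z r = (let u = \<Sum>i\<in>UNIV. fst r $ i *\<^sub>R snd z $ i in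
    (u, \<chi> j. (if j = 1 then - (snd r *\<^sub>R snd z $ 2) else snd r *\<^sub>R snd z $ 1) - Gam (fst z) u (snd z $ j)))"

definition surf_coeff :: "surf_coords \<Rightarrow> surf_coords \<Rightarrow> (real^2) \<times> real" where
  "surf_coeff z v = (\<chi> i. et i z v, cn 1 2 z v)"

lemma surf_field_coeff:
  assumes z: "z \<in> FP" and v: "\<forall>i j. cn i j z v + cn j i z v = 0"
  shows "surf_field z (surf_coeff z v) = v"
proof -
  have 1: "(\<Sum>i\<in>UNIV. et i z v *\<^sub>R snd z $ i) = fst v"
    unfolding eta_def using frame_expand(1)[OF z, of "fst v"] by simp
  have e: "snd v $ j = (\<Sum>i\<in>UNIV. cn i j z v *\<^sub>R snd z $ i) - Gam (fst z) (fst v) (snd z $ j)" for j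
    using frame_expand(1)[OF z, of "snd v $ j + Gam (fst z) (fst v) (snd z $ j)"]
    unfolding conn_eq by (simp add: eq_diff_eq)
  have v': "cn i i z v = 0" "cn 2 1 z v = - cn 1 2 z v" for i
    using v[rule_format, of i i] v[rule_format, of 2 1] by simp_all
  have "snd (surf_field z (surf_coeff z v)) $ j = snd v $ j" for j
    unfolding e using exhaust_2[of j] 1 by (auto simp: surf_field_def surf_coeff_def Let_def v' sum_2)
  then show ?thesis
    using 1 by (simp add: prod_eq_iff vec_eq_iff[of "snd _"] surf_field_def surf_coeff_def Let_def)
qed

lemma eta_surf_field:
  assumes z: "z \<in> FP"
  shows "et i z (surf_field z r) = fst r $ i"
    "cn 1 2 z (surf_field z r) = snd r" "cn 2 1 z (surf_field z r) = - snd r" "cn j j z (surf_field z r) = 0"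
  using frame_patchD(2)[OF z] G_simps[OF frame_patchD(1)[OF z]] exhaust_2[of i] exhaust_2[of j]
  by (auto simp: eta_def conn_eq surf_field_def Let_def sum_2)

lemma surf_field_skew: "z \<in> FP \<Longrightarrow> cn i j z (surf_field z r) + cn j i z (surf_field z r) = 0"
  using exhaust_2[of i] exhaust_2[of j] by (auto simp: eta_surf_field)

text \<open>By metric compatibility, skewness of the connection forms is the linearisation of the
  orthonormality relations.\<close>

lemma frame_derivative:
  assumes U: "fst z \<in> U"
  shows "((\<lambda>P. G (fst P) (snd P $ i) (snd P $ j)) has_derivative (\<lambda>u. cn i j z u + cn j i z u)) (at z)"
proof -
  have nth: "((\<lambda>P. snd P $ i) has_derivative (\<lambda>u. snd u $ i)) (at Q)" for i :: 2 and Q :: surf_coords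
    by (auto intro!: bounded_linear_imp_has_derivative bounded_linear_compose[OF bounded_linear_vec_nth bounded_linear_snd])
  show ?thesis
    by (rule has_derivative_eq_rhs[OF has_derivative_G[OF bounded_linear_imp_has_derivative[OF bounded_linear_fst] U nth nth]])
      (simp add: fun_eq_iff conn_eq metric_compatible[OF U] G_simps[OF U] G_sym[OF U, of "snd z $ j"])
qed

text \<open>If the inner products agree with those of an orthonormal frame to first order,
  Gram-Schmidt does not change the velocity at 0.\<close>

lemma gram_schmidt_derivative:
  fixes E1 E2 :: "real \<Rightarrow> 'v::real_normed_vector" and n1 n2 m :: "real \<Rightarrow> real"
  assumes E: "(E1 has_derivative (\<lambda>h. h *\<^sub>R W1)) (at 0)" "(E2 has_derivative (\<lambda>h. h *\<^sub>R W2)) (at 0)"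
    and n: "(n1 has_derivative (\<lambda>h. 0)) (at 0)" "(n2 has_derivative (\<lambda>h. 0)) (at 0)" "(m has_derivative (\<lambda>h. 0)) (at 0)"
    and v: "n1 0 = 1" "n2 0 = 1" "m 0 = 0"
  shows "((\<lambda>t. (1 / sqrt (n1 t)) *\<^sub>R E1 t) has_derivative (\<lambda>h. h *\<^sub>R W1)) (at 0)"
    "((\<lambda>t. (1 / sqrt (n2 t - m t * m t / n1 t)) *\<^sub>R (E2 t - (m t / n1 t) *\<^sub>R E1 t)) has_derivative (\<lambda>h. h *\<^sub>R W2)) (at 0)"
proof -
  have s: "((\<lambda>t. 1 / sqrt (f t)) has_derivative (\<lambda>h. 0)) (at 0)"
    if "(f has_derivative (\<lambda>h. 0)) (at 0)" "f 0 = 1" for f :: "real \<Rightarrow> real"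
  proof -
    have "((\<lambda>t. sqrt (f t)) has_derivative (\<lambda>h. 0)) (at 0)"
      by (rule has_derivative_eq_rhs[OF has_derivative_real_sqrt[OF _ that(1)]]) (use that(2) in auto)
    from has_derivative_divide[OF has_derivative_const this, of 1] show ?thesis
      using that(2) by (rule_tac has_derivative_eq_rhs) auto
  qed
  have q: "((\<lambda>t. m t / n1 t) has_derivative (\<lambda>h. 0)) (at 0)"
    by (rule has_derivative_eq_rhs[OF has_derivative_divide[OF n(3,1)]]) (use v in auto)
  have q2: "((\<lambda>t. n2 t - m t * m t / n1 t) has_derivative (\<lambda>h. 0)) (at 0)"
    by (rule has_derivative_eq_rhs[OF has_derivative_diff[OF n(2) has_derivative_divide[OF has_derivative_mult[OF n(3,3)] n(1)]]])
      (use v in auto)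
  show "((\<lambda>t. (1 / sqrt (n1 t)) *\<^sub>R E1 t) has_derivative (\<lambda>h. h *\<^sub>R W1)) (at 0)"
    by (rule has_derivative_eq_rhs[OF has_derivative_scaleR[OF s[OF n(1) v(1)] E(1)]]) (use v in auto)
  show "((\<lambda>t. (1 / sqrt (n2 t - m t * m t / n1 t)) *\<^sub>R (E2 t - (m t / n1 t) *\<^sub>R E1 t)) has_derivative (\<lambda>h. h *\<^sub>R W2)) (at 0)"
    by (rule has_derivative_eq_rhs[OF has_derivative_scaleR[OF s[OF q2] has_derivative_diff[OF E(2) has_derivative_scaleR[OF q E(1)]]]])
      (use v in auto)
qed

lemma surf_tangent:
  assumes z: "z \<in> FP"
  shows "tangent_space FP z = {v. \<forall>i j. cn i j z v + cn j i z v = 0}"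
proof (intro set_eqI iffI)
  fix v assume v: "v \<in> tangent_space FP z"
  have "cn i j z v + cn j i z v = 0" for i j
    using tangent_derivative_0[OF v open_UNIV UNIV_I _ frame_derivative[OF frame_patchD(1)[OF z]], where a = "if i = j then 1 else 0"]
      frame_patchD(2) by blast
  then show "v \<in> {v. \<forall>i j. cn i j z v + cn j i z v = 0}" by simp
next
  fix v assume v: "v \<in> {v. \<forall>i j. cn i j z v + cn j i z v = 0}"
  note U = frame_patchD(1)[OF z]
  \<comment> \<open>A straight line may leave the patch, but its frame is orthonormal to first
    order; orthonormalising it therefore keeps the velocity.\<close>
  define \<gamma> where "\<gamma> t = z + t *\<^sub>R v" for t
  have \<gamma>: "(\<gamma> has_derivative (\<lambda>h. h *\<^sub>R v)) (at 0)"
    unfolding \<gamma>_def by (auto intro!: derivative_eq_intros)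
  define n where "n i j t = G (fst (\<gamma> t)) (snd (\<gamma> t) $ i) (snd (\<gamma> t) $ j)" for i j t
  have n: "(n i j has_derivative (\<lambda>h. 0)) (at 0)" for i j
  proof -
    have "fst (\<gamma> 0) \<in> U" using U by (simp add: \<gamma>_def)
    from has_derivative_compose[OF \<gamma> frame_derivative[OF this]]
    show ?thesis
      unfolding n_def by (rule has_derivative_eq_rhs)
        (use v linear_scale[OF linear_conn[OF U]] in \<open>simp add: fun_eq_iff \<gamma>_def distrib_left[symmetric]\<close>)
  qed
  have n0: "n i j 0 = (if i = j then 1 else 0)" for i j
    using frame_patchD(2)[OF z] by (simp add: n_def \<gamma>_def)
  define F where "F t = (\<chi> i::2. if i = 1 then (1 / sqrt (n 1 1 t)) *\<^sub>R snd (\<gamma> t) $ 1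
     else (1 / sqrt (n 2 2 t - n 1 2 t * n 1 2 t / n 1 1 t)) *\<^sub>R (snd (\<gamma> t) $ 2 - (n 1 2 t / n 1 1 t) *\<^sub>R snd (\<gamma> t) $ 1))" for t
  have E: "((\<lambda>t. snd (\<gamma> t) $ i) has_derivative (\<lambda>h. h *\<^sub>R snd v $ i)) (at 0)" for i
    using bounded_linear.has_derivative[OF bounded_linear_compose[OF bounded_linear_vec_nth bounded_linear_snd] \<gamma>] by simp
  note gs = gram_schmidt_derivative[OF E[of 1] E[of 2] n[of 1 1] n[of 2 2] n[of 1 2]]
  have F': "(F has_derivative (\<lambda>h. h *\<^sub>R snd v)) (at 0)"
  proof -
    have "((\<lambda>t. if i = 1 then (1 / sqrt (n 1 1 t)) *\<^sub>R snd (\<gamma> t) $ 1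
     else (1 / sqrt (n 2 2 t - n 1 2 t * n 1 2 t / n 1 1 t)) *\<^sub>R (snd (\<gamma> t) $ 2 - (n 1 2 t / n 1 1 t) *\<^sub>R snd (\<gamma> t) $ 1))
      has_derivative (\<lambda>h. h *\<^sub>R snd v $ i)) (at 0)" for i :: 2
      using gs exhaust_2[of i] n0 by auto
    then show ?thesis
      unfolding F_def
      by (intro has_derivative_eq_rhs[OF has_derivative_vec_lambda]) (assumption, simp add: vec_eq_iff fun_eq_iff)
  qed
  have x': "((\<lambda>t. fst (\<gamma> t)) has_derivative (\<lambda>h. h *\<^sub>R fst v)) (at 0)"
    using bounded_linear.has_derivative[OF bounded_linear_fst \<gamma>] by simp
  have "((\<lambda>t. (fst (\<gamma> t), F t)) has_vector_derivative v) (at 0)"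
    using has_derivative_Pair[OF x' F'] unfolding has_vector_derivative_def by (simp add: scaleR_prod_def)
  then show "v \<in> tangent_space FP z"
  proof (rule tangent_spaceI)
    show z0: "(fst (\<gamma> 0), F 0) = z"
      using exhaust_2 by (auto simp: F_def n0 \<gamma>_def prod_eq_iff vec_eq_iff)
    \<comment> \<open>Positivity of the norms and of the determinant persists near 0, so the
      corrected curve is a curve of oriented frames there.\<close>
    have ev: "\<forall>\<^sub>F t in nhds 0. f t > 0" if "isCont f 0" "f 0 > 0" for f :: "real \<Rightarrow> real"
      using that order_tendstoD(1)[of f "f 0" "nhds 0" 0] by (simp add: isCont_def tendsto_at_iff_tendsto_nhds)
    have cn: "isCont (n i j) 0" for i j
      using has_derivative_continuous[OF n] .
    have cF: "isCont (\<lambda>t. F t $ i $ j) 0" for i j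
      using has_derivative_continuous[OF F'] by (intro continuous_intros) auto
    have e1: "\<forall>\<^sub>F t in nhds 0. n 1 1 t > 0"
      by (rule ev[OF cn]) (simp add: n0)
    have e2: "\<forall>\<^sub>F t in nhds 0. n 2 2 t - n 1 2 t * n 1 2 t / n 1 1 t > 0"
      by (rule ev) (auto intro!: continuous_intros cn simp: n0)
    have e3: "\<forall>\<^sub>F t in nhds 0. det (F t) > 0"
      by (rule ev) (use z0 z in \<open>auto intro!: continuous_intros cF simp: det_2 frame_patch_eq\<close>)
    have e4: "\<forall>\<^sub>F t in nhds 0. fst (\<gamma> t) \<in> U"
      by (rule eventually_in_U[OF x']) (simp add: \<gamma>_def U)
    show "\<forall>\<^sub>F t in nhds 0. (fst (\<gamma> t), F t) \<in> FP"
      using e1 e2 e3 e4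
    proof eventually_elim
      case (elim t)
      note S = G_simps[OF elim(4)]
      have n21: "n 2 1 t = n 1 2 t"
        unfolding n_def by (rule G_sym[OF elim(4)])
      define a where "a = sqrt (n 1 1 t)"
      define b where "b = sqrt (n 2 2 t - n 1 2 t * n 1 2 t / n 1 1 t)"
      have a: "a > 0" "a * a = n 1 1 t" and b: "b > 0" "b * b = n 2 2 t - n 1 2 t * n 1 2 t / n 1 1 t"
        using elim by (simp_all add: a_def b_def)
      have "G (fst (\<gamma> t)) (F t $ 1) (F t $ 1) = n 1 1 t / (a * a)"
        by (simp add: F_def S n_def[symmetric] a_def[symmetric])
      moreover have "G (fst (\<gamma> t)) (F t $ 1) (F t $ 2) = 0"
        using elim(1) by (simp add: F_def S n_def[symmetric])
      moreover have "G (fst (\<gamma> t)) (F t $ 2) (F t $ 1) = 0"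
        using elim(1) by (simp add: F_def S n_def[symmetric] n21)
      moreover have "G (fst (\<gamma> t)) (F t $ 2) (F t $ 2) = (n 2 2 t - n 1 2 t * n 1 2 t / n 1 1 t) / (b * b)"
      proof -
        let ?w = "snd (\<gamma> t) $ 2 - (n 1 2 t / n 1 1 t) *\<^sub>R snd (\<gamma> t) $ 1"
        have "G (fst (\<gamma> t)) ?w ?w = n 2 2 t - n 1 2 t * n 1 2 t / n 1 1 t"
          using elim(1) by (simp add: S n_def[symmetric] n21)
        moreover have "F t $ 2 = (1 / b) *\<^sub>R ?w"
          by (simp add: F_def b_def)
        ultimately show ?thesis
          by (simp add: S(3,4))
      qed
      ultimately show ?case
        using elim a b by (auto simp: frame_patch_eq forall_2)
    qed
  qed
qed

text \<open>Metric compatibility turns derivatives of \<open>G\<close> into covariant derivatives of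
  the frame; the remaining terms cancel by the symmetry of \<open>Gam\<close>, the absence of
  torsion.\<close>

lemma ext_d_eta:
  assumes z: "z \<in> FP"
  shows "ext_d (et i) z u v = (\<Sum>j\<in>UNIV. cn j i z u * et j z v - cn j i z v * et j z u)"
    "form_differentiable (et i) z"
proof -
  note U = frame_patchD(1)[OF z]
  have nth: "((\<lambda>P. snd P $ i) has_derivative (\<lambda>u. snd u $ i)) (at Q)" for i :: 2 and Q :: surf_coords
    by (auto intro!: bounded_linear_imp_has_derivative bounded_linear_compose[OF bounded_linear_vec_nth bounded_linear_snd])
  have d: "((\<lambda>Q. et i Q v) has_derivative
     (\<lambda>u. dG (fst z) (fst u) (snd z $ i) (fst v) + G (fst z) (snd u $ i) (fst v) + G (fst z) (snd z $ i) 0)) (at z)" for v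
    unfolding eta_def
    by (rule has_derivative_G[OF bounded_linear_imp_has_derivative[OF bounded_linear_fst] U nth has_derivative_const])
  show "form_differentiable (et i) z"
    using ext_dI(2)[OF d] .
  have e: "ext_d (et i) z u v = G (fst z) (snd u $ i + Gam (fst z) (fst u) (snd z $ i)) (fst v)
      - G (fst z) (snd v $ i + Gam (fst z) (fst v) (snd z $ i)) (fst u)"
    unfolding ext_dI(1)[OF d] by (simp add: metric_compatible[OF U] G_simps[OF U] Gam_sym[OF U, of "fst v" "fst u"])
  show "ext_d (et i) z u v = (\<Sum>j\<in>UNIV. cn j i z u * et j z v - cn j i z v * et j z u)"
    unfolding e by (subst (1 2) frame_expand(2)[OF z]) (simp add: conn_eq eta_def sum_subtractf)
qed

text \<open>The derivatives of \<open>Gam\<close> and its quadratic terms combine to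
  \<open>Rm\<close>; the rest is an inner product of covariant derivatives of frame vectors,
  expanded in the frame.\<close>

lemma ext_d_conn:
  assumes z: "z \<in> FP"
  shows "ext_d (cn i j) z u v = (\<Sum>l\<in>UNIV. cn l i z u * cn l j z v - cn l i z v * cn l j z u)
      + G (fst z) (snd z $ i) (Rm (fst z) (fst u) (fst v) (snd z $ j))"
    "form_differentiable (cn i j) z"
proof -
  note U = frame_patchD(1)[OF z]
  have nth: "((\<lambda>P. snd P $ i) has_derivative (\<lambda>u. snd u $ i)) (at Q)" for i :: 2 and Q :: surf_coords
    by (auto intro!: bounded_linear_imp_has_derivative bounded_linear_compose[OF bounded_linear_vec_nth bounded_linear_snd])
  note fst' = bounded_linear_imp_has_derivative[OF bounded_linear_fst]
  have d: "((\<lambda>Q. cn i j Q v) has_derivative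
     (\<lambda>u. dG (fst z) (fst u) (snd z $ i) (snd v $ j + Gam (fst z) (fst v) (snd z $ j))
        + G (fst z) (snd u $ i) (snd v $ j + Gam (fst z) (fst v) (snd z $ j))
        + G (fst z) (snd z $ i) (0 + (dGam (fst z) (fst u) (fst v) (snd z $ j) + Gam (fst z) 0 (snd z $ j) + Gam (fst z) (fst v) (snd u $ j))))) (at z)" for v
    unfolding conn_eq
    by (rule has_derivative_G[OF fst' U nth has_derivative_add[OF has_derivative_const has_derivative_Gam[OF fst' U has_derivative_const nth]]])
  show "form_differentiable (cn i j) z"
    using ext_dI(2)[OF d] .
  let ?D = "\<lambda>u i. snd u $ i + Gam (fst z) (fst u) (snd z $ i)"
  have e: "ext_d (cn i j) z u v = G (fst z) (?D u i) (?D v j) - G (fst z) (?D v i) (?D u j)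
      + G (fst z) (snd z $ i) (Rm (fst z) (fst u) (fst v) (snd z $ j))"
    unfolding ext_dI(1)[OF d] Rm_def by (simp add: metric_compatible[OF U] G_simps[OF U] Gam_simps)
  show "ext_d (cn i j) z u v = (\<Sum>l\<in>UNIV. cn l i z u * cn l j z v - cn l i z v * cn l j z u)
      + G (fst z) (snd z $ i) (Rm (fst z) (fst u) (fst v) (snd z $ j))"
    unfolding e by (subst (1 2) frame_expand(2)[OF z]) (simp add: conn_eq sum_subtractf)
qed

text \<open>By \<open>frame_derivative\<close> the symmetrised forms are differentials of functions,
  so they must be closed; in terms of curvature this is its skewness. It makes brackets of tangent
  fields tangent.\<close>

lemma ext_d_conn_sym:
  assumes z: "z \<in> FP"
  shows "ext_d (cn i j) z u v + ext_d (cn j i) z u v = 0"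
  using curvature_antisym[OF frame_patchD(1)[OF z], of "fst u" "fst v" "snd z $ i" "snd z $ j"]
    G_sym[OF frame_patchD(1)[OF z], of "snd z $ j"]
  unfolding ext_d_conn(1)[OF z] by (simp add: sum_2)

end

section \<open>The isometric embedding system in a chart\<close>

locale curved_chart = surface_chart +
  fixes K :: "'a \<Rightarrow> real"
  assumes gauss: "is_gauss_curvature A g K" and K_pos: "p \<in> topspace X \<Longrightarrow> K p > 0"
begin

definition S :: "coords set" where "S = FP \<times> euc_frame_bundle"
text \<open>An open neighbourhood of \<open>S\<close> in the ambient space on which the coframe and
  the fields \<open>fld\<close> are smooth.\<close>

definition Dom :: "coords set" where "Dom = {z. fst (fst z) \<in> U}"
definition kap :: "real^2 \<Rightarrow> real" where "kap x = sqrt (K (chart_inv c x))"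

text \<open>In the notation of the paper, \<open>e1, e2, al\<close> are \<open>\<eta>\<^sup>1, \<eta>\<^sup>2, \<eta>\<^sup>1\<^sub>2\<close>, and
  \<open>o1, o2, o3, o12, h1, h2\<close> are \<open>\<omega>\<^sup>1, \<omega>\<^sup>2, \<omega>\<^sup>3, \<omega>\<^sup>1\<^sub>2, \<omega>\<^sup>3\<^sub>1, \<omega>\<^sup>3\<^sub>2\<close>; on S these nine
  forms are a coframe. \<open>s1, s2\<close> are the two generators of the singular system besides the
  \<open>\<theta>\<^sub>i\<close>.\<close>

definition e1 where "e1 z v = et 1 (fst z) (fst v)" for z v :: coords
definition e2 where "e2 z v = et 2 (fst z) (fst v)" for z v :: coords
definition al where "al z v = cn 1 2 (fst z) (fst v)" for z v :: coords
definition o1 where "o1 z v = omega 1 (snd z) (snd v)" for z v :: coords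
definition o2 where "o2 z v = omega 2 (snd z) (snd v)" for z v :: coords
definition o3 where "o3 z v = omega 3 (snd z) (snd v)" for z v :: coords
definition o12 where "o12 z v = omega_conn 1 2 (snd z) (snd v)" for z v :: coords
definition h1 where "h1 z v = omega_conn 3 1 (snd z) (snd v)" for z v :: coords
definition h2 where "h2 z v = omega_conn 3 2 (snd z) (snd v)" for z v :: coords

lemmas coframe_defs = e1_def e2_def al_def o1_def o2_def o3_def o12_def h1_def h2_def

text \<open>The tangent field with prescribed values of the coframe
  \<open>((e1, e2), al), ((o1, o2, o3), (o12, h1, h2))\<close>, extended to the ambient space.\<close>

definition fld :: "coords \<Rightarrow> ((real^2) \<times> real) \<times> ((real^3) \<times> (real^3)) \<Rightarrow> coords" where
  "fld z r = (surf_field (fst z) (fst r), euc_field (snd z) (snd r))"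

definition th0 :: "coords cform" where "th0 z v = of_real (o3 z v)"
definition th1 :: "coords cform" where "th1 z v = of_real (o1 z v - e1 z v)"
definition th2 :: "coords cform" where "th2 z v = of_real (o2 z v - e2 z v)"
definition th3 :: "coords cform" where "th3 z v = of_real (o12 z v - al z v)"
definition s1 :: "coords cform" where
  "s1 z v = of_real (h1 z v) - \<i> * of_real (kap (fst (fst z)) * e2 z v)"
definition s2 :: "coords cform" where
  "s2 z v = of_real (h2 z v) + \<i> * of_real (kap (fst (fst z)) * e1 z v)"

lemma embedding_forms_eq: "embedding_forms A g c = [th0, th1, th2, th3]"
  by (simp add: embedding_forms_def th0_def[abs_def] th1_def[abs_def] th2_def[abs_def] th3_def[abs_def] coframe_defs)

lemma singular_forms_eq: "singular_forms A g K c = [th0, th1, th2, th3, s1, s2]"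
  by (simp add: singular_forms_def embedding_forms_eq s1_def[abs_def] s2_def[abs_def] coframe_defs kap_def Let_def)

lemma open_Dom: "open Dom"
proof -
  have "Dom = (\<lambda>z. fst (fst z)) -` U"
    by (auto simp: Dom_def)
  then show ?thesis
    using open_image by (auto intro!: open_vimage continuous_intros)
qed

lemma SD: assumes "z \<in> S" shows "fst z \<in> FP" "snd z \<in> euc_frame_bundle" "z \<in> Dom"
  using assms frame_patchD(1)[of "fst z"] by (auto simp: S_def Dom_def mem_Times_iff)

lemma tangent_S:
  assumes "z \<in> S"
  shows "v \<in> tangent_space S z \<longleftrightarrow>
    (\<forall>i j. cn i j (fst z) (fst v) + cn j i (fst z) (fst v) = 0) \<and>
    (\<forall>i j. omega_conn i j (snd z) (snd v) + omega_conn j i (snd z) (snd v) = 0)"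
  unfolding S_def tangent_space_Times mem_Times_iff surf_tangent[OF SD(1)[OF assms]] euc_tangent[OF SD(2)[OF assms]]
  by blast

lemma fld_tangent: "z \<in> S \<Longrightarrow> fld z r \<in> tangent_space S z"
  unfolding tangent_S using SD[of z] by (simp add: fld_def surf_field_skew euc_field_skew)

lemma coframe_fld [simp]:
  assumes "z \<in> S"
  shows "e1 z (fld z r) = fst (fst r) $ 1" "e2 z (fld z r) = fst (fst r) $ 2" "al z (fld z r) = snd (fst r)"
    "o1 z (fld z r) = fst (snd r) $ 1" "o2 z (fld z r) = fst (snd r) $ 2" "o3 z (fld z r) = fst (snd r) $ 3"
    "o12 z (fld z r) = snd (snd r) $ 1" "h1 z (fld z r) = snd (snd r) $ 2" "h2 z (fld z r) = snd (snd r) $ 3"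
  using SD[OF assms] by (simp_all add: coframe_defs fld_def eta_surf_field omega_euc_field)

definition coe :: "coords \<Rightarrow> coords \<Rightarrow> ((real^2) \<times> real) \<times> ((real^3) \<times> (real^3))" where
  "coe z v = (surf_coeff (fst z) (fst v), euc_coeff (snd z) (snd v))"

lemma fld_coe: "z \<in> S \<Longrightarrow> v \<in> tangent_space S z \<Longrightarrow> fld z (coe z v) = v"
  using SD[of z] unfolding tangent_S by (simp add: fld_def coe_def surf_field_coeff euc_field_coeff)

lemma bl_base: "bounded_linear (\<lambda>z::coords. fst (fst z))"
  and bl_E: "bounded_linear (\<lambda>z::coords. snd (fst z) $ i)"
  and bl_F: "bounded_linear (\<lambda>z::coords. snd (snd z) $ j)"
  by (auto intro!: bounded_linear_compose[OF bounded_linear_fst] bounded_linear_compose[OF bounded_linear_snd]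
    bounded_linear_compose[OF bounded_linear_vec_nth] bounded_linear_fst bounded_linear_snd)

lemma smooth_base:
  assumes "smooth_on U f"
  shows "smooth_on Dom (\<lambda>z. f (fst (fst z)))"
  by (rule smooth_on_comp_linear[OF open_Dom bl_base open_image _ assms]) (auto simp: Dom_def)

lemma smooth_nth:
  fixes f :: "'e::euclidean_space \<Rightarrow> ('b::euclidean_space)^'n"
  shows "open T \<Longrightarrow> smooth_on T f \<Longrightarrow> smooth_on T (\<lambda>z. f z $ i)"
  by (rule smooth_on_bounded_linear[OF _ bounded_linear_vec_nth])

lemma smooth_G_field:
  assumes "smooth_on Dom u" "smooth_on Dom w"
  shows "smooth_on Dom (\<lambda>z. G (fst (fst z)) (u z) (w z))"
proof -
  have "smooth_on Dom (\<lambda>z. \<Sum>i\<in>UNIV. \<Sum>j\<in>UNIV. u z $ i * w z $ j * gm i j (fst (fst z)))"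
    by (intro smooth_on_sum smooth_on_mult open_Dom smooth_nth assms smooth_base smooth_G)
  then show ?thesis
    by (rule smooth_on_cong[OF open_Dom, rotated]) (simp only: Dom_def mem_Collect_eq, rule G_expand[symmetric])
qed

lemma smooth_Gam_field:
  assumes "smooth_on Dom u" "smooth_on Dom w"
  shows "smooth_on Dom (\<lambda>z. Gam (fst (fst z)) (u z) (w z))"
  unfolding Gam_def
  by (intro smooth_on_vec_lambda smooth_on_sum smooth_on_mult open_Dom smooth_nth assms smooth_base smooth_christoffel)

lemma smooth_inner:
  assumes "open T" "smooth_on T u" "smooth_on T w" shows "smooth_on T (\<lambda>z. u z \<bullet> w z)"
  using assms by (rule smooth_on_bounded_bilinear[OF _ bounded_bilinear_inner])

lemma smooth_fld: "smooth_on Dom (\<lambda>z. fld z r)"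
proof -
  note E = smooth_on_linear[OF open_Dom bl_E] and F = smooth_on_linear[OF open_Dom bl_F]
  have u: "smooth_on Dom (\<lambda>z. \<Sum>i\<in>UNIV. fst (fst r) $ i *\<^sub>R snd (fst z) $ i)"
    by (intro smooth_on_sum smooth_on_scaleR smooth_on_const open_Dom E)
  have w: "smooth_on Dom (\<lambda>z. (if j = 1 then - (snd (fst r) *\<^sub>R snd (fst z) $ 2) else snd (fst r) *\<^sub>R snd (fst z) $ 1)
     - Gam (fst (fst z)) (\<Sum>i\<in>UNIV. fst (fst r) $ i *\<^sub>R snd (fst z) $ i) (snd (fst z) $ j))" for j :: 2
    by (cases "j = 1"; simp only: simp_thms if_True if_False;
      intro smooth_on_diff smooth_on_minus smooth_on_scaleR smooth_on_const open_Dom E smooth_Gam_field u)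
  have p: "smooth_on Dom (\<lambda>z. \<Sum>i\<in>UNIV. fst (snd r) $ i *\<^sub>R snd (snd z) $ i)"
    by (intro smooth_on_sum smooth_on_scaleR smooth_on_const open_Dom F)
  have q: "smooth_on Dom (\<lambda>z. if i = 1 then snd (snd r) $ 2 *\<^sub>R snd (snd z) $ 3 - snd (snd r) $ 1 *\<^sub>R snd (snd z) $ 2
       else if i = 2 then snd (snd r) $ 1 *\<^sub>R snd (snd z) $ 1 + snd (snd r) $ 3 *\<^sub>R snd (snd z) $ 3
       else - (snd (snd r) $ 2 *\<^sub>R snd (snd z) $ 1) - snd (snd r) $ 3 *\<^sub>R snd (snd z) $ 2)" for i :: 3
    by (cases "i = 1"; cases "i = 2"; simp only: simp_thms if_True if_False;
      intro smooth_on_diff smooth_on_add smooth_on_minus smooth_on_scaleR smooth_on_const open_Dom F)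
  show ?thesis
    unfolding fld_def surf_field_def euc_field_def Let_def
    by (intro smooth_on_Pair smooth_on_vec_lambda open_Dom u w p q)
qed

lemma smooth_coframe:
  "smooth_on Dom (\<lambda>z. e1 z v)" "smooth_on Dom (\<lambda>z. e2 z v)" "smooth_on Dom (\<lambda>z. al z v)"
  "smooth_on Dom (\<lambda>z. o1 z v)" "smooth_on Dom (\<lambda>z. o2 z v)" "smooth_on Dom (\<lambda>z. o3 z v)"
  "smooth_on Dom (\<lambda>z. o12 z v)" "smooth_on Dom (\<lambda>z. h1 z v)" "smooth_on Dom (\<lambda>z. h2 z v)"
  unfolding coframe_defs eta_def conn_eq omega_def omega_conn_def
  by (intro smooth_G_field smooth_Gam_field smooth_inner smooth_on_add smooth_on_const open_Dom
    smooth_on_linear[OF open_Dom bl_E] smooth_on_linear[OF open_Dom bl_F])+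

lemma linear_coframe:
  assumes "z \<in> Dom"
  shows "linear (e1 z)" "linear (e2 z)" "linear (al z)" "linear (o1 z)" "linear (o2 z)" "linear (o3 z)"
    "linear (o12 z)" "linear (h1 z)" "linear (h2 z)"
proof -
  have U: "fst (fst z) \<in> U" using assms by (simp add: Dom_def)
  show "linear (e1 z)" "linear (e2 z)" "linear (al z)"
    by (rule linearI; simp add: coframe_defs linear_add[OF linear_eta[OF U]] linear_scale[OF linear_eta[OF U]]
      linear_add[OF linear_conn[OF U]] linear_scale[OF linear_conn[OF U]])+
  show "linear (o1 z)" "linear (o2 z)" "linear (o3 z)" "linear (o12 z)" "linear (h1 z)" "linear (h2 z)"
    by (rule linearI; simp add: coframe_defs linear_add[OF linear_omega(1)] linear_scale[OF linear_omega(1)]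
      linear_add[OF linear_omega(2)] linear_scale[OF linear_omega(2)])+
qed

definition wd :: "(coords \<Rightarrow> coords \<Rightarrow> real) \<Rightarrow> (coords \<Rightarrow> coords \<Rightarrow> real) \<Rightarrow> coords \<Rightarrow> coords \<Rightarrow> coords \<Rightarrow> real" where
  "wd \<alpha> \<beta> z u v = \<alpha> z u * \<beta> z v - \<alpha> z v * \<beta> z u"

section \<open>The function k in a chart and the structure equations on the product\<close>

lemma K_chart: "x \<in> U \<Longrightarrow> K (chart_inv c x) = gauss_curvature_in A g c x"
  using gauss chart chart_inv_in chart_chart_inv unfolding is_gauss_curvature_def by metis

lemma K_chart_pos: "x \<in> U \<Longrightarrow> K (chart_inv c x) > 0"
  using K_pos chart_inv_in chart_subset[OF chart] by blast

lemma kap_pos: "x \<in> U \<Longrightarrow> kap x > 0"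
  using K_chart_pos by (simp add: kap_def)

lemma kap_square: "x \<in> U \<Longrightarrow> kap x * kap x = gauss_curvature_in A g c x"
  using K_chart_pos[of x] K_chart[of x] by (simp add: kap_def)

lemma smooth_kap: "smooth_on U kap"
  by (rule smooth_on_cong[OF open_image _ smooth_on_sqrt[OF open_image smooth_gauss_curvature]])
    (use K_chart K_chart_pos in \<open>auto simp: kap_def\<close>)

text \<open>On tangent vectors the connection matrices are skew, so all their entries reduce to
  members of the coframe; the general formulas for exterior derivatives then become wedge products
  of these.\<close>

lemma structure_equations:
  assumes z: "z \<in> S" and u: "u \<in> tangent_space S z" and v: "v \<in> tangent_space S z"
  shows "ext_d e1 z u v = - wd al e2 z u v" "ext_d e2 z u v = wd al e1 z u v"
    "ext_d al z u v = kap (fst (fst z)) * kap (fst (fst z)) * wd e1 e2 z u v"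
    "ext_d o1 z u v = - wd o12 o2 z u v + wd h1 o3 z u v"
    "ext_d o2 z u v = wd o12 o1 z u v + wd h2 o3 z u v"
    "ext_d o3 z u v = - wd h1 o1 z u v - wd h2 o2 z u v"
    "ext_d o12 z u v = wd h1 h2 z u v"
    "ext_d h1 z u v = wd h2 o12 z u v" "ext_d h2 z u v = - wd h1 o12 z u v"
proof -
  note T = u[unfolded tangent_S[OF z]] v[unfolded tangent_S[OF z]]
  have c: "cn i i (fst z) (fst w) = 0" "cn 2 1 (fst z) (fst w) = - cn 1 2 (fst z) (fst w)"
    "omega_conn j j (snd z) (snd w) = 0" "omega_conn 2 1 (snd z) (snd w) = - omega_conn 1 2 (snd z) (snd w)"
    "omega_conn 1 3 (snd z) (snd w) = - omega_conn 3 1 (snd z) (snd w)"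
    "omega_conn 2 3 (snd z) (snd w) = - omega_conn 3 2 (snd z) (snd w)"
    if "w = u \<or> w = v" for w i j
  proof -
    have W: "\<forall>i j. cn i j (fst z) (fst w) + cn j i (fst z) (fst w) = 0"
      "\<forall>i j. omega_conn i j (snd z) (snd w) + omega_conn j i (snd z) (snd w) = 0"
      using T that by blast+
    show "cn i i (fst z) (fst w) = 0" "cn 2 1 (fst z) (fst w) = - cn 1 2 (fst z) (fst w)"
      "omega_conn j j (snd z) (snd w) = 0" "omega_conn 2 1 (snd z) (snd w) = - omega_conn 1 2 (snd z) (snd w)"
      "omega_conn 1 3 (snd z) (snd w) = - omega_conn 3 1 (snd z) (snd w)"
      "omega_conn 2 3 (snd z) (snd w) = - omega_conn 3 2 (snd z) (snd w)"
      using W(1)[rule_format, of i i] W(1)[rule_format, of 2 1] W(2)[rule_format, of j j] W(2)[rule_format, of 2 1]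
        W(2)[rule_format, of 1 3] W(2)[rule_format, of 2 3] by linarith+
  qed
  note c' = c[of u, simplified] c[of v, simplified]
  note eta' = ext_d_eta[OF SD(1)[OF z]] and conn' = ext_d_conn[OF SD(1)[OF z]]
    and om = ext_d_omega[OF SD(2)[OF z]] and omc = ext_d_omega_conn[OF SD(2)[OF z]]
  note pf = ext_d_pullback(1)[OF bounded_linear_fst] and ps = ext_d_pullback(1)[OF bounded_linear_snd]
  show "ext_d e1 z u v = - wd al e2 z u v" "ext_d e2 z u v = wd al e1 z u v"
    unfolding e1_def[abs_def] e2_def[abs_def] pf[OF eta'(2)] eta'(1)
    by (simp_all add: wd_def coframe_defs sum_2 c')
  show "ext_d al z u v = kap (fst (fst z)) * kap (fst (fst z)) * wd e1 e2 z u v"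
    unfolding al_def[abs_def] pf[OF conn'(2)] conn'(1) frame_curvature[OF SD(1)[OF z]]
    by (simp add: wd_def coframe_defs sum_2 c' kap_square[OF frame_patchD(1)[OF SD(1)[OF z]]])
  show "ext_d o1 z u v = - wd o12 o2 z u v + wd h1 o3 z u v"
    "ext_d o2 z u v = wd o12 o1 z u v + wd h2 o3 z u v"
    "ext_d o3 z u v = - wd h1 o1 z u v - wd h2 o2 z u v"
    unfolding o1_def[abs_def] o2_def[abs_def] o3_def[abs_def] ps[OF om(2)] om(1)
    by (simp_all add: wd_def coframe_defs sum_3 c')
  show "ext_d o12 z u v = wd h1 h2 z u v"
    "ext_d h1 z u v = wd h2 o12 z u v" "ext_d h2 z u v = - wd h1 o12 z u v"
    unfolding o12_def[abs_def] h1_def[abs_def] h2_def[abs_def] ps[OF omc(2)] omc(1)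
    by (simp_all add: wd_def coframe_defs sum_3 c')
qed

lemma smooth_imp_form_differentiable:
  "z \<in> V \<Longrightarrow> (\<And>v. smooth_on V (\<lambda>z. \<alpha> z v)) \<Longrightarrow> form_differentiable \<alpha> z"
  unfolding form_differentiable_def using smooth_on_has_derivative differentiableI by blast

text \<open>Applied to the difference of two forms with the same restriction to \<open>S\<close>,
  this shows that their exterior derivatives agree on tangent vectors.\<close>

lemma ext_d_zero_on_S:
  fixes \<alpha> :: "coords cform"
  assumes V: "open V" "V \<subseteq> Dom" "z \<in> S \<inter> V" and lin: "\<And>P. P \<in> V \<Longrightarrow> linear (\<alpha> P)"
    and diff: "form_differentiable \<alpha> z"
    and zero: "\<And>P v. P \<in> S \<inter> V \<Longrightarrow> v \<in> tangent_space S P \<Longrightarrow> \<alpha> P v = 0"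
    and uv: "u \<in> tangent_space S z" "v \<in> tangent_space S z"
  shows "ext_d \<alpha> z u v = 0"
proof -
  \<comment> \<open>The common kernel of the symmetrised connection forms of both factors is the
    tangent space of \<open>S\<close>.\<close>
  define N where "N = range (\<lambda>(i, j) P v. cn i j (fst P) (fst v) + cn j i (fst P) (fst v)) \<union>
     range (\<lambda>(i, j) P v. omega_conn i j (snd P) (snd v) + omega_conn j i (snd P) (snd v))"
  have z: "z \<in> S" "z \<in> V" using V by auto
  note pf = ext_d_pullback[OF bounded_linear_fst] and ps = ext_d_pullback[OF bounded_linear_snd]
  note cd = pf[OF ext_d_conn(2)[OF SD(1)[OF z(1)]]] and od = ps[OF ext_d_omega_conn(2)[OF SD(2)[OF z(1)]]]
  show ?thesis
  proof (rule ext_d_eq_0_if_zero_on_tangent[OF V(1) z(2,1) lin diff zero _ _ _ _ _ uv, of N])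
    fix P assume "P \<in> S \<inter> V"
    then have P: "P \<in> S" by simp
    show "tangent_space S P = {v. \<forall>\<nu>\<in>N. \<nu> P v = 0}"
      by (rule set_eqI) (simp add: tangent_S[OF P] N_def ball_Un)
  next
    fix P \<nu> assume P: "P \<in> V" and \<nu>: "\<nu> \<in> N"
    have U: "fst (fst P) \<in> U" using P V by (auto simp: Dom_def)
    show "linear (\<nu> P)"
      using \<nu> unfolding N_def
      by (auto intro!: linear_compose_add
        linear_compose[OF bounded_linear.linear[OF bounded_linear_fst] linear_conn[OF U], unfolded o_def]
        linear_compose[OF bounded_linear.linear[OF bounded_linear_snd] linear_omega(2), unfolded o_def])
  next
    fix \<nu> assume "\<nu> \<in> N"
    then show "form_differentiable \<nu> z"
      unfolding N_def by (auto intro!: ext_d_add(2) cd(2) od(2))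
  next
    fix \<nu> u v assume "\<nu> \<in> N"
    then show "ext_d \<nu> z u v = 0"
      unfolding N_def
      by (auto simp: ext_d_add(1)[OF cd(2) cd(2)] ext_d_add(1)[OF od(2) od(2)] cd(1) od(1)
        ext_d_conn_sym[OF SD(1)[OF z(1)]] ext_d_omega_conn(1)[OF SD(2)[OF z(1)]] sum.distrib[symmetric])
  next
    fix v assume v: "v \<in> tangent_space S z"
    \<comment> \<open>Keeping the coframe values of v constant gives a field that is tangent to
      \<open>S\<close> at each of its points.\<close>
    show "\<exists>Y Y'. (Y has_derivative Y') (at z) \<and> Y z = v \<and> (\<forall>P\<in>S \<inter> V. Y P \<in> tangent_space S P)"
      using smooth_on_has_derivative[OF smooth_fld SD(3)[OF z(1)], of "coe z v"] fld_coe[OF z(1) v] fld_tangent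
      by (intro exI[of _ "\<lambda>P. fld P (coe z v)"] exI conjI) auto
  qed auto
qed

end

text \<open>This is \<open>d\<phi>\<^sub>1 \<equiv> d\<phi>\<^sub>2 \<equiv> 0\<close> modulo \<open>\<phi>\<^sub>1 = s1 + a \<theta>\<^sub>3\<close> and \<open>\<phi>\<^sub>2 = s2 + b \<theta>\<^sub>3\<close>, evaluated on
  vectors u, v. The coefficients \<open>a = -\<i>k\<^sub>1/(2k\<^sup>2)\<close>, \<open>b = -\<i>k\<^sub>2/(2k\<^sup>2)\<close> come from solving the
  first-order system below with all coefficients other than those of \<open>\<theta>\<^sub>3\<close> equal to 0.\<close>

lemma frobenius_identity:
  fixes a b k k1 k2 :: complex
  assumes k: "k1 = 2 * \<i> * k * k * a" "k2 = 2 * \<i> * k * k * b"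
    and da: "\<And>w. w \<in> {u, v} \<Longrightarrow> da w = (\<i> * k + \<i> * k * a * a) * E1 w + \<i> * k * a * b * E2 w - b * B w"
    and db: "\<And>w. w \<in> {u, v} \<Longrightarrow> db w = \<i> * k * a * b * E1 w + (\<i> * k + \<i> * k * b * b) * E2 w + a * B w"
    and f1: "\<And>w. F1 w = (H w - \<i> * k * E2 w) + a * (O12 w - B w)"
    and f2: "\<And>w. F2 w = (L w + \<i> * k * E1 w) + b * (O12 w - B w)"
  shows "(L u * O12 v - L v * O12 u) - \<i> * (k1 * (E1 u * E2 v - E1 v * E2 u) + k * (B u * E1 v - B v * E1 u))
     + (da u * (O12 v - B v) - da v * (O12 u - B u) + a * ((H u * L v - H v * L u) - k * k * (E1 u * E2 v - E1 v * E2 u)))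
    = (- a * (- \<i> * k * E1 u - b * (O12 u - B u)) * F1 v - (- a * (- \<i> * k * E1 v - b * (O12 v - B v))) * F1 u)
    + ((- B u - (O12 u - B u) + a * F1 u + a * (\<i> * k * E2 u - a * (O12 u - B u))) * F2 v
      - (- B v - (O12 v - B v) + a * F1 v + a * (\<i> * k * E2 v - a * (O12 v - B v))) * F2 u)" (is ?th1)
   "- (H u * O12 v - H v * O12 u) + \<i> * (- k2 * (E1 u * E2 v - E1 v * E2 u) - k * (B u * E2 v - B v * E2 u))
     + (db u * (O12 v - B v) - db v * (O12 u - B u) + b * ((H u * L v - H v * L u) - k * k * (E1 u * E2 v - E1 v * E2 u)))
    = ((B u + (O12 u - B u) - b * (- \<i> * k * E1 u - b * (O12 u - B u))) * F1 v
      - (B v + (O12 v - B v) - b * (- \<i> * k * E1 v - b * (O12 v - B v))) * F1 u)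
    + ((b * F1 u + b * (\<i> * k * E2 u - a * (O12 u - B u))) * F2 v
      - (b * F1 v + b * (\<i> * k * E2 v - a * (O12 v - B v))) * F2 u)" (is ?th2)
proof -
  have ii: "\<i> * \<i> = -1" by simp
  have d: "da u = (\<i> * k + \<i> * k * a * a) * E1 u + \<i> * k * a * b * E2 u - b * B u"
    "da v = (\<i> * k + \<i> * k * a * a) * E1 v + \<i> * k * a * b * E2 v - b * B v"
    "db u = \<i> * k * a * b * E1 u + (\<i> * k + \<i> * k * b * b) * E2 u + a * B u"
    "db v = \<i> * k * a * b * E1 v + (\<i> * k + \<i> * k * b * b) * E2 v + a * B v"
    using da db by simp_all
  show ?th1 unfolding d f1 f2 k using ii by algebra
  show ?th2 unfolding d f1 f2 k using ii by algebra
qed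

section \<open>Normalised forms, their exterior derivatives and the dual frame\<close>

context curved_chart
begin

text \<open>The coefficient \<open>k\<^sub>i\<close> in
  \<open>dk = k\<^sub>i \<eta>\<^sup>i\<close>.\<close>

definition kd :: "2 \<Rightarrow> coords \<Rightarrow> real" where
  "kd i z = frechet_derivative kap (at (fst (fst z))) (snd (fst z) $ i)"

abbreviation "kp z \<equiv> kap (fst (fst z))"

definition ph :: "coords cform \<Rightarrow> (coords \<Rightarrow> complex) \<Rightarrow> (coords \<Rightarrow> complex) \<Rightarrow> (coords \<Rightarrow> complex) \<Rightarrow>
    (coords \<Rightarrow> complex) \<Rightarrow> coords cform" where
  "ph s a0 a1 a2 a3 z v = s z v + a0 z * th0 z v + a1 z * th1 z v + a2 z * th2 z v + a3 z * th3 z v"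

lemma smooth_forms:
  "smooth_on Dom (\<lambda>z. th0 z v)" "smooth_on Dom (\<lambda>z. th1 z v)" "smooth_on Dom (\<lambda>z. th2 z v)"
  "smooth_on Dom (\<lambda>z. th3 z v)" "smooth_on Dom (\<lambda>z. s1 z v)" "smooth_on Dom (\<lambda>z. s2 z v)"
  unfolding th0_def th1_def th2_def th3_def s1_def s2_def
  by (intro smooth_on_add smooth_on_diff smooth_on_mult smooth_on_of_real smooth_on_const smooth_coframe
    smooth_base smooth_kap open_Dom)+

lemma form_differentiable_forms:
  assumes "z \<in> Dom"
  shows "form_differentiable th0 z" "form_differentiable th1 z" "form_differentiable th2 z"
    "form_differentiable th3 z" "form_differentiable s1 z" "form_differentiable s2 z"
  by (rule smooth_imp_form_differentiable[OF assms], rule smooth_forms)+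

lemma form_differentiable_coframe:
  assumes "z \<in> Dom"
  shows "form_differentiable e1 z" "form_differentiable e2 z" "form_differentiable al z"
    "form_differentiable o1 z" "form_differentiable o2 z" "form_differentiable o3 z"
    "form_differentiable o12 z" "form_differentiable h1 z" "form_differentiable h2 z"
  by (rule smooth_imp_form_differentiable[OF assms], rule smooth_coframe)+

lemma linear_forms:
  assumes "z \<in> Dom"
  shows "linear (th0 z)" "linear (th1 z)" "linear (th2 z)" "linear (th3 z)" "linear (s1 z)" "linear (s2 z)"
  by (rule linearI; simp add: th0_def th1_def th2_def th3_def s1_def s2_def
    linear_coframe[OF assms, THEN linear_add] linear_coframe[OF assms, THEN linear_scale] scaleR_conv_of_real algebra_simps)+

lemma linear_ph:
  assumes "z \<in> Dom" "linear (s z)"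
  shows "linear (ph s a0 a1 a2 a3 z)"
  by (rule linearI; simp add: ph_def linear_forms[OF assms(1), THEN linear_add] linear_forms[OF assms(1), THEN linear_scale]
    linear_add[OF assms(2)] linear_scale[OF assms(2)] scaleR_conv_of_real algebra_simps)

lemma smooth_cform_ph:
  assumes V: "open V" "V \<subseteq> Dom" and s: "s \<in> {s1, s2}"
    and a: "smooth_on V a0" "smooth_on V a1" "smooth_on V a2" "smooth_on V a3"
  shows "smooth_cform V (ph s a0 a1 a2 a3)"
  unfolding smooth_cform_def
proof (intro conjI ballI allI)
  fix P assume "P \<in> V"
  then show "linear (ph s a0 a1 a2 a3 P)"
    using V s linear_ph linear_forms(5,6) by blast
next
  fix v
  have "smooth_on V (\<lambda>z. s z v)"
    using s smooth_forms(5,6) smooth_on_subset[OF _ V(2)] by blast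
  then show "smooth_on V (\<lambda>P. ph s a0 a1 a2 a3 P v)"
    unfolding ph_def
    by (intro smooth_on_add smooth_on_mult V(1) a smooth_forms(1-4)[THEN smooth_on_subset[OF _ V(2)]])
qed

lemma base_derivative:
  assumes z: "z \<in> S" and f: "smooth_on U f"
  shows "((\<lambda>z. f (fst (fst z))) has_derivative (\<lambda>u. frechet_derivative f (at (fst (fst z))) (fst (fst u)))) (at z)"
    "frechet_derivative f (at (fst (fst z))) (fst (fst u)) =
      e1 z u *\<^sub>R frechet_derivative f (at (fst (fst z))) (snd (fst z) $ 1) +
      e2 z u *\<^sub>R frechet_derivative f (at (fst (fst z))) (snd (fst z) $ 2)"
proof -
  have U: "fst (fst z) \<in> U" using SD(3)[OF z] by (simp add: Dom_def)
  note f' = smooth_on_has_derivative[OF f U]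
  show "((\<lambda>z. f (fst (fst z))) has_derivative (\<lambda>u. frechet_derivative f (at (fst (fst z))) (fst (fst u)))) (at z)"
    by (rule has_derivative_compose[OF bounded_linear_imp_has_derivative[OF bl_base] f'])
  have "fst (fst u) = e1 z u *\<^sub>R snd (fst z) $ 1 + e2 z u *\<^sub>R snd (fst z) $ 2"
    using frame_expand(1)[OF SD(1)[OF z], of "fst (fst u)"] by (simp add: sum_2 e1_def e2_def eta_def)
  then show "frechet_derivative f (at (fst (fst z))) (fst (fst u)) =
      e1 z u *\<^sub>R frechet_derivative f (at (fst (fst z))) (snd (fst z) $ 1) +
      e2 z u *\<^sub>R frechet_derivative f (at (fst (fst z))) (snd (fst z) $ 2)"
    using linear_add[OF has_derivative_linear[OF f']] linear_scale[OF has_derivative_linear[OF f']] by simp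
qed

lemma ext_d_forms:
  assumes z: "z \<in> S" and u: "u \<in> tangent_space S z" and v: "v \<in> tangent_space S z"
  shows "ext_d th0 z u v = of_real (- wd h1 o1 z u v - wd h2 o2 z u v)"
    "ext_d th1 z u v = of_real (- wd o12 o2 z u v + wd h1 o3 z u v + wd al e2 z u v)"
    "ext_d th2 z u v = of_real (wd o12 o1 z u v + wd h2 o3 z u v - wd al e1 z u v)"
    "ext_d th3 z u v = of_real (wd h1 h2 z u v - kp z * kp z * wd e1 e2 z u v)"
    "ext_d s1 z u v = of_real (wd h2 o12 z u v) - \<i> * of_real (kd 1 z * wd e1 e2 z u v + kp z * wd al e1 z u v)"
    "ext_d s2 z u v = of_real (- wd h1 o12 z u v) + \<i> * of_real (- kd 2 z * wd e1 e2 z u v - kp z * wd al e2 z u v)"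
proof -
  note se = structure_equations[OF z u v]
  note fd = form_differentiable_coframe[OF SD(3)[OF z]]
  note ofr = ext_d_bounded_linear[OF bounded_linear_of_real]
  show "ext_d th0 z u v = of_real (- wd h1 o1 z u v - wd h2 o2 z u v)"
    unfolding th0_def[abs_def] ofr(1)[OF fd(6)] se ..
  show "ext_d th1 z u v = of_real (- wd o12 o2 z u v + wd h1 o3 z u v + wd al e2 z u v)"
    unfolding th1_def[abs_def] ofr(1)[OF ext_d_diff(2)[OF fd(4) fd(1)]] ext_d_diff(1)[OF fd(4) fd(1)] se by simp
  show "ext_d th2 z u v = of_real (wd o12 o1 z u v + wd h2 o3 z u v - wd al e1 z u v)"
    unfolding th2_def[abs_def] ofr(1)[OF ext_d_diff(2)[OF fd(5) fd(2)]] ext_d_diff(1)[OF fd(5) fd(2)] se by simp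
  show "ext_d th3 z u v = of_real (wd h1 h2 z u v - kp z * kp z * wd e1 e2 z u v)"
    unfolding th3_def[abs_def] ofr(1)[OF ext_d_diff(2)[OF fd(7) fd(3)]] ext_d_diff(1)[OF fd(7) fd(3)] se by simp
  note kap' = base_derivative[OF z smooth_kap]
  have ke1: "ext_d (\<lambda>z v. kp z * e1 z v) z u v = - kd 2 z * wd e1 e2 z u v - kp z * wd al e2 z u v"
    unfolding ext_d_fmult(1)[OF kap'(1) fd(1)] se kap'(2) by (simp add: kd_def wd_def algebra_simps)
  have ke2: "ext_d (\<lambda>z v. kp z * e2 z v) z u v = kd 1 z * wd e1 e2 z u v + kp z * wd al e1 z u v"
    unfolding ext_d_fmult(1)[OF kap'(1) fd(2)] se kap'(2) by (simp add: kd_def wd_def algebra_simps)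
  note kf1 = ext_d_fmult(2)[OF kap'(1) fd(1)] and kf2 = ext_d_fmult(2)[OF kap'(1) fd(2)]
  note ic = ext_d_bounded_linear[OF bounded_linear_mult_right[of "\<i>"]]
  show "ext_d s1 z u v = of_real (wd h2 o12 z u v) - \<i> * of_real (kd 1 z * wd e1 e2 z u v + kp z * wd al e1 z u v)"
    unfolding s1_def[abs_def] ext_d_diff(1)[OF ofr(2)[OF fd(8)] ic(2)[OF ofr(2)[OF kf2]]] ic(1)[OF ofr(2)[OF kf2]]
      ofr(1)[OF kf2] ofr(1)[OF fd(8)] ke2 se ..
  show "ext_d s2 z u v = of_real (- wd h1 o12 z u v) + \<i> * of_real (- kd 2 z * wd e1 e2 z u v - kp z * wd al e2 z u v)"
    unfolding s2_def[abs_def] ext_d_add(1)[OF ofr(2)[OF fd(9)] ic(2)[OF ofr(2)[OF kf1]]] ic(1)[OF ofr(2)[OF kf1]]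
      ofr(1)[OF kf1] ofr(1)[OF fd(9)] ke1 se ..
qed

lemma ext_d_ph:
  assumes z: "z \<in> S" and s: "s \<in> {s1, s2}"
    and a: "(a0 has_derivative a0') (at z)" "(a1 has_derivative a1') (at z)"
      "(a2 has_derivative a2') (at z)" "(a3 has_derivative a3') (at z)"
  shows "ext_d (ph s a0 a1 a2 a3) z u v = ext_d s z u v
     + (a0' u * th0 z v - a0' v * th0 z u + a0 z * ext_d th0 z u v)
     + (a1' u * th1 z v - a1' v * th1 z u + a1 z * ext_d th1 z u v)
     + (a2' u * th2 z v - a2' v * th2 z u + a2 z * ext_d th2 z u v)
     + (a3' u * th3 z v - a3' v * th3 z u + a3 z * ext_d th3 z u v)"
    "form_differentiable (ph s a0 a1 a2 a3) z"
proof -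
  note fd = form_differentiable_forms[OF SD(3)[OF z]]
  have fs: "form_differentiable s z" using s fd(5,6) by blast
  note m0 = ext_d_fmult[OF a(1) fd(1)] and m1 = ext_d_fmult[OF a(2) fd(2)]
    and m2 = ext_d_fmult[OF a(3) fd(3)] and m3 = ext_d_fmult[OF a(4) fd(4)]
  note p0 = ext_d_add[OF fs m0(2)]
  note p1 = ext_d_add[OF p0(2) m1(2)]
  note p2 = ext_d_add[OF p1(2) m2(2)]
  note p3 = ext_d_add[OF p2(2) m3(2)]
  show "ext_d (ph s a0 a1 a2 a3) z u v = ext_d s z u v
     + (a0' u * th0 z v - a0' v * th0 z u + a0 z * ext_d th0 z u v)
     + (a1' u * th1 z v - a1' v * th1 z u + a1 z * ext_d th1 z u v)
     + (a2' u * th2 z v - a2' v * th2 z u + a2 z * ext_d th2 z u v)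
     + (a3' u * th3 z v - a3' v * th3 z u + a3 z * ext_d th3 z u v)"
    unfolding ph_def[abs_def] p3(1) p2(1) p1(1) p0(1) m0(1) m1(1) m2(1) m3(1) ..
  show "form_differentiable (ph s a0 a1 a2 a3) z"
    unfolding ph_def[abs_def] by (rule p3(2))
qed

text \<open>Members of the frame dual to \<open>e1, e2, al\<close>, the \<open>\<theta>\<^sub>i\<close> and \<open>h1, h2\<close>; in particular
  \<open>V1, V2\<close> annihilate all the \<open>\<theta>\<^sub>i\<close>.\<close>

definition H1 where "H1 z = fld z ((0, 0), (0, axis 2 1))"
definition H2 where "H2 z = fld z ((0, 0), (0, axis 3 1))"
definition T0 where "T0 z = fld z ((0, 0), (axis 3 1, 0))"
definition T1 where "T1 z = fld z ((0, 0), (axis 1 1, 0))"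
definition T2 where "T2 z = fld z ((0, 0), (axis 2 1, 0))"
definition T3 where "T3 z = fld z ((0, 0), (0, axis 1 1))"
definition V1 where "V1 z = fld z ((axis 1 1, 0), (axis 1 1, 0))"
definition V2 where "V2 z = fld z ((axis 2 1, 0), (axis 2 1, 0))"

lemmas field_defs = H1_def H2_def T0_def T1_def T2_def T3_def V1_def V2_def
lemmas form_defs = th0_def th1_def th2_def th3_def s1_def s2_def

lemma field_tangent:
  assumes "z \<in> S"
  shows "H1 z \<in> tangent_space S z" "H2 z \<in> tangent_space S z" "T0 z \<in> tangent_space S z" "T1 z \<in> tangent_space S z"
    "T2 z \<in> tangent_space S z" "T3 z \<in> tangent_space S z" "V1 z \<in> tangent_space S z" "V2 z \<in> tangent_space S z"
  using fld_tangent[OF assms] by (simp_all add: field_defs)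

lemma coframe_fields:
  assumes "z \<in> S"
  shows
  "e1 z (H1 z) = 0" "e2 z (H1 z) = 0" "al z (H1 z) = 0" "o1 z (H1 z) = 0" "o2 z (H1 z) = 0" "o3 z (H1 z) = 0"
  "o12 z (H1 z) = 0" "h1 z (H1 z) = 1" "h2 z (H1 z) = 0"
  "e1 z (H2 z) = 0" "e2 z (H2 z) = 0" "al z (H2 z) = 0" "o1 z (H2 z) = 0" "o2 z (H2 z) = 0" "o3 z (H2 z) = 0"
  "o12 z (H2 z) = 0" "h1 z (H2 z) = 0" "h2 z (H2 z) = 1"
  "e1 z (T0 z) = 0" "e2 z (T0 z) = 0" "al z (T0 z) = 0" "o1 z (T0 z) = 0" "o2 z (T0 z) = 0" "o3 z (T0 z) = 1"
  "o12 z (T0 z) = 0" "h1 z (T0 z) = 0" "h2 z (T0 z) = 0"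
  "e1 z (T1 z) = 0" "e2 z (T1 z) = 0" "al z (T1 z) = 0" "o1 z (T1 z) = 1" "o2 z (T1 z) = 0" "o3 z (T1 z) = 0"
  "o12 z (T1 z) = 0" "h1 z (T1 z) = 0" "h2 z (T1 z) = 0"
  "e1 z (T2 z) = 0" "e2 z (T2 z) = 0" "al z (T2 z) = 0" "o1 z (T2 z) = 0" "o2 z (T2 z) = 1" "o3 z (T2 z) = 0"
  "o12 z (T2 z) = 0" "h1 z (T2 z) = 0" "h2 z (T2 z) = 0"
  "e1 z (T3 z) = 0" "e2 z (T3 z) = 0" "al z (T3 z) = 0" "o1 z (T3 z) = 0" "o2 z (T3 z) = 0" "o3 z (T3 z) = 0"
  "o12 z (T3 z) = 1" "h1 z (T3 z) = 0" "h2 z (T3 z) = 0"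
  "e1 z (V1 z) = 1" "e2 z (V1 z) = 0" "al z (V1 z) = 0" "o1 z (V1 z) = 1" "o2 z (V1 z) = 0" "o3 z (V1 z) = 0"
  "o12 z (V1 z) = 0" "h1 z (V1 z) = 0" "h2 z (V1 z) = 0"
  "e1 z (V2 z) = 0" "e2 z (V2 z) = 1" "al z (V2 z) = 0" "o1 z (V2 z) = 0" "o2 z (V2 z) = 1" "o3 z (V2 z) = 0"
  "o12 z (V2 z) = 0" "h1 z (V2 z) = 0" "h2 z (V2 z) = 0"
  by (simp_all add: field_defs assms axis_def)

lemma smooth_fields:
  "smooth_on Dom H1" "smooth_on Dom H2" "smooth_on Dom T0" "smooth_on Dom T1"
  "smooth_on Dom T2" "smooth_on Dom T3" "smooth_on Dom V1" "smooth_on Dom V2"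
  using smooth_fld by (simp_all add: field_defs[abs_def])

section \<open>Sufficiency\<close>

text \<open>\<open>da\<close> and \<open>db\<close> are the first-order equations that remain when
  only \<open>\<theta>\<^sub>3\<close> has nonzero coefficients. A single F then serves over all of
  \<open>Dom\<close>.\<close>

lemma sufficiency:
  assumes sm: "smooth_on Dom a" "smooth_on Dom b"
    and da: "\<And>z w. z \<in> S \<Longrightarrow> w \<in> tangent_space S z \<Longrightarrow> frechet_derivative a (at z) w =
      (\<i> * kp z + \<i> * kp z * a z * a z) * e1 z w + \<i> * kp z * a z * b z * e2 z w - b z * al z w"
    and db: "\<And>z w. z \<in> S \<Longrightarrow> w \<in> tangent_space S z \<Longrightarrow> frechet_derivative b (at z) w =
      \<i> * kp z * a z * b z * e1 z w + (\<i> * kp z + \<i> * kp z * b z * b z) * e2 z w + a z * al z w"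
    and kd: "\<And>z. z \<in> S \<Longrightarrow> of_real (kd 1 z) = 2 * \<i> * kp z * kp z * a z"
      "\<And>z. z \<in> S \<Longrightarrow> of_real (kd 2 z) = 2 * \<i> * kp z * kp z * b z"
  shows "\<exists>F. subbundle_frame S Dom F \<and> 2 \<le> length F \<and> frobenius S Dom F \<and>
     (\<forall>z\<in>S \<inter> Dom.
        cspan_at S F z \<subseteq> cspan_at S (singular_forms A g K c) z \<and>
        (\<forall>\<phi>\<in>cspan_at S F z \<inter> cspan_at S (embedding_forms A g c) z.
           \<forall>v\<in>tangent_space S z. \<phi> v = 0))"
proof -
  define f1 where "f1 = ph s1 (\<lambda>z. 0) (\<lambda>z. 0) (\<lambda>z. 0) a"
  define f2 where "f2 = ph s2 (\<lambda>z. 0) (\<lambda>z. 0) (\<lambda>z. 0) b"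
  have f: "f1 z v = s1 z v + a z * th3 z v" "f2 z v = s2 z v + b z * th3 z v" for z v
    by (simp_all add: f1_def f2_def ph_def)
  have fH: "f1 z (H1 z) = 1" "f1 z (H2 z) = 0" "f2 z (H1 z) = 0" "f2 z (H2 z) = 1" if "z \<in> S" for z
    by (simp_all add: f form_defs coframe_fields[OF that])
  have sf: "smooth_cform Dom f1" "smooth_cform Dom f2"
    unfolding f1_def f2_def by (rule smooth_cform_ph; simp add: open_Dom smooth_on_const sm)+
  have lf: "linear (f1 z)" "linear (f2 z)" if "z \<in> Dom" for z
    using sf that by (simp_all add: smooth_cform_def)
  have span: "(\<Sum>i<length [f1, f2]. d i * ([f1, f2] ! i) z v) = d 0 * f1 z v + d 1 * f2 z v" for d :: "nat \<Rightarrow> complex" and z v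
    by simp
  have sub: "subbundle_frame S Dom [f1, f2]"
    unfolding subbundle_frame_def cindep_at_def span
  proof (intro conjI ballI allI impI)
    fix z and d :: "nat \<Rightarrow> complex" and i assume z: "z \<in> S \<inter> Dom" and d: "\<forall>v\<in>tangent_space S z. d 0 * f1 z v + d 1 * f2 z v = 0"
      and i: "i < length [f1, f2]"
    have zS: "z \<in> S" using z by simp
    have "d 0 = 0" "d 1 = 0"
      using d[rule_format, OF field_tangent(1)[OF zS]] d[rule_format, OF field_tangent(2)[OF zS]] fH[OF zS] by simp_all
    then show "d i = 0" using i by (cases i) (auto simp: less_Suc_eq)
  qed (use sf in auto)
  \<comment> \<open>The multipliers of f1 and f2 are those of
    \<open>frobenius_identity\<close>.\<close>
  have alg: "ext_d f1 z u v =
       (- a z * (- \<i> * kp z * e1 z u - b z * th3 z u) * f1 z v - (- a z * (- \<i> * kp z * e1 z v - b z * th3 z v)) * f1 z u)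
    + ((- of_real (al z u) - th3 z u + a z * f1 z u + a z * (\<i> * kp z * e2 z u - a z * th3 z u)) * f2 z v
      - (- of_real (al z v) - th3 z v + a z * f1 z v + a z * (\<i> * kp z * e2 z v - a z * th3 z v)) * f2 z u)"
    "ext_d f2 z u v =
      ((al z u + th3 z u - b z * (- \<i> * kp z * e1 z u - b z * th3 z u)) * f1 z v
      - (al z v + th3 z v - b z * (- \<i> * kp z * e1 z v - b z * th3 z v)) * f1 z u)
    + ((b z * f1 z u + b z * (\<i> * kp z * e2 z u - a z * th3 z u)) * f2 z v
      - (b z * f1 z v + b z * (\<i> * kp z * e2 z v - a z * th3 z v)) * f2 z u)"
    if z: "z \<in> S" and u: "u \<in> tangent_space S z" and v: "v \<in> tangent_space S z" for z u v
  proof -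
    note has = smooth_on_has_derivative[OF sm(1) SD(3)[OF z]] smooth_on_has_derivative[OF sm(2) SD(3)[OF z]]
    note c0 = has_derivative_const[of "0::complex" "at z"]
    have t3: "of_real (o12 z w) - of_real (al z w) = th3 z w" for w
      by (simp add: th3_def)
    have p: "frechet_derivative a (at z) w =
        (\<i> * kp z + \<i> * kp z * a z * a z) * e1 z w + \<i> * kp z * a z * b z * e2 z w - b z * al z w"
      "frechet_derivative b (at z) w =
        \<i> * kp z * a z * b z * e1 z w + (\<i> * kp z + \<i> * kp z * b z * b z) * e2 z w + a z * al z w"
      if "w \<in> {u, v}" for w
      using that u v da[OF z] db[OF z] by blast+
    have q: "f1 z w = (of_real (h1 z w) - \<i> * of_real (kp z) * of_real (e2 z w)) + a z * th3 z w"
      "f2 z w = (of_real (h2 z w) + \<i> * of_real (kp z) * of_real (e1 z w)) + b z * th3 z w" for w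
      by (simp_all add: f s1_def s2_def)
    note I = frobenius_identity[where a = "a z" and b = "b z" and k = "kp z" and ?k1.0 = "of_real (kd 1 z)" and ?k2.0 = "of_real (kd 2 z)"
        and u = u and v = v and da = "frechet_derivative a (at z)" and db = "frechet_derivative b (at z)"
        and ?E1.0 = "\<lambda>w. of_real (e1 z w)" and ?E2.0 = "\<lambda>w. of_real (e2 z w)" and B = "\<lambda>w. of_real (al z w)"
        and H = "\<lambda>w. of_real (h1 z w)" and L = "\<lambda>w. of_real (h2 z w)" and ?O12.0 = "\<lambda>w. of_real (o12 z w)"
        and ?F1.0 = "f1 z" and ?F2.0 = "f2 z", unfolded t3]
    show "ext_d f1 z u v =
       (- a z * (- \<i> * kp z * e1 z u - b z * th3 z u) * f1 z v - (- a z * (- \<i> * kp z * e1 z v - b z * th3 z v)) * f1 z u)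
    + ((- of_real (al z u) - th3 z u + a z * f1 z u + a z * (\<i> * kp z * e2 z u - a z * th3 z u)) * f2 z v
      - (- of_real (al z v) - th3 z v + a z * f1 z v + a z * (\<i> * kp z * e2 z v - a z * th3 z v)) * f2 z u)"
      by (rule trans[OF _ I(1)[OF kd(1,2)[OF z] p q]])
        (simp add: f1_def ext_d_ph(1)[OF z _ c0 c0 c0 has(1)] ext_d_forms[OF z u v] wd_def algebra_simps)
    show "ext_d f2 z u v =
      ((al z u + th3 z u - b z * (- \<i> * kp z * e1 z u - b z * th3 z u)) * f1 z v
      - (al z v + th3 z v - b z * (- \<i> * kp z * e1 z v - b z * th3 z v)) * f1 z u)
    + ((b z * f1 z u + b z * (\<i> * kp z * e2 z u - a z * th3 z u)) * f2 z v
      - (b z * f1 z v + b z * (\<i> * kp z * e2 z v - a z * th3 z v)) * f2 z u)"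
      by (rule trans[OF _ I(2)[OF kd(1,2)[OF z] p q]])
        (simp add: f2_def ext_d_ph(1)[OF z _ c0 c0 c0 has(2)] ext_d_forms[OF z u v] wd_def algebra_simps)
  qed
  have frob: "frobenius S Dom [f1, f2]"
    unfolding frobenius_def
  proof (intro allI impI ballI)
    fix W \<alpha> z assume W: "open W" "W \<subseteq> Dom" and \<alpha>: "section_of S W [f1, f2] \<alpha>" and zW: "z \<in> S \<inter> W"
    have z: "z \<in> S" "z \<in> W" "z \<in> Dom" using zW W by auto
    have s\<alpha>: "\<And>v. smooth_on W (\<lambda>P. \<alpha> P v)" "\<And>P. P \<in> W \<Longrightarrow> linear (\<alpha> P)"
      using \<alpha> by (auto simp: section_of_def smooth_cform_def)
    have fd\<alpha>: "form_differentiable \<alpha> z"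
      by (rule smooth_imp_form_differentiable[OF z(2) s\<alpha>(1)])
    have fd: "form_differentiable f1 z" "form_differentiable f2 z"
      using sf by (auto simp: smooth_cform_def intro!: smooth_imp_form_differentiable[OF z(3)])
    \<comment> \<open>\<open>H1\<close>, \<open>H2\<close> are dual to f1, f2, so evaluation
      recovers the coefficients of a section as differentiable functions; membership in the span
      only provides them point by point.\<close>
    define c1 where "c1 P = \<alpha> P (H1 P)" for P
    define c2 where "c2 P = \<alpha> P (H2 P)" for P
    note dH = smooth_fields(1,2)[THEN smooth_on_has_derivative, OF z(3)]
    obtain c1' c2' where c: "(c1 has_derivative c1') (at z)" "(c2 has_derivative c2') (at z)"
      using has_derivative_form_apply[OF W(1) z(2) s\<alpha>(2) fd\<alpha> dH(1)]
        has_derivative_form_apply[OF W(1) z(2) s\<alpha>(2) fd\<alpha> dH(2)] unfolding c1_def[abs_def] c2_def[abs_def] by blast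
    have eq: "\<alpha> P v = c1 P * f1 P v + c2 P * f2 P v" if P: "P \<in> S \<inter> W" and v: "v \<in> tangent_space S P" for P v
    proof -
      obtain d :: "nat \<Rightarrow> complex" where d: "\<And>v. v \<in> tangent_space S P \<Longrightarrow> \<alpha> P v = d 0 * f1 P v + d 1 * f2 P v"
        using \<alpha> P unfolding section_of_def cspan_at_def span by blast
      have PS: "P \<in> S" using P by simp
      show ?thesis
        using d[OF v] d[OF field_tangent(1)[OF PS]] d[OF field_tangent(2)[OF PS]] fH[OF PS] by (simp add: c1_def c2_def)
    qed
    note m1 = ext_d_fmult[OF c(1) fd(1)] and m2 = ext_d_fmult[OF c(2) fd(2)]
    note d1 = ext_d_diff[OF fd\<alpha> m1(2)]
    note d2 = ext_d_diff[OF d1(2) m2(2)]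
    \<comment> \<open>The section equals c1 f1 + c2 f2 on tangent vectors of \<open>S\<close> only,
      so the product rule is transferred by \<open>ext_d_zero_on_S\<close>.\<close>
    have ext: "ext_d \<alpha> z u v = c1' u * f1 z v - c1' v * f1 z u + c1 z * ext_d f1 z u v +
       (c2' u * f2 z v - c2' v * f2 z u + c2 z * ext_d f2 z u v)"
      if uv: "u \<in> tangent_space S z" "v \<in> tangent_space S z" for u v
    proof -
      have "ext_d (\<lambda>P v. \<alpha> P v - c1 P * f1 P v - c2 P * f2 P v) z u v = 0"
      proof (rule ext_d_zero_on_S[OF W zW _ d2(2) _ uv])
        fix P assume P: "P \<in> W"
        then have PD: "P \<in> Dom" using W(2) by blast
        show "linear (\<lambda>v. \<alpha> P v - c1 P * f1 P v - c2 P * f2 P v)"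
          by (intro linear_compose_sub s\<alpha>(2)[OF P] linear_compose[OF lf(1)[OF PD] linear_times, unfolded o_def]
            linear_compose[OF lf(2)[OF PD] linear_times, unfolded o_def])
      qed (use eq in auto)
      then show ?thesis
        unfolding d2(1) d1(1) m1(1) m2(1) by (simp add: algebra_simps)
    qed
    define \<beta>1 where "\<beta>1 u = c1' u + c1 z * (- a z * (- \<i> * kp z * e1 z u - b z * th3 z u)) +
      c2 z * (al z u + th3 z u - b z * (- \<i> * kp z * e1 z u - b z * th3 z u))" for u
    define \<beta>2 where "\<beta>2 u = c2' u + c1 z * (- of_real (al z u) - th3 z u + a z * f1 z u + a z * (\<i> * kp z * e2 z u - a z * th3 z u)) +
      c2 z * (b z * f1 z u + b z * (\<i> * kp z * e2 z u - a z * th3 z u))" for u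
    have lin: "linear \<beta>1" "linear \<beta>2"
      unfolding \<beta>1_def[abs_def] \<beta>2_def[abs_def]
      by (rule linearI; simp add: c[THEN has_derivative_linear, THEN linear_add] c[THEN has_derivative_linear, THEN linear_scale]
        linear_coframe[OF z(3), THEN linear_add] linear_coframe[OF z(3), THEN linear_scale]
        linear_forms[OF z(3), THEN linear_add] linear_forms[OF z(3), THEN linear_scale]
        lf[OF z(3), THEN linear_add] lf[OF z(3), THEN linear_scale] scaleR_conv_of_real algebra_simps)+
    show "ext_deriv_congruent_0 S [f1, f2] \<alpha> z"
      unfolding ext_deriv_congruent_0_def ext_deriv_eq
    proof (intro exI[of _ "\<lambda>i. if i = 0 then \<beta>1 else \<beta>2"] conjI allI ballI)
      fix u v assume uv: "u \<in> tangent_space S z" "v \<in> tangent_space S z"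
      show "ext_d \<alpha> z u v = (\<Sum>i<length [f1, f2]. (if i = 0 then \<beta>1 else \<beta>2) u * ([f1, f2] ! i) z v
          - (if i = 0 then \<beta>1 else \<beta>2) v * ([f1, f2] ! i) z u)"
        unfolding ext[OF uv] alg[OF z(1) uv] by (simp add: \<beta>1_def \<beta>2_def algebra_simps)
    qed (use lin in auto)
  qed
  have "cspan_at S [f1, f2] z \<subseteq> cspan_at S (singular_forms A g K c) z \<and>
        (\<forall>\<phi>\<in>cspan_at S [f1, f2] z \<inter> cspan_at S (embedding_forms A g c) z.
           \<forall>v\<in>tangent_space S z. \<phi> v = 0)" if z: "z \<in> S" for z
  proof (intro conjI subsetI ballI)
    fix \<phi> assume \<phi>: "\<phi> \<in> cspan_at S [f1, f2] z"
    obtain d :: "nat \<Rightarrow> complex" where d: "linear \<phi>" "\<And>v. v \<in> tangent_space S z \<Longrightarrow> \<phi> v = d 0 * f1 z v + d 1 * f2 z v"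
      using \<phi> unfolding cspan_at_def span by blast
    \<comment> \<open>In the list of generators, th3 has index 3 and receives the contributions of a
      and b; s1 and s2 have indices 4 and 5.\<close>
    then show "\<phi> \<in> cspan_at S (singular_forms A g K c) z"
      unfolding cspan_at_def singular_forms_eq
      by (intro CollectI conjI exI[of _ "\<lambda>i. if i = 3 then d 0 * a z + d 1 * b z else if i = 4 then d 0 else if i = 5 then d 1 else 0"])
        (auto simp: f algebra_simps)
  next
    fix \<phi> v assume \<phi>: "\<phi> \<in> cspan_at S [f1, f2] z \<inter> cspan_at S (embedding_forms A g c) z" and v: "v \<in> tangent_space S z"
    obtain d :: "nat \<Rightarrow> complex" where d: "\<And>v. v \<in> tangent_space S z \<Longrightarrow> \<phi> v = d 0 * f1 z v + d 1 * f2 z v"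
      using \<phi> unfolding cspan_at_def span by blast
    obtain e where e: "\<And>v. v \<in> tangent_space S z \<Longrightarrow> \<phi> v = (\<Sum>i<length [th0, th1, th2, th3]. e i * ([th0, th1, th2, th3] ! i) z v)"
      using \<phi> unfolding cspan_at_def embedding_forms_eq by blast
    have "\<phi> (H1 z) = 0" "\<phi> (H2 z) = 0"
      using e[OF field_tangent(1)[OF z]] e[OF field_tangent(2)[OF z]] by (simp_all add: form_defs coframe_fields[OF z])
    then have "d 0 = 0" "d 1 = 0"
      using d[OF field_tangent(1)[OF z]] d[OF field_tangent(2)[OF z]] fH[OF z] by simp_all
    then show "\<phi> v = 0" using d[OF v] by simp
  qed
  then show ?thesis
    using sub frob by (intro exI[of _ "[f1, f2]"]) auto
qed

end

section \<open>The overdetermined system for a Frobenius subbundle\<close>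

text \<open>The two equations for R make (X, Y) a multiple l of (A, B). If (A, B) is nonzero and d =
  A X - P, then E1 and E2 give l d = 4 k^2, and E3 becomes (d - 2 k^2)^2 = 0. If A = B = 0, E3
  becomes (Q + 2 k^2)^2 = 0. The double roots leave one solution.\<close>

lemma final_algebra:
  fixes A B X Y P Q R k :: complex
  assumes k: "k \<noteq> 0"
    and E1: "R * X - P * Y = 4 * k * k * B" and E2: "R * Y - Q * X = 4 * k * k * A"
    and R: "R = B * X" "R = A * Y"
    and E3: "R * R - P * Q = 4 * k * k * (A * A + B * B + Q + k * k - B * Y)"
    and E4: "R * R - P * Q = 4 * k * k * (A * A + B * B + P + k * k - A * X)"
  shows "P = 2 * A * A - 2 * k * k" "Q = 2 * B * B - 2 * k * k" "R = 2 * A * B"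
proof -
  have PQ: "Q - B * Y = P - A * X"
    using E3 E4 k by simp
  have main: "A * X - P = 2 * k * k \<and> X = 2 * A \<and> Y = 2 * B" if "A \<noteq> 0 \<or> B \<noteq> 0"
  proof -
    obtain l where l: "X = l * A" "Y = l * B"
    proof (cases "A = 0")
      case True
      then show ?thesis using that[of "Y / B"] R \<open>A \<noteq> 0 \<or> B \<noteq> 0\<close> by auto
    next
      case False
      then show ?thesis using that[of "X / A"] R by (auto simp: field_simps)
    qed
    define d where "d = l * A * A - P"
    have PQ': "P = l * A * A - d" "Q = l * B * B - d"
      using PQ by (simp_all add: d_def l algebra_simps)
    have "B * (l * d - 4 * k * k) = 0"
      using E1 unfolding R(1) l PQ' by (simp add: algebra_simps)
    moreover have "A * (l * d - 4 * k * k) = 0"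
      using E2 unfolding R(2) l PQ' by (simp add: algebra_simps)
    ultimately have ld: "l * d = 4 * k * k"
      using that by auto
    have "(d - 2 * k * k) * (d - 2 * k * k) = 0"
      using E3 ld unfolding R(1) l PQ' by algebra
    then have d: "d = 2 * k * k" by simp
    then have "l = 2" using ld k by simp
    then show ?thesis using d l by (simp add: d_def algebra_simps)
  qed
  have "P = 2 * A * A - 2 * k * k \<and> Q = 2 * B * B - 2 * k * k \<and> R = 2 * A * B"
  proof (cases "A = 0 \<and> B = 0")
    case True
    then have "P = Q" "R = 0" using PQ R by simp_all
    moreover have "4 * k * k * (Q + k * k) = - (Q * Q)"
      using E3 True calculation by simp
    then have "Q * Q + 4 * k * k * (Q + k * k) = 0" by simp
    then have "(Q + 2 * k * k) * (Q + 2 * k * k) = 0"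
      by (simp add: algebra_simps)
    ultimately show ?thesis using True by (simp add: eq_neg_iff_add_eq_0)
  next
    case False
    then have m: "A * X - P = 2 * k * k" "X = 2 * A" "Y = 2 * B" using main by auto
    then show ?thesis using PQ R by (simp add: algebra_simps)
  qed
  then show "P = 2 * A * A - 2 * k * k" "Q = 2 * B * B - 2 * k * k" "R = 2 * A * B" by blast+
qed

text \<open>\<open>der f f1 f2\<close> stands for: along S, the derivatives of f in two fixed complex directions are
  f1 and f2. Only the values on S matter, since both directions are tangent to S.\<close>

locale derivation_pair =
  fixes S :: "'p set" and der :: "('p \<Rightarrow> complex) \<Rightarrow> ('p \<Rightarrow> complex) \<Rightarrow> ('p \<Rightarrow> complex) \<Rightarrow> bool"
  assumes der_const: "der (\<lambda>z. c) (\<lambda>z. 0) (\<lambda>z. 0)"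
    and der_add: "der f f1 f2 \<Longrightarrow> der h h1 h2 \<Longrightarrow> der (\<lambda>z. f z + h z) (\<lambda>z. f1 z + h1 z) (\<lambda>z. f2 z + h2 z)"
    and der_mult: "der f f1 f2 \<Longrightarrow> der h h1 h2 \<Longrightarrow>
      der (\<lambda>z. f z * h z) (\<lambda>z. f1 z * h z + f z * h1 z) (\<lambda>z. f2 z * h z + f z * h2 z)"
    and der_cong: "der f f1 f2 \<Longrightarrow> (\<And>z. z \<in> S \<Longrightarrow> f1 z = h1 z) \<Longrightarrow> (\<And>z. z \<in> S \<Longrightarrow> f2 z = h2 z) \<Longrightarrow> der f h1 h2"
    and der_unique: "der f f1 f2 \<Longrightarrow> der h h1 h2 \<Longrightarrow> (\<And>z. z \<in> S \<Longrightarrow> f z = h z) \<Longrightarrow> z \<in> S \<Longrightarrow> f1 z = h1 z \<and> f2 z = h2 z"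
begin

lemma der_diff:
  assumes "der f f1 f2" "der h h1 h2"
  shows "der (\<lambda>z. f z - h z) (\<lambda>z. f1 z - h1 z) (\<lambda>z. f2 z - h2 z)"
  using der_add[OF assms(1) der_mult[OF der_const[of "-1"] assms(2)]] by simp

lemma der_eq: "der h f1 f2 \<Longrightarrow> f = h \<Longrightarrow> der f f1 f2"
  by simp

lemmas der_intros = der_add der_diff der_mult der_const

text \<open>Here \<open>P, R, Q\<close> are the second derivatives of \<open>ln k / 2\<close> up to lower order terms. The symmetry
  \<open>R = R'\<close> of the Hessian is differentiated once to get \<open>E1, E2\<close>, and once more to get
  enough algebraic equations to determine \<open>P, R, Q\<close>.\<close>

lemma prolongation:
  fixes a0 a1 a2 a3 b0 b1 b2 b3 k A B :: "'p \<Rightarrow> complex"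
  assumes k0: "\<And>z. z \<in> S \<Longrightarrow> k z \<noteq> 0"
    and A: "\<And>z. A z = a0 z + \<i> * k z * a3 z" and B: "\<And>z. B z = b0 z + \<i> * k z * b3 z"
    and k: "der k (\<lambda>z. 2 * A z * k z) (\<lambda>z. 2 * B z * k z)"
    and a0: "der a0 (\<lambda>z. A z * a0 z + \<i> * k z * a2 z) (\<lambda>z. A z * b0 z - \<i> * k z * a1 z)"
    and a1: "der a1 (\<lambda>z. A z * a1 z) (\<lambda>z. A z * b1 z + \<i> * k z * a0 z)"
    and a2: "der a2 (\<lambda>z. A z * a2 z - \<i> * k z * a0 z) (\<lambda>z. A z * b2 z)"
    and a3: "der a3 (\<lambda>z. A z * a3 z + a2 z + \<i> * k z) (\<lambda>z. A z * b3 z - a1 z)"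
    and b0: "der b0 (\<lambda>z. B z * a0 z + \<i> * k z * b2 z) (\<lambda>z. B z * b0 z - \<i> * k z * b1 z)"
    and b1: "der b1 (\<lambda>z. B z * a1 z) (\<lambda>z. B z * b1 z + \<i> * k z * b0 z)"
    and b2: "der b2 (\<lambda>z. B z * a2 z - \<i> * k z * b0 z) (\<lambda>z. B z * b2 z)"
    and b3: "der b3 (\<lambda>z. B z * a3 z + b2 z) (\<lambda>z. B z * b3 z - b1 z + \<i> * k z)"
    and hess: "\<And>A1 A2 B1 B2 z. der A A1 A2 \<Longrightarrow> der B B1 B2 \<Longrightarrow> z \<in> S \<Longrightarrow> A2 z = B1 z"
  shows "der A (\<lambda>z. 3 * A z * A z - k z * k z) (\<lambda>z. 3 * A z * B z)"
    "der B (\<lambda>z. 3 * A z * B z) (\<lambda>z. 3 * B z * B z - k z * k z)"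
proof -
  have ii: "\<i> * \<i> = -1" by simp
  \<comment> \<open>Since 2 A = 2 a0 + X and 2 B = 2 b0 + Y, the eight coefficients can be exchanged
    for A, B, X, Y, P, R, R' and Q (see \<open>half\<close> and \<open>ik\<close>); with R = R' the
    derivatives of these quantities are polynomials in them and k.\<close>
  define X where "X z = 2 * \<i> * k z * a3 z" for z
  define Y where "Y z = 2 * \<i> * k z * b3 z" for z
  define P where "P z = 2 * \<i> * k z * a2 z + A z * X z - 2 * k z * k z" for z
  define R where "R z = B z * X z - 2 * \<i> * k z * a1 z" for z
  define R' where "R' z = 2 * \<i> * k z * b2 z + A z * Y z" for z
  define Q where "Q z = B z * Y z - 2 * \<i> * k z * b1 z - 2 * k z * k z" for z
  note d1 = der_intros k a0 a1 a2 a3 b0 b1 b2 b3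
  have dA: "der A (\<lambda>z. A z * A z + P z + k z * k z) (\<lambda>z. A z * B z + R z)"
  proof -
    have "der (\<lambda>z. a0 z + \<i> * k z * a3 z) (\<lambda>z. A z * A z + P z + k z * k z) (\<lambda>z. A z * B z + R z)"
    proof (rule der_cong, (rule d1)+)
      fix z
      show "A z * a0 z + \<i> * k z * a2 z + ((0 * k z + \<i> * (2 * A z * k z)) * a3 z + \<i> * k z * (A z * a3 z + a2 z + \<i> * k z)) = A z * A z + P z + k z * k z"
        unfolding P_def X_def A using ii by algebra
      show "A z * b0 z - \<i> * k z * a1 z + ((0 * k z + \<i> * (2 * B z * k z)) * a3 z + \<i> * k z * (A z * b3 z - a1 z)) = A z * B z + R z"
        unfolding R_def X_def A B by (simp add: algebra_simps)
    qed
    then show ?thesis by (simp add: A[abs_def])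
  qed
  have dB: "der B (\<lambda>z. A z * B z + R' z) (\<lambda>z. B z * B z + Q z + k z * k z)"
  proof -
    have "der (\<lambda>z. b0 z + \<i> * k z * b3 z) (\<lambda>z. A z * B z + R' z) (\<lambda>z. B z * B z + Q z + k z * k z)"
    proof (rule der_cong, (rule d1)+)
      fix z
      show "B z * a0 z + \<i> * k z * b2 z + ((0 * k z + \<i> * (2 * A z * k z)) * b3 z + \<i> * k z * (B z * a3 z + b2 z)) = A z * B z + R' z"
        unfolding R'_def Y_def A B by (simp add: algebra_simps)
      show "B z * b0 z - \<i> * k z * b1 z + ((0 * k z + \<i> * (2 * B z * k z)) * b3 z + \<i> * k z * (B z * b3 z - b1 z + \<i> * k z)) = B z * B z + Q z + k z * k z"
        unfolding Q_def Y_def B using ii by algebra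
    qed
    then show ?thesis by (simp add: B[abs_def])
  qed
  \<comment> \<open>The symmetry of the Hessian of k enters here.\<close>
  have RR: "R z = R' z" if "z \<in> S" for z
    using hess[OF dA dB that] by simp
  have half: "2 * a0 z = 2 * A z - X z" "2 * b0 z = 2 * B z - Y z" for z
    by (simp_all add: A B X_def Y_def)
  have ik: "2 * \<i> * k z * a2 z = P z - A z * X z + 2 * k z * k z" "2 * \<i> * k z * a1 z = B z * X z - R z"
    "2 * \<i> * k z * b2 z = R' z - A z * Y z" "2 * \<i> * k z * b1 z = B z * Y z - Q z - 2 * k z * k z" for z
    by (simp_all add: P_def R_def R'_def Q_def)
  note d2 = d1 dA dB
  have dX: "der X (\<lambda>z. 2 * A z * X z + P z) (\<lambda>z. B z * X z + A z * Y z + R z)"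
    by (rule der_eq[OF _ ext[OF X_def]], rule der_cong, (rule d1)+;
      simp add: X_def Y_def P_def R_def R'_def Q_def algebra_simps)
  have dY: "der Y (\<lambda>z. A z * Y z + B z * X z + R' z) (\<lambda>z. 2 * B z * Y z + Q z)"
    by (rule der_eq[OF _ ext[OF Y_def]], rule der_cong, (rule d1)+;
      simp add: X_def Y_def P_def R_def R'_def Q_def algebra_simps)
  note d3 = d2 dX dY
  have dR: "der R (\<lambda>z. R z * X z + 3 * A z * R z + B z * P z) (\<lambda>z. Q z * X z + 3 * B z * R z + A z * Q z + 4 * k z * k z * A z)"
    apply (rule der_eq[OF _ ext[OF R_def]], rule der_cong, (rule d3)+)
    subgoal premises p for z
      using ii half[of z] ik[of z] RR[OF p] by algebra
    subgoal premises p for z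
      using ii half[of z] ik[of z] RR[OF p] by algebra
    done
  have dR': "der R' (\<lambda>z. P z * Y z + 3 * A z * R z + B z * P z + 4 * k z * k z * B z) (\<lambda>z. R z * Y z + 3 * B z * R z + A z * Q z)"
    apply (rule der_eq[OF _ ext[OF R'_def]], rule der_cong, (rule d3)+)
    subgoal premises p for z
      using ii half[of z] ik[of z] RR[OF p] by algebra
    subgoal premises p for z
      using ii half[of z] ik[of z] RR[OF p] by algebra
    done
  have dP: "der P (\<lambda>z. P z * X z + 4 * A z * P z) (\<lambda>z. R z * X z + 2 * B z * P z + 2 * A z * R z - 4 * k z * k z * B z)"
    apply (rule der_eq[OF _ ext[OF P_def]], rule der_cong, (rule d3)+)
    subgoal premises p for z
      using ii half[of z] ik[of z] RR[OF p] by algebra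
    subgoal premises p for z
      using ii half[of z] ik[of z] RR[OF p] by algebra
    done
  have dQ: "der Q (\<lambda>z. R z * Y z + 2 * A z * Q z + 2 * B z * R z - 4 * k z * k z * A z) (\<lambda>z. Q z * Y z + 4 * B z * Q z)"
    apply (rule der_eq[OF _ ext[OF Q_def]], rule der_cong, (rule d3)+)
    subgoal premises p for z
      using ii half[of z] ik[of z] RR[OF p] by algebra
    subgoal premises p for z
      using ii half[of z] ik[of z] RR[OF p] by algebra
    done
  \<comment> \<open>R and R' agree on S, hence so do their computed derivatives; the terms 3 A R + B
    P and 3 B R + A Q cancel.\<close>
  have E1: "R z * X z - P z * Y z = 4 * k z * k z * B z" and E2: "R z * Y z - Q z * X z = 4 * k z * k z * A z" if "z \<in> S" for z
    using der_unique[OF dR dR' RR that] by (simp_all add: algebra_simps)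
  note d4 = d3 dR dP dQ
  have sol: "P z = 2 * A z * A z - 2 * k z * k z" "Q z = 2 * B z * B z - 2 * k z * k z" "R z = 2 * A z * B z"
    if z: "z \<in> S" for z
  proof -
    have l: "der (\<lambda>z. R z * X z - P z * Y z)
      (\<lambda>z. ((R z * X z + 3 * A z * R z + B z * P z) * X z + R z * (2 * A z * X z + P z)) -
        ((P z * X z + 4 * A z * P z) * Y z + P z * (A z * Y z + B z * X z + R' z)))
      (\<lambda>z. ((Q z * X z + 3 * B z * R z + A z * Q z + 4 * k z * k z * A z) * X z + R z * (B z * X z + A z * Y z + R z)) -
        ((R z * X z + 2 * B z * P z + 2 * A z * R z - 4 * k z * k z * B z) * Y z + P z * (2 * B z * Y z + Q z)))"
      by (rule d4)+
    have r: "der (\<lambda>z. 4 * k z * k z * B z)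
      (\<lambda>z. ((0 * k z + 4 * (2 * A z * k z)) * k z + 4 * k z * (2 * A z * k z)) * B z + 4 * k z * k z * (A z * B z + R' z))
      (\<lambda>z. ((0 * k z + 4 * (2 * B z * k z)) * k z + 4 * k z * (2 * B z * k z)) * B z + 4 * k z * k z * (B z * B z + Q z + k z * k z))"
      by (rule d4)+
    have l2: "der (\<lambda>z. R z * Y z - Q z * X z)
      (\<lambda>z. ((R z * X z + 3 * A z * R z + B z * P z) * Y z + R z * (A z * Y z + B z * X z + R' z)) -
        ((R z * Y z + 2 * A z * Q z + 2 * B z * R z - 4 * k z * k z * A z) * X z + Q z * (2 * A z * X z + P z)))
      (\<lambda>z. ((Q z * X z + 3 * B z * R z + A z * Q z + 4 * k z * k z * A z) * Y z + R z * (2 * B z * Y z + Q z)) -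
        ((Q z * Y z + 4 * B z * Q z) * X z + Q z * (B z * X z + A z * Y z + R z)))"
      by (rule d4)+
    have r2: "der (\<lambda>z. 4 * k z * k z * A z)
      (\<lambda>z. ((0 * k z + 4 * (2 * A z * k z)) * k z + 4 * k z * (2 * A z * k z)) * A z + 4 * k z * k z * (A z * A z + P z + k z * k z))
      (\<lambda>z. ((0 * k z + 4 * (2 * B z * k z)) * k z + 4 * k z * (2 * B z * k z)) * A z + 4 * k z * k z * (A z * B z + R z))"
      by (rule d4)+
    \<comment> \<open>Differentiating E1 in the first and E2 in the second direction gives R = B X
      and R = A Y; the other two derivatives give the quadratic equations of
      \<open>final_algebra\<close>.\<close>
    note D1 = der_unique[OF l r E1 z, THEN conjunct1] der_unique[OF l r E1 z, THEN conjunct2]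
      and D2 = der_unique[OF l2 r2 E2 z, THEN conjunct1] der_unique[OF l2 r2 E2 z, THEN conjunct2]
    have "4 * k z * k z * (R z - B z * X z) = 0"
      using D1(1) E1[OF z] RR[OF z] by algebra
    then have R1: "R z = B z * X z" using k0[OF z] by simp
    have "4 * k z * k z * (R z - A z * Y z) = 0"
      using D2(2) E2[OF z] by algebra
    then have R2: "R z = A z * Y z" using k0[OF z] by simp
    have S1: "R z * R z - P z * Q z = 4 * k z * k z * (A z * A z + B z * B z + Q z + k z * k z - B z * Y z)"
      using D1(2) E1[OF z] E2[OF z] by algebra
    have S2: "R z * R z - P z * Q z = 4 * k z * k z * (A z * A z + B z * B z + P z + k z * k z - A z * X z)"
      using D2(1) E1[OF z] E2[OF z] RR[OF z] by algebra
    show "P z = 2 * A z * A z - 2 * k z * k z" "Q z = 2 * B z * B z - 2 * k z * k z" "R z = 2 * A z * B z"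
      using final_algebra[OF k0[OF z] E1[OF z] E2[OF z] R1 R2 S1 S2] by blast+
  qed
  show "der A (\<lambda>z. 3 * A z * A z - k z * k z) (\<lambda>z. 3 * A z * B z)"
    by (rule der_cong[OF dA]) (simp_all add: sol)
  show "der B (\<lambda>z. 3 * A z * B z) (\<lambda>z. 3 * B z * B z - k z * k z)"
    by (rule der_cong[OF dB]) (simp_all add: sol RR[symmetric])
qed

end

section \<open>The covariant Hessian of a function on the surface\<close>

context surface_chart
begin

definition fd :: "(real^2 \<Rightarrow> real) \<Rightarrow> 2 \<Rightarrow> surf_coords \<Rightarrow> real" where
  "fd f i P = frechet_derivative f (at (fst P)) (snd P $ i)"

text \<open>The second covariant derivative in the frame: the \<open>f\<^sub>i\<^sub>j\<close> of
  \<open>df\<^sub>i = f\<^sub>j \<eta>\<^sup>j\<^sub>i + f\<^sub>i\<^sub>j \<eta>\<^sup>j\<close>,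
  while \<open>fd\<close> gives the \<open>f\<^sub>i\<close>.\<close>

definition Hs :: "(real^2 \<Rightarrow> real) \<Rightarrow> 2 \<Rightarrow> 2 \<Rightarrow> surf_coords \<Rightarrow> real" where
  "Hs f i j P = frechet_derivative (\<lambda>y. frechet_derivative f (at y) (snd P $ i)) (at (fst P)) (snd P $ j)
     - frechet_derivative f (at (fst P)) (Gam (fst P) (snd P $ j) (snd P $ i))"

text \<open>Second derivatives commute, and the connection has no torsion.\<close>

lemma Hs_sym:
  assumes "smooth_on U f" "fst P \<in> U"
  shows "Hs f i j P = Hs f j i P"
  unfolding Hs_def
  using frechet_derivative_commute[OF open_image assms, of "snd P $ i" "snd P $ j"] Gam_sym[OF assms(2), of "snd P $ i"]
  by simp

lemma fd_has_derivative:
  assumes f: "smooth_on U f" and P: "fst P \<in> U"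
  shows "(fd f i has_derivative (\<lambda>v. frechet_derivative (\<lambda>y. frechet_derivative f (at y) (snd P $ i)) (at (fst P)) (fst v)
      + frechet_derivative f (at (fst P)) (snd v $ i))) (at P)"
proof -
  let ?\<alpha> = "\<lambda>y. frechet_derivative f (at y)"
  have lin: "linear (?\<alpha> y)" if "y \<in> U" for y
    using has_derivative_linear[OF smooth_on_has_derivative[OF f that]] .
  have D: "((\<lambda>y. ?\<alpha> y v) has_derivative frechet_derivative (\<lambda>y. ?\<alpha> y v) (at (fst P))) (at (fst P))" for v
    by (rule smooth_on_has_derivative[OF smooth_on_frechet_derivative[OF f] P])
  have exp: "?\<alpha> y w = w $ 1 * ?\<alpha> y (axis 1 1) + w $ 2 * ?\<alpha> y (axis 2 1)" if "y \<in> U" for y w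
    by (subst vec2_expansion[of w]) (simp add: linear_add[OF lin[OF that]] linear_scale[OF lin[OF that]])
  have Dexp: "frechet_derivative (\<lambda>y. ?\<alpha> y w) (at (fst P)) h =
     w $ 1 * frechet_derivative (\<lambda>y. ?\<alpha> y (axis 1 1)) (at (fst P)) h + w $ 2 * frechet_derivative (\<lambda>y. ?\<alpha> y (axis 2 1)) (at (fst P)) h" for w h
  proof -
    have "((\<lambda>y. w $ 1 * ?\<alpha> y (axis 1 1) + w $ 2 * ?\<alpha> y (axis 2 1)) has_derivative
      (\<lambda>h. w $ 1 * frechet_derivative (\<lambda>y. ?\<alpha> y (axis 1 1)) (at (fst P)) h + w $ 2 * frechet_derivative (\<lambda>y. ?\<alpha> y (axis 2 1)) (at (fst P)) h)) (at (fst P))"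
      by (intro has_derivative_add has_derivative_mult_right D)
    then have "((\<lambda>y. ?\<alpha> y w) has_derivative
      (\<lambda>h. w $ 1 * frechet_derivative (\<lambda>y. ?\<alpha> y (axis 1 1)) (at (fst P)) h + w $ 2 * frechet_derivative (\<lambda>y. ?\<alpha> y (axis 2 1)) (at (fst P)) h)) (at (fst P))"
      by (rule has_derivative_transform_within_open[OF _ open_image P]) (rule exp[symmetric])
    from fun_cong[OF frechet_derivative_at[OF this], of h] show ?thesis by (rule sym)
  qed
  have n: "((\<lambda>Q. snd Q $ i $ j) has_derivative (\<lambda>v. snd v $ i $ j)) (at P)" for j :: 2
    by (auto intro!: bounded_linear_imp_has_derivative bounded_linear_compose[OF bounded_linear_vec_nth]
      bounded_linear_snd)
  have a: "((\<lambda>Q. ?\<alpha> (fst Q) v) has_derivative (\<lambda>h. frechet_derivative (\<lambda>y. ?\<alpha> y v) (at (fst P)) (fst h))) (at P)" for v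
    by (rule has_derivative_compose[OF bounded_linear_imp_has_derivative[OF bounded_linear_fst] D])
  have e: "frechet_derivative (\<lambda>y. ?\<alpha> y (snd P $ i)) (at (fst P)) h + ?\<alpha> (fst P) w =
    snd P $ i $ 1 * frechet_derivative (\<lambda>y. ?\<alpha> y (axis 1 1)) (at (fst P)) h + w $ 1 * ?\<alpha> (fst P) (axis 1 1) +
    (snd P $ i $ 2 * frechet_derivative (\<lambda>y. ?\<alpha> y (axis 2 1)) (at (fst P)) h + w $ 2 * ?\<alpha> (fst P) (axis 2 1))" for h w
    unfolding Dexp[of "snd P $ i"] exp[OF P, of w] by simp
  have 1: "((\<lambda>Q. snd Q $ i $ 1 * ?\<alpha> (fst Q) (axis 1 1) + snd Q $ i $ 2 * ?\<alpha> (fst Q) (axis 2 1)) has_derivative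
     (\<lambda>v. frechet_derivative (\<lambda>y. ?\<alpha> y (snd P $ i)) (at (fst P)) (fst v) + ?\<alpha> (fst P) (snd v $ i))) (at P)"
    by (rule has_derivative_eq_rhs[OF has_derivative_add[OF has_derivative_mult[OF n[of 1] a[of "axis 1 1"]]
          has_derivative_mult[OF n[of 2] a[of "axis 2 1"]]]])
      (rule ext, simp only: e)
  have o: "open (fst -` U :: surf_coords set)"
    using open_image by (auto intro!: open_vimage continuous_intros)
  have q: "snd Q $ i $ 1 * ?\<alpha> (fst Q) (axis 1 1) + snd Q $ i $ 2 * ?\<alpha> (fst Q) (axis 2 1) = fd f i Q"
    if "Q \<in> fst -` U" for Q
    unfolding fd_def using that by (intro exp[symmetric]) simp
  show ?thesis
    by (rule has_derivative_transform_within_open[OF 1 o _ q]) (simp_all add: P)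
qed

text \<open>Identifies \<open>fd\<close> and \<open>Hs\<close> as covariant derivatives: when the
  two parts of a tangent vector are expanded in the frame, the \<open>Gam\<close> term of the frame
  part goes into the Hessian.\<close>

lemma fd_tangent:
  assumes f: "smooth_on U f" and P: "P \<in> FP" and v: "\<forall>i j. cn i j P v + cn j i P v = 0"
  shows "frechet_derivative (\<lambda>y. frechet_derivative f (at y) (snd P $ i)) (at (fst P)) (fst v)
      + frechet_derivative f (at (fst P)) (snd v $ i) =
    (\<Sum>j\<in>UNIV. fd f j P * cn j i P v) + (\<Sum>j\<in>UNIV. Hs f i j P * et j P v)"
proof -
  note U = frame_patchD(1)[OF P]
  let ?D = "frechet_derivative f (at (fst P))"
  let ?D2 = "frechet_derivative (\<lambda>y. frechet_derivative f (at y) (snd P $ i)) (at (fst P))"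
  have lin: "linear ?D" "linear ?D2"
    using has_derivative_linear[OF smooth_on_has_derivative[OF f U]]
      has_derivative_linear[OF smooth_on_has_derivative[OF smooth_on_frechet_derivative[OF f] U]] by auto
  have x: "fst v = (\<Sum>j\<in>UNIV. et j P v *\<^sub>R snd P $ j)"
    unfolding eta_def by (rule frame_expand(1)[OF P])
  have w: "snd v $ i = (\<Sum>j\<in>UNIV. cn j i P v *\<^sub>R snd P $ j) - Gam (fst P) (fst v) (snd P $ i)"
    using frame_expand(1)[OF P, of "snd v $ i + Gam (fst P) (fst v) (snd P $ i)"]
    unfolding conn_eq by (simp add: eq_diff_eq)
  have "?D2 (fst v) = (\<Sum>j\<in>UNIV. et j P v * ?D2 (snd P $ j))"
    by (subst x) (simp add: linear_sum[OF lin(2)] linear_scale[OF lin(2)])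
  moreover have "?D (snd v $ i) = (\<Sum>j\<in>UNIV. cn j i P v * ?D (snd P $ j)) - ?D (Gam (fst P) (fst v) (snd P $ i))"
    by (subst w) (simp add: linear_diff[OF lin(1)] linear_sum[OF lin(1)] linear_scale[OF lin(1)])
  moreover have "?D (Gam (fst P) (fst v) (snd P $ i)) = (\<Sum>j\<in>UNIV. et j P v * ?D (Gam (fst P) (snd P $ j) (snd P $ i)))"
    by (subst x) (simp add: sum_2 Gam_simps linear_add[OF lin(1)] linear_scale[OF lin(1)])
  ultimately show ?thesis
    by (simp add: fd_def Hs_def sum_2 algebra_simps)
qed

end

context curved_chart
begin

section \<open>Necessity\<close>

lemma kd_fd: "kd i z = fd kap i (fst z)"
  by (simp add: kd_def fd_def)

lemma kd_derivative:
  assumes z: "z \<in> S"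
  obtains D where "(kd i has_derivative D) (at z)"
    and "\<And>v. v \<in> tangent_space S z \<Longrightarrow> D v = (if i = 1 then - kd 2 z * al z v else kd 1 z * al z v)
       + Hs kap i 1 (fst z) * e1 z v + Hs kap i 2 (fst z) * e2 z v"
proof -
  note P = SD(1)[OF z]
  let ?D = "\<lambda>v. frechet_derivative (\<lambda>y. frechet_derivative kap (at y) (snd (fst z) $ i)) (at (fst (fst z))) (fst (fst v))
      + frechet_derivative kap (at (fst (fst z))) (snd (fst v) $ i)"
  have "((\<lambda>z. fd kap i (fst z)) has_derivative ?D) (at z)"
    by (rule has_derivative_compose[OF bounded_linear_imp_has_derivative[OF bounded_linear_fst] fd_has_derivative[OF smooth_kap frame_patchD(1)[OF P]]])
  then have "(kd i has_derivative ?D) (at z)"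
    by (simp add: kd_fd[abs_def])
  moreover have "?D v = (if i = 1 then - kd 2 z * al z v else kd 1 z * al z v)
       + Hs kap i 1 (fst z) * e1 z v + Hs kap i 2 (fst z) * e2 z v" if v: "v \<in> tangent_space S z" for v
  proof -
    have T: "\<forall>i j. cn i j (fst z) (fst v) + cn j i (fst z) (fst v) = 0"
      using v unfolding tangent_S[OF z] by blast
    have "cn 2 1 (fst z) (fst v) = - cn 1 2 (fst z) (fst v)" "cn i i (fst z) (fst v) = 0" for i
      using T[rule_format, of 2 1] T[rule_format, of i i] by simp_all
    then show ?thesis
      unfolding fd_tangent[OF smooth_kap P T] using exhaust_2[of i]
      by (auto simp: sum_2 kd_fd coframe_defs)
  qed
  ultimately show ?thesis by (rule that)
qed

text \<open>A complex tangent vector is represented by the pair of its real and imaginary parts;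
  \<open>cx\<close>, \<open>cx2\<close> and \<open>rx\<close> are the complex-linear extensions of forms.\<close>

definition cx :: "(coords \<Rightarrow> complex) \<Rightarrow> coords \<times> coords \<Rightarrow> complex" where
  "cx m w = m (fst w) + \<i> * m (snd w)"

definition cx2 :: "(coords \<Rightarrow> coords \<Rightarrow> complex) \<Rightarrow> coords \<times> coords \<Rightarrow> coords \<times> coords \<Rightarrow> complex" where
  "cx2 \<omega> w y = cx (\<lambda>u. cx (\<omega> u) y) w"

lemma cx2_cong:
  assumes "\<And>u v. u \<in> T \<Longrightarrow> v \<in> T \<Longrightarrow> \<omega> u v = \<omega>' u v" "fst w \<in> T" "snd w \<in> T" "fst y \<in> T" "snd y \<in> T"
  shows "cx2 \<omega> w y = cx2 \<omega>' w y"
  using assms by (simp add: cx2_def cx_def)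

definition rx :: "(coords \<Rightarrow> real) \<Rightarrow> coords \<times> coords \<Rightarrow> complex" where
  "rx m w = Complex (m (fst w)) (m (snd w))"

lemma rx_eq: "rx m w = cx (\<lambda>u. of_real (m u)) w"
  by (simp add: rx_def cx_def complex_eq_iff)

definition wx :: "(coords \<Rightarrow> coords \<Rightarrow> real) \<Rightarrow> (coords \<Rightarrow> coords \<Rightarrow> real) \<Rightarrow> coords \<Rightarrow> coords \<times> coords \<Rightarrow> coords \<times> coords \<Rightarrow> complex" where
  "wx \<alpha> \<beta> z w y = rx (\<alpha> z) w * rx (\<beta> z) y - rx (\<alpha> z) y * rx (\<beta> z) w"

lemma cx2_wd: "cx2 (\<lambda>u v. of_real (wd \<alpha> \<beta> z u v)) w y = wx \<alpha> \<beta> z w y"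
  by (simp add: cx2_def cx_def wd_def wx_def rx_eq algebra_simps)

definition tangentC :: "coords \<Rightarrow> coords \<times> coords \<Rightarrow> bool" where
  "tangentC z w \<longleftrightarrow> fst w \<in> tangent_space S z \<and> snd w \<in> tangent_space S z"

lemma cx2_forms:
  assumes z: "z \<in> S" and w: "tangentC z w" and y: "tangentC z y"
  shows "cx2 (ext_d th0 z) w y = - wx h1 o1 z w y - wx h2 o2 z w y"
    "cx2 (ext_d th1 z) w y = - wx o12 o2 z w y + wx h1 o3 z w y + wx al e2 z w y"
    "cx2 (ext_d th2 z) w y = wx o12 o1 z w y + wx h2 o3 z w y - wx al e1 z w y"
    "cx2 (ext_d th3 z) w y = wx h1 h2 z w y - kp z * kp z * wx e1 e2 z w y"
    "cx2 (ext_d s1 z) w y = wx h2 o12 z w y - \<i> * (kd 1 z * wx e1 e2 z w y + kp z * wx al e1 z w y)"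
    "cx2 (ext_d s2 z) w y = - wx h1 o12 z w y + \<i> * (- kd 2 z * wx e1 e2 z w y - kp z * wx al e2 z w y)"
  using w y
  by (simp_all add: cx2_wd[symmetric] cx2_def cx_def tangentC_def ext_d_forms[OF z] algebra_simps)

lemma cx2_ph:
  assumes z: "z \<in> S" and s: "s \<in> {s1, s2}" and w: "tangentC z w" and y: "tangentC z y"
    and a: "(a0 has_derivative a0') (at z)" "(a1 has_derivative a1') (at z)"
      "(a2 has_derivative a2') (at z)" "(a3 has_derivative a3') (at z)"
  shows "cx2 (ext_d (ph s a0 a1 a2 a3) z) w y = cx2 (ext_d s z) w y
     + (cx a0' w * cx (th0 z) y - cx a0' y * cx (th0 z) w + a0 z * cx2 (ext_d th0 z) w y)
     + (cx a1' w * cx (th1 z) y - cx a1' y * cx (th1 z) w + a1 z * cx2 (ext_d th1 z) w y)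
     + (cx a2' w * cx (th2 z) y - cx a2' y * cx (th2 z) w + a2 z * cx2 (ext_d th2 z) w y)
     + (cx a3' w * cx (th3 z) y - cx a3' y * cx (th3 z) w + a3 z * cx2 (ext_d th3 z) w y)"
  by (simp add: cx2_def cx_def ext_d_ph(1)[OF z s a] algebra_simps)

text \<open>The form in which d\<phi> \<equiv> 0 modulo F enters the converse: d\<phi> vanishes on
  complex vectors that F annihilates.\<close>

lemma cx2_wedge_zero:
  assumes "\<And>i. i < n \<Longrightarrow> cx (f i) w = 0" "\<And>i. i < n \<Longrightarrow> cx (f i) y = 0"
  shows "cx2 (\<lambda>u v. \<Sum>i<n. \<beta> i u * f i v - \<beta> i v * f i u) w y = 0"
proof -
  have "cx2 (\<lambda>u v. \<Sum>i<n. \<beta> i u * f i v - \<beta> i v * f i u) w y =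
     (\<Sum>i<n. cx (\<beta> i) w * cx (f i) y - cx (\<beta> i) y * cx (f i) w)"
    by (simp add: cx2_def cx_def sum_distrib_left sum.distrib[symmetric] algebra_simps)
  then show ?thesis using assms by simp
qed

text \<open>Imaginary parts: \<open>V1 + \<i> W1\<close> is \<open>V1 - \<i>k H2\<close> and
  \<open>V2 + \<i> W2\<close> is \<open>V2 + \<i>k H1\<close>, the corrections of V1 and V2 that s1
  and s2 annihilate.\<close>

definition W1 where "W1 z = fld z ((0, 0), (0, axis 3 (- kp z)))"
definition W2 where "W2 z = fld z ((0, 0), (0, axis 2 (kp z)))"

text \<open>Real and imaginary part of T - a H1 - b H2, where p lists the values of
  \<open>\<omega>\<^sup>1\<close>, \<open>\<omega>\<^sup>2\<close>, \<open>\<omega>\<^sup>3\<close>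
  and \<open>\<omega>\<^sup>1\<^sub>2\<close> on T. With a and b the coefficients of the matching
  \<theta>, both normalised forms annihilate it.\<close>

definition TC :: "(real^3) \<times> real \<Rightarrow> complex \<Rightarrow> complex \<Rightarrow> coords \<Rightarrow> coords \<times> coords" where
  "TC p a b z = (fld z ((0, 0), (fst p, axis 1 (snd p) - axis 2 (Re a) - axis 3 (Re b))),
     fld z ((0, 0), (0, - axis 2 (Im a) - axis 3 (Im b))))"

lemma rx_V:
  assumes "z \<in> S"
  shows "rx (e1 z) (V1 z, W1 z) = 1" "rx (e2 z) (V1 z, W1 z) = 0" "rx (al z) (V1 z, W1 z) = 0"
    "rx (o1 z) (V1 z, W1 z) = 1" "rx (o2 z) (V1 z, W1 z) = 0" "rx (o3 z) (V1 z, W1 z) = 0"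
    "rx (o12 z) (V1 z, W1 z) = 0" "rx (h1 z) (V1 z, W1 z) = 0" "rx (h2 z) (V1 z, W1 z) = - \<i> * kp z"
    "rx (e1 z) (V2 z, W2 z) = 0" "rx (e2 z) (V2 z, W2 z) = 1" "rx (al z) (V2 z, W2 z) = 0"
    "rx (o1 z) (V2 z, W2 z) = 0" "rx (o2 z) (V2 z, W2 z) = 1" "rx (o3 z) (V2 z, W2 z) = 0"
    "rx (o12 z) (V2 z, W2 z) = 0" "rx (h1 z) (V2 z, W2 z) = \<i> * kp z" "rx (h2 z) (V2 z, W2 z) = 0"
    "rx (e1 z) (TC p a b z) = 0" "rx (e2 z) (TC p a b z) = 0" "rx (al z) (TC p a b z) = 0"
    "rx (o1 z) (TC p a b z) = fst p $ 1" "rx (o2 z) (TC p a b z) = fst p $ 2" "rx (o3 z) (TC p a b z) = fst p $ 3"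
    "rx (o12 z) (TC p a b z) = snd p" "rx (h1 z) (TC p a b z) = - a" "rx (h2 z) (TC p a b z) = - b"
  by (simp_all add: rx_def V1_def V2_def W1_def W2_def TC_def assms axis_def complex_eq_iff)

lemma tangentC_fields:
  assumes "z \<in> S"
  shows "tangentC z (V1 z, W1 z)" "tangentC z (V2 z, W2 z)" "tangentC z (TC p a b z)"
  using fld_tangent[OF assms] by (simp_all add: tangentC_def V1_def V2_def W1_def W2_def TC_def)

lemma cx_forms:
  "cx (th0 z) w = rx (o3 z) w" "cx (th1 z) w = rx (o1 z) w - rx (e1 z) w" "cx (th2 z) w = rx (o2 z) w - rx (e2 z) w"
  "cx (th3 z) w = rx (o12 z) w - rx (al z) w" "cx (s1 z) w = rx (h1 z) w - \<i> * kp z * rx (e2 z) w"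
  "cx (s2 z) w = rx (h2 z) w + \<i> * kp z * rx (e1 z) w"
  by (simp_all add: form_defs cx_def rx_eq algebra_simps)

lemma cx_ph: "cx (ph s a0 a1 a2 a3 z) w = cx (s z) w + a0 z * cx (th0 z) w + a1 z * cx (th1 z) w
    + a2 z * cx (th2 z) w + a3 z * cx (th3 z) w"
  by (simp add: ph_def cx_def algebra_simps)

text \<open>The equations are \<open>d\<phi> = 0\<close> for the two forms \<open>\<phi>\<close>, evaluated on pairs of those complex vectors
  among \<open>V1 - \<i>k H2\<close>, \<open>V2 + \<i>k H1\<close>, \<open>T\<^sub>i - a\<^sub>i H1 - b\<^sub>i H2\<close> that both forms annihilate.\<close>

lemma first_order_system:
  assumes z: "z \<in> S"
    and a: "(a0 has_derivative a0') (at z)" "(a1 has_derivative a1') (at z)"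
      "(a2 has_derivative a2') (at z)" "(a3 has_derivative a3') (at z)"
    and b: "(b0 has_derivative b0') (at z)" "(b1 has_derivative b1') (at z)"
      "(b2 has_derivative b2') (at z)" "(b3 has_derivative b3') (at z)"
    and zero: "\<And>w y. tangentC z w \<Longrightarrow> tangentC z y \<Longrightarrow>
       cx (ph s1 a0 a1 a2 a3 z) w = 0 \<Longrightarrow> cx (ph s2 b0 b1 b2 b3 z) w = 0 \<Longrightarrow>
       cx (ph s1 a0 a1 a2 a3 z) y = 0 \<Longrightarrow> cx (ph s2 b0 b1 b2 b3 z) y = 0 \<Longrightarrow>
       cx2 (ext_d (ph s1 a0 a1 a2 a3) z) w y = 0 \<and> cx2 (ext_d (ph s2 b0 b1 b2 b3) z) w y = 0"
  defines "AA \<equiv> a0 z + \<i> * kp z * a3 z" and "BB \<equiv> b0 z + \<i> * kp z * b3 z"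
    and "D1 \<equiv> (\<lambda>f::coords \<Rightarrow> complex. cx f (V1 z, W1 z))" and "D2 \<equiv> (\<lambda>f::coords \<Rightarrow> complex. cx f (V2 z, W2 z))"
  shows "of_real (kd 1 z) = 2 * AA * kp z" "of_real (kd 2 z) = 2 * BB * kp z"
    "D1 a0' = AA * a0 z + \<i> * kp z * a2 z" "D2 a0' = AA * b0 z - \<i> * kp z * a1 z"
    "D1 a1' = AA * a1 z" "D2 a1' = AA * b1 z + \<i> * kp z * a0 z"
    "D1 a2' = AA * a2 z - \<i> * kp z * a0 z" "D2 a2' = AA * b2 z"
    "D1 a3' = AA * a3 z + a2 z + \<i> * kp z" "D2 a3' = AA * b3 z - a1 z"
    "D1 b0' = BB * a0 z + \<i> * kp z * b2 z" "D2 b0' = BB * b0 z - \<i> * kp z * b1 z"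
    "D1 b1' = BB * a1 z" "D2 b1' = BB * b1 z + \<i> * kp z * b0 z"
    "D1 b2' = BB * a2 z - \<i> * kp z * b0 z" "D2 b2' = BB * b2 z"
    "D1 b3' = BB * a3 z + b2 z" "D2 b3' = BB * b3 z - b1 z + \<i> * kp z"
proof -
  note tc = tangentC_fields[OF z]
  note ev = rx_V[OF z]
  let ?T0 = "TC (axis 3 1, 0) (a0 z) (b0 z) z" and ?T1 = "TC (axis 1 1, 0) (a1 z) (b1 z) z"
    and ?T2 = "TC (axis 2 1, 0) (a2 z) (b2 z) z" and ?T3 = "TC (0, 1) (a3 z) (b3 z) z"
  have kill: "cx (ph s1 a0 a1 a2 a3 z) w = 0" "cx (ph s2 b0 b1 b2 b3 z) w = 0" "tangentC z w"
    if "w \<in> {(V1 z, W1 z), (V2 z, W2 z), ?T0, ?T1, ?T2, ?T3}" for w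
    using that tc by (auto simp: cx_ph cx_forms ev axis_def)
  have s: "s1 \<in> {s1, s2}" "s2 \<in> {s1, s2}" by auto
  have E: "cx2 (ext_d (ph s1 a0 a1 a2 a3) z) w y = 0" "cx2 (ext_d (ph s2 b0 b1 b2 b3) z) w y = 0"
    if "w \<in> {(V1 z, W1 z), (V2 z, W2 z), ?T0, ?T1, ?T2, ?T3}" "y \<in> {(V1 z, W1 z), (V2 z, W2 z), ?T0, ?T1, ?T2, ?T3}" for w y
    using zero[OF kill(3)[OF that(1)] kill(3)[OF that(2)] kill(1,2)[OF that(1)] kill(1,2)[OF that(2)]] by blast+
  have kp0: "complex_of_real (kp z) \<noteq> 0"
    using kap_pos[OF frame_patchD(1)[OF SD(1)[OF z]]] by simp
  note simps = cx2_ph[OF z s(1) tc(1) tc(2) a] cx2_ph[OF z s(1) tc(1) tc(3) a] cx2_ph[OF z s(1) tc(2) tc(3) a]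
    cx2_ph[OF z s(2) tc(1) tc(2) b] cx2_ph[OF z s(2) tc(1) tc(3) b] cx2_ph[OF z s(2) tc(2) tc(3) b]
    cx2_forms[OF z tc(1) tc(2)] cx2_forms[OF z tc(1) tc(3)] cx2_forms[OF z tc(2) tc(3)] cx_forms wx_def ev axis_def
  have ii: "\<i> * \<i> = -1" by simp
  \<comment> \<open>All \<theta>'s vanish on both vectors of this pair, so no derivative of a
    coefficient appears; what remains are conditions on dk.\<close>
  have 12: "2 * (\<i> * kp z) * (a0 z + \<i> * kp z * a3 z) = \<i> * of_real (kd 1 z)"
     "2 * (\<i> * kp z) * (b0 z + \<i> * kp z * b3 z) = \<i> * of_real (kd 2 z)"
    using E[of "(V1 z, W1 z)" "(V2 z, W2 z)"] by (simp_all add: simps algebra_simps)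
  then show "of_real (kd 1 z) = 2 * AA * kp z" "of_real (kd 2 z) = 2 * BB * kp z"
    unfolding AA_def BB_def using ii by algebra+
  show "D1 a0' = AA * a0 z + \<i> * kp z * a2 z" "D1 b0' = BB * a0 z + \<i> * kp z * b2 z"
    using E[of "(V1 z, W1 z)" ?T0] by (simp_all add: simps AA_def BB_def D1_def algebra_simps)
  show "D2 a0' = AA * b0 z - \<i> * kp z * a1 z" "D2 b0' = BB * b0 z - \<i> * kp z * b1 z"
    using E[of "(V2 z, W2 z)" ?T0] by (simp_all add: simps AA_def BB_def D2_def algebra_simps)
  show "D1 a1' = AA * a1 z" "D1 b1' = BB * a1 z"
    using E[of "(V1 z, W1 z)" ?T1] by (simp_all add: simps AA_def BB_def D1_def algebra_simps)
  show "D2 a1' = AA * b1 z + \<i> * kp z * a0 z" "D2 b1' = BB * b1 z + \<i> * kp z * b0 z"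
    using E[of "(V2 z, W2 z)" ?T1] by (simp_all add: simps AA_def BB_def D2_def algebra_simps)
  show "D1 a2' = AA * a2 z - \<i> * kp z * a0 z" "D1 b2' = BB * a2 z - \<i> * kp z * b0 z"
    using E[of "(V1 z, W1 z)" ?T2] by (simp_all add: simps AA_def BB_def D1_def algebra_simps)
  show "D2 a2' = AA * b2 z" "D2 b2' = BB * b2 z"
    using E[of "(V2 z, W2 z)" ?T2] by (simp_all add: simps AA_def BB_def D2_def algebra_simps)
  show "D1 a3' = AA * a3 z + a2 z + \<i> * kp z" "D1 b3' = BB * a3 z + b2 z"
    using E[of "(V1 z, W1 z)" ?T3] by (simp_all add: simps AA_def BB_def D1_def algebra_simps)
  show "D2 a3' = AA * b3 z - a1 z" "D2 b3' = BB * b3 z - b1 z + \<i> * kp z"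
    using E[of "(V2 z, W2 z)" ?T3] by (simp_all add: simps AA_def BB_def D2_def algebra_simps)
qed

end

section \<open>Pointwise spans and evaluation of forms on fields\<close>

lemma cspan_at_nth:
  assumes "i < length \<alpha>s" "linear ((\<alpha>s ! i) P)"
  shows "(\<alpha>s ! i) P \<in> cspan_at S \<alpha>s P"
  unfolding cspan_at_def
proof (intro CollectI conjI exI[of _ "\<lambda>j. if j = i then 1 else 0"] ballI)
  fix v
  have "(\<Sum>j<length \<alpha>s. (if j = i then 1 else 0) * (\<alpha>s ! j) P v) = (\<Sum>j<length \<alpha>s. if j = i then (\<alpha>s ! j) P v else 0)"
    by (rule sum.cong) auto
  then show "(\<alpha>s ! i) P v = (\<Sum>j<length \<alpha>s. (if j = i then 1 else 0) * (\<alpha>s ! j) P v)"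
    using assms(1) by simp
qed (rule assms(2))

lemma cspan_at_lincomb:
  assumes "\<phi> \<in> cspan_at S \<alpha>s P" "\<psi> \<in> cspan_at S \<alpha>s P"
  shows "(\<lambda>v. a * \<phi> v + b * \<psi> v) \<in> cspan_at S \<alpha>s P"
proof -
  obtain c where c: "linear \<phi>" "\<And>v. v \<in> tangent_space S P \<Longrightarrow> \<phi> v = (\<Sum>i<length \<alpha>s. c i * (\<alpha>s ! i) P v)"
    using assms(1) unfolding cspan_at_def by blast
  obtain d where d: "linear \<psi>" "\<And>v. v \<in> tangent_space S P \<Longrightarrow> \<psi> v = (\<Sum>i<length \<alpha>s. d i * (\<alpha>s ! i) P v)"
    using assms(2) unfolding cspan_at_def by blast
  show ?thesis
    unfolding cspan_at_def
  proof (intro CollectI conjI exI[of _ "\<lambda>i. a * c i + b * d i"] ballI)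
    show "linear (\<lambda>v. a * \<phi> v + b * \<psi> v)"
      by (intro linear_compose_add linear_compose[OF c(1) linear_times, unfolded o_def]
        linear_compose[OF d(1) linear_times, unfolded o_def])
    fix v assume "v \<in> tangent_space S P"
    then show "a * \<phi> v + b * \<psi> v = (\<Sum>i<length \<alpha>s. (a * c i + b * d i) * (\<alpha>s ! i) P v)"
      by (simp add: c(2) d(2) sum_distrib_left sum.distrib algebra_simps)
  qed
qed

lemma cspan_at_cong:
  assumes "\<phi> \<in> cspan_at S \<alpha>s P" "linear \<psi>" "\<And>v. v \<in> tangent_space S P \<Longrightarrow> \<psi> v = \<phi> v"
  shows "\<psi> \<in> cspan_at S \<alpha>s P"
  using assms unfolding cspan_at_def by auto

lemma smooth_form_apply:
  assumes "open V" "smooth_cform V \<alpha>" "smooth_on V Y"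
  shows "smooth_on V (\<lambda>z. \<alpha> z (Y z))"
proof -
  have s: "smooth_on V (\<lambda>z. \<alpha> z v)" and lin: "z \<in> V \<Longrightarrow> linear (\<alpha> z)" for z v
    using assms(2) by (auto simp: smooth_cform_def)
  have "smooth_on V (\<lambda>z. \<Sum>b\<in>Basis. (Y z \<bullet> b) *\<^sub>R \<alpha> z b)"
    by (intro smooth_on_sum smooth_on_scaleR assms(1) s
      smooth_on_bounded_linear[OF assms(1) bounded_linear_inner_left assms(3)])
  then show ?thesis
  proof (rule smooth_on_cong[OF assms(1), rotated])
    fix z assume "z \<in> V"
    then have "\<alpha> z (\<Sum>b\<in>Basis. (Y z \<bullet> b) *\<^sub>R b) = (\<Sum>b\<in>Basis. (Y z \<bullet> b) *\<^sub>R \<alpha> z b)"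
      by (simp add: linear_sum[OF lin] linear_scale[OF lin])
    then show "(\<Sum>b\<in>Basis. (Y z \<bullet> b) *\<^sub>R \<alpha> z b) = \<alpha> z (Y z)"
      by (simp add: euclidean_representation)
  qed
qed

context curved_chart
begin

text \<open>The fields T0, T1, T2, T3, H1, H2 are dual to the six generators, so the coefficients of
  a covector are its values on them.\<close>

lemma singular_expand:
  assumes z: "z \<in> S" and \<phi>: "\<phi> \<in> cspan_at S (singular_forms A g K c) z" and v: "v \<in> tangent_space S z"
  shows "\<phi> v = \<phi> (T0 z) * th0 z v + \<phi> (T1 z) * th1 z v + \<phi> (T2 z) * th2 z v + \<phi> (T3 z) * th3 z v
    + \<phi> (H1 z) * s1 z v + \<phi> (H2 z) * s2 z v"
proof -
  obtain d :: "nat \<Rightarrow> complex" where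
    d: "\<And>v. v \<in> tangent_space S z \<Longrightarrow> \<phi> v = (\<Sum>i<length [th0, th1, th2, th3, s1, s2]. d i * ([th0, th1, th2, th3, s1, s2] ! i) z v)"
    using \<phi> unfolding cspan_at_def singular_forms_eq by blast
  then have d': "\<phi> v = d 0 * th0 z v + d 1 * th1 z v + d 2 * th2 z v + d 3 * th3 z v + d 4 * s1 z v + d 5 * s2 z v"
    if "v \<in> tangent_space S z" for v
    using d[OF that] by (simp add: eval_nat_numeral)
  note t = field_tangent[OF z]
  have "\<phi> (T0 z) = d 0" "\<phi> (T1 z) = d 1" "\<phi> (T2 z) = d 2" "\<phi> (T3 z) = d 3" "\<phi> (H1 z) = d 4" "\<phi> (H2 z) = d 5"
    unfolding t[THEN d'] by (simp_all add: form_defs coframe_fields[OF z])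
  then show ?thesis using d'[OF v] by simp
qed

text \<open>Turns transversality to the \<theta>'s into a test on the two vectors H1 and H2.\<close>

lemma embedding_span:
  assumes z: "z \<in> S" and \<phi>: "\<phi> \<in> cspan_at S (singular_forms A g K c) z" and 0: "\<phi> (H1 z) = 0" "\<phi> (H2 z) = 0"
  shows "\<phi> \<in> cspan_at S (embedding_forms A g c) z"
  unfolding cspan_at_def embedding_forms_eq
proof (intro CollectI conjI exI[of _ "\<lambda>i. [\<phi> (T0 z), \<phi> (T1 z), \<phi> (T2 z), \<phi> (T3 z)] ! i"] ballI)
  show "linear \<phi>" using \<phi> by (simp add: cspan_at_def)
  fix v assume "v \<in> tangent_space S z"
  from singular_expand[OF z \<phi> this] show "\<phi> v = (\<Sum>i<length [th0, th1, th2, th3].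
      [\<phi> (T0 z), \<phi> (T1 z), \<phi> (T2 z), \<phi> (T3 z)] ! i * ([th0, th1, th2, th3] ! i) z v)"
    by (simp add: 0)
qed

text \<open>The relation required by \<open>derivation_pair\<close>. Any ambient derivative may be
  the witness, since the values of f on S determine it along tangent vectors.\<close>

definition der :: "coords set \<Rightarrow> (coords \<Rightarrow> complex) \<Rightarrow> (coords \<Rightarrow> complex) \<Rightarrow> (coords \<Rightarrow> complex) \<Rightarrow> bool" where
  "der N f f1 f2 \<longleftrightarrow> (\<forall>z\<in>S \<inter> N. \<exists>f'. (f has_derivative f') (at z) \<and>
     cx f' (V1 z, W1 z) = f1 z \<and> cx f' (V2 z, W2 z) = f2 z)"

lemma derI:
  assumes "\<And>z. z \<in> S \<inter> N \<Longrightarrow> (f has_derivative f' z) (at z)"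
    "\<And>z. z \<in> S \<inter> N \<Longrightarrow> cx (f' z) (V1 z, W1 z) = f1 z" "\<And>z. z \<in> S \<inter> N \<Longrightarrow> cx (f' z) (V2 z, W2 z) = f2 z"
  shows "der N f f1 f2"
  using assms unfolding der_def by blast

lemma derivation_pair_der:
  assumes N: "open N"
  shows "derivation_pair (S \<inter> N) (der N)"
proof
  show "der N (\<lambda>z. c) (\<lambda>z. 0) (\<lambda>z. 0)" for c
    by (rule derI[OF has_derivative_const]) (simp_all add: cx_def)
next
  fix f f1 f2 h h1 h2 assume f: "der N f f1 f2" and h: "der N h h1 h2"
  show "der N (\<lambda>z. f z + h z) (\<lambda>z. f1 z + h1 z) (\<lambda>z. f2 z + h2 z)"
    unfolding der_def
  proof
    fix z assume z: "z \<in> S \<inter> N"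
    obtain f' h' where "(f has_derivative f') (at z)" "cx f' (V1 z, W1 z) = f1 z" "cx f' (V2 z, W2 z) = f2 z"
      and "(h has_derivative h') (at z)" "cx h' (V1 z, W1 z) = h1 z" "cx h' (V2 z, W2 z) = h2 z"
      using f h z unfolding der_def by blast
    then show "\<exists>f'. ((\<lambda>z. f z + h z) has_derivative f') (at z) \<and> cx f' (V1 z, W1 z) = f1 z + h1 z \<and> cx f' (V2 z, W2 z) = f2 z + h2 z"
      by (intro exI[of _ "\<lambda>u. f' u + h' u"]) (auto intro: has_derivative_add simp: cx_def algebra_simps)
  qed
  show "der N (\<lambda>z. f z * h z) (\<lambda>z. f1 z * h z + f z * h1 z) (\<lambda>z. f2 z * h z + f z * h2 z)"
    unfolding der_def
  proof
    fix z assume z: "z \<in> S \<inter> N"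
    obtain f' h' where f': "(f has_derivative f') (at z)" "cx f' (V1 z, W1 z) = f1 z" "cx f' (V2 z, W2 z) = f2 z"
      and h': "(h has_derivative h') (at z)" "cx h' (V1 z, W1 z) = h1 z" "cx h' (V2 z, W2 z) = h2 z"
      using f h z unfolding der_def by blast
    have "cx (\<lambda>u. f z * h' u + f' u * h z) w = cx f' w * h z + f z * cx h' w" for w
      by (simp add: cx_def algebra_simps)
    then show "\<exists>f'. ((\<lambda>z. f z * h z) has_derivative f') (at z) \<and> cx f' (V1 z, W1 z) = f1 z * h z + f z * h1 z
        \<and> cx f' (V2 z, W2 z) = f2 z * h z + f z * h2 z"
      using has_derivative_mult[OF f'(1) h'(1)] f'(2,3) h'(2,3) by (intro exI[of _ "\<lambda>u. f z * h' u + f' u * h z"]) simp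
  qed
next
  fix f f1 f2 h1 h2 assume "der N f f1 f2" "\<And>z. z \<in> S \<inter> N \<Longrightarrow> f1 z = h1 z" "\<And>z. z \<in> S \<inter> N \<Longrightarrow> f2 z = h2 z"
  then show "der N f h1 h2" unfolding der_def by metis
next
  fix f f1 f2 h h1 h2 z assume f: "der N f f1 f2" and h: "der N h h1 h2" and eq: "\<And>z. z \<in> S \<inter> N \<Longrightarrow> f z = h z"
    and z: "z \<in> S \<inter> N"
  obtain f' h' where f': "(f has_derivative f') (at z)" "cx f' (V1 z, W1 z) = f1 z" "cx f' (V2 z, W2 z) = f2 z"
    and h': "(h has_derivative h') (at z)" "cx h' (V1 z, W1 z) = h1 z" "cx h' (V2 z, W2 z) = h2 z"
    using f h z unfolding der_def by blast
  have zN: "z \<in> N" "z \<in> S" using z by auto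
  have "f' u = h' u" if "u \<in> tangent_space S z" for u
    by (rule tangent_derivative_eq[OF that N zN(1) eq f'(1) h'(1)])
  then show "f1 z = h1 z \<and> f2 z = h2 z"
    using f'(2,3) h'(2,3) tangentC_fields[OF zN(2)] by (simp add: cx_def tangentC_def)
qed

text \<open>The relations kd 1 = 2 AA k and kd 2 = 2 BB k hold along S, so they may be
  differentiated again in both directions: the left sides give the Hessian of k, the right sides the
  derivatives of AA and BB found in \<open>prolongation\<close>.\<close>

lemma hessian_from_system:
  assumes N: "open N" and z0: "z0 \<in> S \<inter> N"
    and diff: "\<And>z. z \<in> S \<inter> N \<Longrightarrow> (a0 has_derivative a0' z) (at z)" "\<And>z. z \<in> S \<inter> N \<Longrightarrow> (a1 has_derivative a1' z) (at z)"
      "\<And>z. z \<in> S \<inter> N \<Longrightarrow> (a2 has_derivative a2' z) (at z)" "\<And>z. z \<in> S \<inter> N \<Longrightarrow> (a3 has_derivative a3' z) (at z)"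
      "\<And>z. z \<in> S \<inter> N \<Longrightarrow> (b0 has_derivative b0' z) (at z)" "\<And>z. z \<in> S \<inter> N \<Longrightarrow> (b1 has_derivative b1' z) (at z)"
      "\<And>z. z \<in> S \<inter> N \<Longrightarrow> (b2 has_derivative b2' z) (at z)" "\<And>z. z \<in> S \<inter> N \<Longrightarrow> (b3 has_derivative b3' z) (at z)"
    and zero: "\<And>z w y. z \<in> S \<inter> N \<Longrightarrow> tangentC z w \<Longrightarrow> tangentC z y \<Longrightarrow>
       cx (ph s1 a0 a1 a2 a3 z) w = 0 \<Longrightarrow> cx (ph s2 b0 b1 b2 b3 z) w = 0 \<Longrightarrow>
       cx (ph s1 a0 a1 a2 a3 z) y = 0 \<Longrightarrow> cx (ph s2 b0 b1 b2 b3 z) y = 0 \<Longrightarrow>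
       cx2 (ext_d (ph s1 a0 a1 a2 a3) z) w y = 0 \<and> cx2 (ext_d (ph s2 b0 b1 b2 b3) z) w y = 0"
  shows "Hs kap i j (fst z0) = 5 / 2 * fd kap i (fst z0) * fd kap j (fst z0) / kp z0
     - (if i = j then 2 * kp z0 ^ 3 else 0)"
proof -
  interpret dp: derivation_pair "S \<inter> N" "der N"
    by (rule derivation_pair_der[OF N])
  define AA where "AA z = a0 z + \<i> * kp z * a3 z" for z
  define BB where "BB z = b0 z + \<i> * kp z * b3 z" for z
  let ?k = "\<lambda>z. complex_of_real (kp z)"
  have sys: "z \<in> S \<inter> N \<Longrightarrow> z \<in> S" for z by simp
  have FO: "of_real (kd 1 z) = 2 * AA z * kp z" "of_real (kd 2 z) = 2 * BB z * kp z"
    "cx (a0' z) (V1 z, W1 z) = AA z * a0 z + \<i> * kp z * a2 z" "cx (a0' z) (V2 z, W2 z) = AA z * b0 z - \<i> * kp z * a1 z"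
    "cx (a1' z) (V1 z, W1 z) = AA z * a1 z" "cx (a1' z) (V2 z, W2 z) = AA z * b1 z + \<i> * kp z * a0 z"
    "cx (a2' z) (V1 z, W1 z) = AA z * a2 z - \<i> * kp z * a0 z" "cx (a2' z) (V2 z, W2 z) = AA z * b2 z"
    "cx (a3' z) (V1 z, W1 z) = AA z * a3 z + a2 z + \<i> * kp z" "cx (a3' z) (V2 z, W2 z) = AA z * b3 z - a1 z"
    "cx (b0' z) (V1 z, W1 z) = BB z * a0 z + \<i> * kp z * b2 z" "cx (b0' z) (V2 z, W2 z) = BB z * b0 z - \<i> * kp z * b1 z"
    "cx (b1' z) (V1 z, W1 z) = BB z * a1 z" "cx (b1' z) (V2 z, W2 z) = BB z * b1 z + \<i> * kp z * b0 z"
    "cx (b2' z) (V1 z, W1 z) = BB z * a2 z - \<i> * kp z * b0 z" "cx (b2' z) (V2 z, W2 z) = BB z * b2 z"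
    "cx (b3' z) (V1 z, W1 z) = BB z * a3 z + b2 z" "cx (b3' z) (V2 z, W2 z) = BB z * b3 z - b1 z + \<i> * kp z"
    if "z \<in> S \<inter> N" for z
    unfolding AA_def BB_def
    by (rule first_order_system[OF sys[OF that] diff(1)[OF that] diff(2)[OF that] diff(3)[OF that] diff(4)[OF that]
      diff(5)[OF that] diff(6)[OF that] diff(7)[OF that] diff(8)[OF that]]; rule zero[OF that]; assumption)+
  note kd1 = FO(1) and kd2 = FO(2)
  have k0: "?k z \<noteq> 0" if "z \<in> S \<inter> N" for z
    using kap_pos[OF frame_patchD(1)[OF SD(1)[OF sys[OF that]]]] by simp
  have dk: "der N ?k (\<lambda>z. 2 * AA z * ?k z) (\<lambda>z. 2 * BB z * ?k z)"
  proof (rule derI)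
    fix z assume z: "z \<in> S \<inter> N"
    note bd = base_derivative[OF sys[OF z] smooth_kap]
    show "(?k has_derivative (\<lambda>u. of_real (frechet_derivative kap (at (fst (fst z))) (fst (fst u))))) (at z)"
      by (rule bounded_linear.has_derivative[OF bounded_linear_of_real bd(1)])
    show "cx (\<lambda>u. of_real (frechet_derivative kap (at (fst (fst z))) (fst (fst u)))) (V1 z, W1 z) = 2 * AA z * ?k z"
      "cx (\<lambda>u. of_real (frechet_derivative kap (at (fst (fst z))) (fst (fst u)))) (V2 z, W2 z) = 2 * BB z * ?k z"
      using sys[OF z] unfolding kd1[OF z, symmetric] kd2[OF z, symmetric] bd(2)
      by (simp_all add: cx_def V1_def V2_def W1_def W2_def kd_def axis_def)
  qed
  \<comment> \<open>The two directions have no component along \<open>al\<close>, so the connection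
    term in the differential of kd drops out.\<close>
  have dkd: "der N (\<lambda>z. of_real (kd i z)) (\<lambda>z. of_real (Hs kap i 1 (fst z))) (\<lambda>z. of_real (Hs kap i 2 (fst z)))" for i
    unfolding der_def
  proof
    fix z assume z: "z \<in> S \<inter> N"
    obtain D where D: "(kd i has_derivative D) (at z)"
      "\<And>v. v \<in> tangent_space S z \<Longrightarrow> D v = (if i = 1 then - kd 2 z * al z v else kd 1 z * al z v)
       + Hs kap i 1 (fst z) * e1 z v + Hs kap i 2 (fst z) * e2 z v"
      using kd_derivative[OF sys[OF z]] by blast
    note tc = tangentC_fields(1,2)[OF sys[OF z], unfolded tangentC_def fst_conv snd_conv]
    show "\<exists>f'. ((\<lambda>z. complex_of_real (kd i z)) has_derivative f') (at z) \<and> cx f' (V1 z, W1 z) = of_real (Hs kap i 1 (fst z)) \<and>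
         cx f' (V2 z, W2 z) = of_real (Hs kap i 2 (fst z))"
      using bounded_linear.has_derivative[OF bounded_linear_of_real D(1)] tc sys[OF z]
      by (intro exI[of _ "\<lambda>u. of_real (D u)"])
        (auto simp: cx_def D(2), simp_all add: V1_def V2_def W1_def W2_def axis_def)
  qed
  have h12: "Hs kap 1 2 (fst z) = Hs kap 2 1 (fst z)" if "z \<in> S \<inter> N" for z
    by (rule Hs_sym[OF smooth_kap frame_patchD(1)[OF SD(1)[OF sys[OF that]]]])
  have ukd: "of_real (Hs kap 1 1 (fst z)) = 2 * (2 * AA z * ?k z) * AA z + 2 * ?k z * A1 z"
      "of_real (Hs kap 1 2 (fst z)) = 2 * (2 * BB z * ?k z) * AA z + 2 * ?k z * A2 z"
    if dA: "der N AA A1 A2" and z: "z \<in> S \<inter> N" for z A1 A2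
  proof -
    have "der N (\<lambda>z. 2 * ?k z * AA z) (\<lambda>z. (0 * ?k z + 2 * (2 * AA z * ?k z)) * AA z + 2 * ?k z * A1 z)
      (\<lambda>z. (0 * ?k z + 2 * (2 * BB z * ?k z)) * AA z + 2 * ?k z * A2 z)"
      by (intro dp.der_mult dp.der_const dk dA)
    from dp.der_unique[OF dkd this _ z, of 1]
    show "of_real (Hs kap 1 1 (fst z)) = 2 * (2 * AA z * ?k z) * AA z + 2 * ?k z * A1 z"
      "of_real (Hs kap 1 2 (fst z)) = 2 * (2 * BB z * ?k z) * AA z + 2 * ?k z * A2 z"
      using kd1 by auto
  qed
  have ukd2: "of_real (Hs kap 2 1 (fst z)) = 2 * (2 * AA z * ?k z) * BB z + 2 * ?k z * B1 z"
      "of_real (Hs kap 2 2 (fst z)) = 2 * (2 * BB z * ?k z) * BB z + 2 * ?k z * B2 z"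
    if dB: "der N BB B1 B2" and z: "z \<in> S \<inter> N" for z B1 B2
  proof -
    have "der N (\<lambda>z. 2 * ?k z * BB z) (\<lambda>z. (0 * ?k z + 2 * (2 * AA z * ?k z)) * BB z + 2 * ?k z * B1 z)
      (\<lambda>z. (0 * ?k z + 2 * (2 * BB z * ?k z)) * BB z + 2 * ?k z * B2 z)"
      by (intro dp.der_mult dp.der_const dk dB)
    from dp.der_unique[OF dkd this _ z, of 2]
    show "of_real (Hs kap 2 1 (fst z)) = 2 * (2 * AA z * ?k z) * BB z + 2 * ?k z * B1 z"
      "of_real (Hs kap 2 2 (fst z)) = 2 * (2 * BB z * ?k z) * BB z + 2 * ?k z * B2 z"
      using kd2 by auto
  qed
  have hess: "A2 z = B1 z" if "der N AA A1 A2" "der N BB B1 B2" "z \<in> S \<inter> N" for A1 A2 B1 B2 z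
    using ukd(2)[OF that(1,3)] ukd2(1)[OF that(2,3)] h12[OF that(3)] k0[OF that(3)] by (simp add: algebra_simps)
  have da0: "der N a0 (\<lambda>z. AA z * a0 z + \<i> * kp z * a2 z) (\<lambda>z. AA z * b0 z - \<i> * kp z * a1 z)"
    and da1: "der N a1 (\<lambda>z. AA z * a1 z) (\<lambda>z. AA z * b1 z + \<i> * kp z * a0 z)"
    and da2: "der N a2 (\<lambda>z. AA z * a2 z - \<i> * kp z * a0 z) (\<lambda>z. AA z * b2 z)"
    and da3: "der N a3 (\<lambda>z. AA z * a3 z + a2 z + \<i> * kp z) (\<lambda>z. AA z * b3 z - a1 z)"
    and db0: "der N b0 (\<lambda>z. BB z * a0 z + \<i> * kp z * b2 z) (\<lambda>z. BB z * b0 z - \<i> * kp z * b1 z)"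
    and db1: "der N b1 (\<lambda>z. BB z * a1 z) (\<lambda>z. BB z * b1 z + \<i> * kp z * b0 z)"
    and db2: "der N b2 (\<lambda>z. BB z * a2 z - \<i> * kp z * b0 z) (\<lambda>z. BB z * b2 z)"
    and db3: "der N b3 (\<lambda>z. BB z * a3 z + b2 z) (\<lambda>z. BB z * b3 z - b1 z + \<i> * kp z)"
    by (rule derI, erule diff; erule FO)+
  have sol: "der N AA (\<lambda>z. 3 * AA z * AA z - ?k z * ?k z) (\<lambda>z. 3 * AA z * BB z)"
    "der N BB (\<lambda>z. 3 * AA z * BB z) (\<lambda>z. 3 * BB z * BB z - ?k z * ?k z)"
    by (rule dp.prolongation[where k = ?k and A = AA and B = BB and ?a0.0 = a0 and ?a1.0 = a1 and ?a2.0 = a2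
      and ?a3.0 = a3 and ?b0.0 = b0 and ?b1.0 = b1 and ?b2.0 = b2 and ?b3.0 = b3];
      (rule k0 AA_def BB_def dk da0 da1 da2 da3 db0 db1 db2 db3 | erule (2) hess); assumption?)+
  have k0': "kp z0 \<noteq> 0" "kp z0 > 0" using kap_pos[OF frame_patchD(1)[OF SD(1)[OF sys[OF z0]]]] by simp_all
  \<comment> \<open>AA and BB are real at z0 by their relation to dk, so the complex equations
    descend to real ones.\<close>
  define p where "p = kd 1 z0 / (2 * kp z0)"
  define q where "q = kd 2 z0 / (2 * kp z0)"
  have A: "AA z0 = of_real p" "BB z0 = of_real q"
    using kd1[OF z0] kd2[OF z0] k0' by (simp_all add: p_def q_def field_simps)
  have "complex_of_real (Hs kap 1 1 (fst z0)) = of_real (2 * (2 * p * kp z0) * p + 2 * kp z0 * (3 * p * p - kp z0 * kp z0))"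
    "complex_of_real (Hs kap 1 2 (fst z0)) = of_real (2 * (2 * q * kp z0) * p + 2 * kp z0 * (3 * p * q))"
    "complex_of_real (Hs kap 2 1 (fst z0)) = of_real (2 * (2 * p * kp z0) * q + 2 * kp z0 * (3 * p * q))"
    "complex_of_real (Hs kap 2 2 (fst z0)) = of_real (2 * (2 * q * kp z0) * q + 2 * kp z0 * (3 * q * q - kp z0 * kp z0))"
    using ukd[OF sol(1) z0] ukd2[OF sol(2) z0] by (simp_all add: A)
  note H = this[unfolded of_real_eq_iff]
  show ?thesis
    using exhaust_2[of i] exhaust_2[of j] k0'
    by (auto simp: H p_def q_def kd_fd field_simps power3_eq_cube)
qed

end

section \<open>Normalising a given Frobenius subbundle\<close>

lemma sum_lessThan_two:
  fixes h :: "nat \<Rightarrow> 'b::comm_ring_1"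
  assumes "2 \<le> n"
  shows "(\<Sum>i<n. (if i = 0 then x else if i = 1 then y else 0) * h i) = x * h 0 + y * h 1"
proof -
  obtain m where "n = Suc (Suc m)" using assms by (metis Suc_le_D numeral_2_eq_2 Suc_le_mono)
  then show ?thesis by (simp add: sum.lessThan_Suc_shift del: sum.lessThan_Suc)
qed

lemma kernel_2x2:
  fixes a b c d :: "'a::field"
  assumes "a * d - b * c = 0"
  shows "\<exists>x y. (x \<noteq> 0 \<or> y \<noteq> 0) \<and> x * a + y * c = 0 \<and> x * b + y * d = 0"
proof (cases "a = 0 \<and> c = 0")
  case True
  show ?thesis
  proof (cases "b = 0 \<and> d = 0")
    case True
    then show ?thesis using \<open>a = 0 \<and> c = 0\<close> by (intro exI[of _ 1] exI[of _ 0]) simp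
  next
    case False
    then show ?thesis using \<open>a = 0 \<and> c = 0\<close> by (intro exI[of _ d] exI[of _ "- b"]) (auto simp: algebra_simps)
  qed
next
  case False
  then show ?thesis using assms by (intro exI[of _ c] exI[of _ "- a"]) (auto simp: algebra_simps)
qed

context curved_chart
begin

text \<open>Near z0 the given frame of F is exchanged for the normalised forms P1 and P2, to which
  \<open>hessian_from_system\<close> applies.\<close>

lemma necessity:
  assumes z0: "z0 \<in> S" "z0 \<in> V" and V: "open V"
    and fr: "subbundle_frame S V F" and len: "2 \<le> length F" and frob: "frobenius S V F"
    and sub: "\<And>z. z \<in> S \<inter> V \<Longrightarrow> cspan_at S F z \<subseteq> cspan_at S (singular_forms A g K c) z"
    and trans: "\<And>z \<phi> v. z \<in> S \<inter> V \<Longrightarrow> \<phi> \<in> cspan_at S F z \<Longrightarrow> \<phi> \<in> cspan_at S (embedding_forms A g c) z \<Longrightarrow>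
      v \<in> tangent_space S z \<Longrightarrow> \<phi> v = 0"
  shows "Hs kap i j (fst z0) = 5 / 2 * fd kap i (fst z0) * fd kap j (fst z0) / kp z0
     - (if i = j then 2 * kp z0 ^ 3 else 0)"
proof -
  define f where "f l = F ! l" for l
  have smf: "smooth_cform V (f l)" if "l < length F" for l
    using fr that by (auto simp: subbundle_frame_def f_def)
  have linf: "linear (f l z)" if "l < length F" "z \<in> V" for l z
    using smf[OF that(1)] that(2) by (simp add: smooth_cform_def)
  have mem: "f l z \<in> cspan_at S F z" if "l < length F" "z \<in> V" for l z
    using cspan_at_nth[of l F z S] linf[OF that] that by (simp add: f_def)
  have vanish: "\<phi> v = 0"
    if z: "z \<in> S \<inter> V" and \<phi>: "\<phi> \<in> cspan_at S F z" "\<phi> (H1 z) = 0" "\<phi> (H2 z) = 0" and v: "v \<in> tangent_space S z" for z \<phi> v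
    using trans[OF z \<phi>(1) embedding_span v] z sub[OF z] \<phi> by blast
  have l01: "0 < length F" "1 < length F" using len by auto
  define m where "m l z = f l z (H1 z)" for l z
  define n where "n l z = f l z (H2 z)" for l z
  \<comment> \<open>If this determinant vanished, a nontrivial combination of the first two members
    of F would kill H1 and H2, hence be zero by transversality, against independence.\<close>
  define dt where "dt z = m 0 z * n 1 z - n 0 z * m 1 z" for z
  have dt: "dt z \<noteq> 0" if z: "z \<in> S \<inter> V" for z
  proof
    assume "dt z = 0"
    then obtain x y where xy: "x \<noteq> 0 \<or> y \<noteq> 0" "x * m 0 z + y * m 1 z = 0" "x * n 0 z + y * n 1 z = 0"
      using kernel_2x2[of "m 0 z" "n 1 z" "n 0 z" "m 1 z"] unfolding dt_def by blast
    have zV: "z \<in> V" using z by simp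
    have "(\<lambda>v. x * f 0 z v + y * f 1 z v) \<in> cspan_at S F z"
      by (rule cspan_at_lincomb[OF mem[OF l01(1) zV] mem[OF l01(2) zV]])
    from vanish[OF z this] have "x * f 0 z v + y * f 1 z v = 0" if "v \<in> tangent_space S z" for v
      using xy that by (simp add: m_def n_def)
    then have "\<forall>v\<in>tangent_space S z. (\<Sum>i<length F. (if i = 0 then x else if i = 1 then y else 0) * (F ! i) z v) = 0"
      unfolding sum_lessThan_two[OF len] by (simp add: f_def)
    moreover have "cindep_at S F z"
      using fr z by (simp add: subbundle_frame_def)
    ultimately have "\<forall>i<length F. (if i = 0 then x else if i = 1 then y else 0) = 0"
      unfolding cindep_at_def by (elim allE[of _ "\<lambda>i. if i = 0 then x else if i = 1 then y else 0"]) simp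
    then show False
      using xy(1) l01 by (metis zero_neq_one)
  qed
  define V' where "V' = V \<inter> Dom"
  have V': "open V'" "V' \<subseteq> V" "V' \<subseteq> Dom" using V open_Dom by (auto simp: V'_def)
  have smf': "smooth_cform V' (f l)" if "l < length F" for l
    using smf[OF that] V'(2) unfolding smooth_cform_def by (meson smooth_on_subset subsetD)
  note smY = smooth_fields[THEN smooth_on_subset[OF _ V'(3)]]
  have smm: "smooth_on V' (m l)" and smn: "smooth_on V' (n l)" if "l < length F" for l
    unfolding m_def[abs_def] n_def[abs_def] by (rule smooth_form_apply[OF V'(1) smf'[OF that]], rule smY)+
  have smdt: "smooth_on V' dt"
    unfolding dt_def[abs_def] by (intro smooth_on_diff smooth_on_mult V'(1) smm smn l01)
  \<comment> \<open>\<open>dt\<close> is known to be nonzero on \<open>S\<close>, but the quotients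
    below must be smooth on an open set of the ambient space.\<close>
  define N where "N = V' \<inter> dt -` (- {0})"
  have N: "open N" "N \<subseteq> V'"
    unfolding N_def using continuous_open_preimage[OF smooth_on_imp_continuous_on[OF smdt] V'(1), of "- {0}"] by auto
  have NV: "N \<subseteq> V" "N \<subseteq> Dom" using N(2) V' by auto
  have dtN: "z \<in> N \<Longrightarrow> dt z \<noteq> 0" for z by (simp add: N_def)
  have zN: "z0 \<in> S \<inter> N"
    using z0 dt[of z0] SD(3)[OF z0(1)] by (simp add: N_def V'_def)
  \<comment> \<open>Cramer's rule for the combinations of the first two members with values 1, 0 and
    0, 1 on H1, H2.\<close>
  define a where "a Y z = (n 1 z * f 0 z (Y z) - n 0 z * f 1 z (Y z)) / dt z" for Y :: "coords \<Rightarrow> coords" and z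
  define b where "b Y z = (m 0 z * f 1 z (Y z) - m 1 z * f 0 z (Y z)) / dt z" for Y :: "coords \<Rightarrow> coords" and z
  have sma: "smooth_on N (a Y)" and smb: "smooth_on N (b Y)" if Y: "smooth_on Dom Y" for Y
  proof -
    have fY: "smooth_on N (\<lambda>z. f l z (Y z))" if "l < length F" for l
      by (rule smooth_on_subset[OF smooth_form_apply[OF V'(1) smf'[OF that] smooth_on_subset[OF Y V'(3)]] N(2)])
    show "smooth_on N (a Y)" "smooth_on N (b Y)"
      unfolding a_def[abs_def] b_def[abs_def]
      by (intro smooth_on_divide smooth_on_diff smooth_on_mult N(1) fY l01 dtN
        smm[THEN smooth_on_subset[OF _ N(2)]] smn[THEN smooth_on_subset[OF _ N(2)]] smdt[THEN smooth_on_subset[OF _ N(2)]]; assumption)+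
  qed
  define P1 where "P1 = ph s1 (a T0) (a T1) (a T2) (a T3)"
  define P2 where "P2 = ph s2 (b T0) (b T1) (b T2) (b T3)"
  have P: "P1 z v = n 1 z / dt z * f 0 z v + - n 0 z / dt z * f 1 z v"
    "P2 z v = - m 1 z / dt z * f 0 z v + m 0 z / dt z * f 1 z v" if z: "z \<in> S \<inter> N" and v: "v \<in> tangent_space S z" for z v
  proof -
    have zS: "z \<in> S" "z \<in> V" "z \<in> S \<inter> V" "dt z \<noteq> 0" using z NV dtN by auto
    have e: "f l z v = f l z (T0 z) * th0 z v + f l z (T1 z) * th1 z v + f l z (T2 z) * th2 z v + f l z (T3 z) * th3 z v
      + m l z * s1 z v + n l z * s2 z v" if "l < length F" for l
      unfolding m_def n_def using singular_expand[OF zS(1) _ v] mem[OF that zS(2)] sub[OF zS(3)] by blast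
    show "P1 z v = n 1 z / dt z * f 0 z v + - n 0 z / dt z * f 1 z v"
      unfolding e[OF l01(1)] e[OF l01(2)] P1_def ph_def a_def
      using zS(4) by (simp add: divide_simps) (simp add: dt_def algebra_simps)
    show "P2 z v = - m 1 z / dt z * f 0 z v + m 0 z / dt z * f 1 z v"
      unfolding e[OF l01(1)] e[OF l01(2)] P2_def ph_def b_def
      using zS(4) by (simp add: divide_simps) (simp add: dt_def algebra_simps)
  qed
  have smP: "smooth_cform N P1" "smooth_cform N P2"
    unfolding P1_def P2_def by (rule smooth_cform_ph[OF N(1) NV(2)]; (simp; fail | intro sma smb smooth_fields))+
  have inF: "P1 z \<in> cspan_at S F z" "P2 z \<in> cspan_at S F z" if z: "z \<in> S \<inter> N" for z
  proof -
    have zV: "z \<in> V" and zN: "z \<in> N" using z NV by auto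
    have "linear (P1 z)" "linear (P2 z)" using smP zN by (auto simp: smooth_cform_def)
    then show "P1 z \<in> cspan_at S F z" "P2 z \<in> cspan_at S F z"
      by (auto intro: cspan_at_cong[OF cspan_at_lincomb[OF mem[OF l01(1) zV] mem[OF l01(2) zV]]] P[OF z])
  qed
  have frobP: "ext_deriv_congruent_0 S F P1 z" "ext_deriv_congruent_0 S F P2 z" if z: "z \<in> S \<inter> N" for z
    using frob smP inF z N NV unfolding frobenius_def section_of_def by blast+
  have PH: "P1 z (H1 z) = 1" "P1 z (H2 z) = 0" "P2 z (H1 z) = 0" "P2 z (H2 z) = 1" if z: "z \<in> S \<inter> N" for z
    using z by (auto simp: P1_def P2_def ph_def form_defs coframe_fields)
  \<comment> \<open>The difference of the two sides lies in F and kills H1 and H2, so it vanishes by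
    transversality. Hence vectors annihilated by P1 and P2 are annihilated by all members of
    F.\<close>
  have fP: "f l z v = m l z * P1 z v + n l z * P2 z v"
    if z: "z \<in> S \<inter> N" and l: "l < length F" and v: "v \<in> tangent_space S z" for l z v
  proof -
    have zV: "z \<in> V" "z \<in> S \<inter> V" using z NV by auto
    have "(\<lambda>v. 1 * f l z v + -1 * (m l z * P1 z v + n l z * P2 z v)) \<in> cspan_at S F z"
      by (intro cspan_at_lincomb mem[OF l zV(1)] inF[OF z])
    from vanish[OF zV(2) this _ _ v] have "1 * f l z v + -1 * (m l z * P1 z v + n l z * P2 z v) = 0"
      by (simp add: PH[OF z] m_def n_def)
    then show ?thesis by algebra
  qed
  note has = sma[THEN smooth_on_has_derivative] smb[THEN smooth_on_has_derivative]
  have zN': "z \<in> N" if "z \<in> S \<inter> N" for z using that by simp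
  show ?thesis
  proof (rule hessian_from_system[OF N(1) zN, of "a T0" _ "a T1" _ "a T2" _ "a T3" _ "b T0" _ "b T1" _ "b T2" _ "b T3"])
    fix z w y
    assume z: "z \<in> S \<inter> N" and w: "tangentC z w" and y: "tangentC z y"
      and kill: "cx (ph s1 (a T0) (a T1) (a T2) (a T3) z) w = 0" "cx (ph s2 (b T0) (b T1) (b T2) (b T3) z) w = 0"
        "cx (ph s1 (a T0) (a T1) (a T2) (a T3) z) y = 0" "cx (ph s2 (b T0) (b T1) (b T2) (b T3) z) y = 0"
    have fx: "cx (f l z) w = 0" "cx (f l z) y = 0" if l: "l < length F" for l
    proof -
      have "cx (f l z) x = m l z * cx (P1 z) x + n l z * cx (P2 z) x" if "tangentC z x" for x
        using fP[OF z l] that by (simp add: cx_def tangentC_def algebra_simps)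
      then show "cx (f l z) w = 0" "cx (f l z) y = 0"
        using kill w y by (simp_all add: P1_def P2_def)
    qed
    have *: "cx2 (ext_d Q z) w y = 0" if Q: "ext_deriv_congruent_0 S F Q z" for Q
    proof -
      obtain \<beta> where \<beta>: "\<And>u v. u \<in> tangent_space S z \<Longrightarrow> v \<in> tangent_space S z \<Longrightarrow>
          ext_d Q z u v = (\<Sum>i<length F. \<beta> i u * f i z v - \<beta> i v * f i z u)"
        using Q unfolding ext_deriv_congruent_0_def ext_deriv_eq f_def by blast
      have "cx2 (ext_d Q z) w y = cx2 (\<lambda>u v. \<Sum>i<length F. \<beta> i u * f i z v - \<beta> i v * f i z u) w y"
        by (rule cx2_cong[of "tangent_space S z"]) (use \<beta> w y in \<open>auto simp: tangentC_def\<close>)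
      then show ?thesis
        using cx2_wedge_zero[of "length F" "\<lambda>i. f i z" w y \<beta>] fx by simp
    qed
    show "cx2 (ext_d (ph s1 (a T0) (a T1) (a T2) (a T3)) z) w y = 0 \<and>
       cx2 (ext_d (ph s2 (b T0) (b T1) (b T2) (b T3)) z) w y = 0"
      using *[OF frobP(1)[OF z]] *[OF frobP(2)[OF z]] by (simp add: P1_def P2_def)
  qed (rule has smooth_fields zN' | assumption)+
qed

end

section \<open>The covariant derivatives of q\<close>

lemma has_differential_on_eq:
  assumes f: "has_differential_on f L S P" and h: "(h has_derivative h') (at P)"
    and eq: "\<And>Q. Q \<in> S \<Longrightarrow> f Q = h Q" and v: "v \<in> tangent_space S P"
  shows "L v = h' v"
proof -
  obtain \<gamma> where \<gamma>: "curve_in S P v \<gamma>" using v unfolding tangent_space_def by blast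
  then have g: "(\<gamma> has_derivative (\<lambda>t. t *\<^sub>R v)) (at 0)" "\<gamma> 0 = P" "\<And>t. \<gamma> t \<in> S"
    by (auto simp: curve_in_def has_vector_derivative_def)
  have "((\<lambda>t. f (\<gamma> t)) has_derivative (\<lambda>t. L v * t)) (at 0)"
    using f \<gamma> unfolding has_differential_on_def has_field_derivative_def by blast
  then have 1: "((\<lambda>t. h (\<gamma> t)) has_derivative (\<lambda>t. L v * t)) (at 0)"
    using eq g(3) by simp
  have "((\<lambda>t. h (\<gamma> t)) has_derivative (\<lambda>t. h' (t *\<^sub>R v))) (at 0)"
    using has_derivative_compose[OF g(1)] h g(2) by auto
  from has_derivative_unique[OF 1 this] have "L v * 1 = h' (1 *\<^sub>R v)"
    by (rule fun_cong)
  then show ?thesis by simp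
qed

context surface_chart
begin

lemma covariant_derivatives_eq:
  assumes cov: "covariant_derivatives X A g q q1 q2" and f: "smooth_on U f"
    and q: "\<And>P. P \<in> frames_over X A g c \<Longrightarrow> q P = f (snd c (fst P))"
    and P: "P \<in> frames_over X A g c"
  shows "q2 i j P = Hs f i j (frame_coords c P)"
proof -
  have FPD: "frame_coords c P \<in> FP" if "P \<in> frames_over X A g c" for P
    by (rule frame_coords_in[OF that])
  have field: "surf_field z r \<in> tangent_space FP z" if "z \<in> FP" for z r
    unfolding surf_tangent[OF that] using surf_field_skew[OF that] by simp
  have 1: "q1 i P = fd f i (frame_coords c P)" if P: "P \<in> frames_over X A g c" for i P
  proof -
    let ?z = "frame_coords c P"
    note z = FPD[OF P]
    \<comment> \<open>The horizontal lift of the i-th frame vector, on which the connection form is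
      0; it isolates a single coefficient.\<close>
    let ?v = "surf_field ?z (axis i 1, 0)"
    have "has_differential_on (q \<circ> frame_at X A g c) (\<lambda>v. \<Sum>j\<in>UNIV. q1 j P * et j ?z v) FP ?z"
      using cov chart P unfolding covariant_derivatives_def by blast
    moreover have "((\<lambda>z. f (fst z)) has_derivative (\<lambda>v. frechet_derivative f (at (fst ?z)) (fst v))) (at ?z)"
      by (rule has_derivative_compose[OF bounded_linear_imp_has_derivative[OF bounded_linear_fst]
          smooth_on_has_derivative[OF f frame_patchD(1)[OF z]]])
    moreover have "(q \<circ> frame_at X A g c) w = f (fst w)" if "w \<in> FP" for w
      using q[OF frame_at_in(1)[OF that]] frame_at_base[OF that] chart_chart_inv[OF frame_patchD(1)[OF that]] by simp
    ultimately have "(\<Sum>j\<in>UNIV. q1 j P * et j ?z ?v) = frechet_derivative f (at (fst ?z)) (fst ?v)"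
      using field[OF z] by (rule has_differential_on_eq)
    moreover have "fst ?v = snd ?z $ i"
      using exhaust_2[of i] by (auto simp: surf_field_def Let_def sum_2 axis_def)
    ultimately show ?thesis
      using exhaust_2[of i] by (auto simp: eta_surf_field[OF z] sum_2 axis_def fd_def)
  qed
  let ?z = "frame_coords c P"
  note z = FPD[OF P]
  let ?v = "surf_field ?z (axis j 1, 0)"
  have skew: "\<forall>i j. cn i j ?z ?v + cn j i ?z ?v = 0" using surf_field_skew[OF z] by blast
  have d: "has_differential_on (q1 i \<circ> frame_at X A g c)
     (\<lambda>v. (\<Sum>j\<in>UNIV. q1 j P * cn j i ?z v) + (\<Sum>j\<in>UNIV. q2 i j P * et j ?z v)) FP ?z"
    using cov chart P unfolding covariant_derivatives_def by blast
  have e: "(q1 i \<circ> frame_at X A g c) w = fd f i w" if "w \<in> FP" for w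
    using 1[OF frame_at_in(1)[OF that]] frame_at_in(2)[OF that] by simp
  have "(\<Sum>j\<in>UNIV. q1 j P * cn j i ?z ?v) + (\<Sum>j\<in>UNIV. q2 i j P * et j ?z ?v) =
     frechet_derivative (\<lambda>y. frechet_derivative f (at y) (snd ?z $ i)) (at (fst ?z)) (fst ?v)
      + frechet_derivative f (at (fst ?z)) (snd ?v $ i)"
    by (rule has_differential_on_eq[OF d fd_has_derivative[OF f frame_patchD(1)[OF z]] e field[OF z]])
  then show ?thesis
    unfolding fd_tangent[OF f z skew] using 1[OF P] exhaust_2[of j]
    by (auto simp: eta_surf_field[OF z] sum_2 axis_def)
qed

end

context curved_chart
begin

section \<open>Powers of k and the equation for q\<close>

lemma smooth_kap_powr: "smooth_on U (\<lambda>x. kap x powr a)"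
  by (rule smooth_on_powr[OF open_image smooth_kap kap_pos])

lemma fd_kap_powr:
  assumes "fst P \<in> U"
  shows "fd (\<lambda>x. kap x powr a) i P = a * kap (fst P) powr (a - 1) * fd kap i P"
proof -
  have "((\<lambda>x. kap x powr a) has_derivative (\<lambda>h. a * kap (fst P) powr (a - 1) * frechet_derivative kap (at (fst P)) h)) (at (fst P))"
    by (rule has_derivative_eq_rhs[OF has_derivative_powr[OF smooth_on_has_derivative[OF smooth_kap assms] has_derivative_const kap_pos[OF assms]]])
      (use kap_pos[OF assms] in \<open>auto simp: powr_diff field_simps\<close>)
  from fun_cong[OF frechet_derivative_at[OF this]] show ?thesis
    by (simp add: fd_def)
qed

text \<open>Differentiate \<open>fd_kap_powr\<close> along the horizontal lift of the j-th frame
  vector, on which the connection terms vanish.\<close>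

lemma Hs_kap_powr:
  assumes P: "P \<in> FP"
  shows "Hs (\<lambda>x. kap x powr a) i j P =
    a * (a - 1) * kap (fst P) powr (a - 2) * fd kap i P * fd kap j P + a * kap (fst P) powr (a - 1) * Hs kap i j P"
proof -
  note UP = frame_patchD(1)[OF P]
  let ?v = "surf_field P (axis j 1, 0)"
  have skew: "\<forall>i j. cn i j P ?v + cn j i P ?v = 0" using surf_field_skew[OF P] by blast
  have ev: "(\<Sum>l\<in>UNIV. fd f l P * cn l i P ?v) + (\<Sum>l\<in>UNIV. Hs f i l P * et l P ?v) = Hs f i j P" for f
    using exhaust_2[of i] exhaust_2[of j] by (auto simp: eta_surf_field[OF P] sum_2 axis_def)
  have vx: "fst ?v = snd P $ j"
    using exhaust_2[of j] by (auto simp: surf_field_def Let_def sum_2 axis_def)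
  let ?D = "\<lambda>f v. frechet_derivative (\<lambda>y. frechet_derivative f (at y) (snd P $ i)) (at (fst P)) (fst v)
      + frechet_derivative f (at (fst P)) (snd v $ i)"
  let ?b = "\<lambda>Q. a * kap (fst Q) powr (a - 1)"
  have b: "(?b has_derivative (\<lambda>v. a * frechet_derivative (\<lambda>x. kap x powr (a - 1)) (at (fst P)) (fst v))) (at P)"
    by (intro has_derivative_mult_right has_derivative_compose[OF bounded_linear_imp_has_derivative[OF bounded_linear_fst]
      smooth_on_has_derivative[OF smooth_kap_powr UP]])
  have "open (fst -` U :: surf_coords set)"
    using open_image by (auto intro!: open_vimage continuous_intros)
  then have "(fd (\<lambda>x. kap x powr a) i has_derivative
     (\<lambda>v. ?b P * ?D kap v + a * frechet_derivative (\<lambda>x. kap x powr (a - 1)) (at (fst P)) (fst v) * fd kap i P)) (at P)"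
    by (rule has_derivative_transform_within_open[OF has_derivative_mult[OF b fd_has_derivative[OF smooth_kap UP]]])
      (simp_all add: UP fd_kap_powr)
  from fun_cong[OF has_derivative_unique[OF fd_has_derivative[OF smooth_kap_powr UP] this], of ?v]
  have "Hs (\<lambda>x. kap x powr a) i j P = ?b P * Hs kap i j P + a * fd (\<lambda>x. kap x powr (a - 1)) j P * fd kap i P"
    unfolding fd_tangent[OF smooth_kap_powr P skew] fd_tangent[OF smooth_kap P skew] ev
    by (simp only: vx fd_def)
  then show ?thesis
    by (simp add: fd_kap_powr[OF UP] algebra_simps)
qed

lemma equation_for_kap:
  assumes P: "P \<in> FP"
  shows "Hs (\<lambda>x. kap x powr (-3/2)) i j P = (if i = j then 3 * (kap (fst P) powr (-3/2)) powr (-1/3) else 0) \<longleftrightarrow>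
    Hs kap i j P = 5 / 2 * fd kap i P * fd kap j P / kap (fst P) - (if i = j then 2 * kap (fst P) ^ 3 else 0)"
proof -
  define k where "k = kap (fst P)"
  have k: "k > 0" using kap_pos[OF frame_patchD(1)[OF P]] by (simp add: k_def)
  \<comment> \<open>The common factor: k^(-5/2) = w k and k^(1/2) = w k^4. Being positive it
    cancels, which leaves integer powers of k.\<close>
  define w where "w = k powr (-7/2)"
  have w: "w > 0" using k by (simp add: w_def)
  have e1: "k powr (-5/2) = w * k"
    using powr_add[of k "-7/2" 1] k by (simp add: w_def)
  have "k powr (1/2) = k powr (-7/2) * k powr 4"
    by (simp add: powr_add[symmetric])
  then have e2: "(k powr (-3/2)) powr (-1/3) = w * k ^ 4"
    using k by (simp add: powr_powr w_def powr_numeral)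
  have "Hs (\<lambda>x. kap x powr (-3/2)) i j P = (-3/2) * (-3/2 - 1) * k powr (-3/2 - 2) * fd kap i P * fd kap j P
     + (-3/2) * k powr (-3/2 - 1) * Hs kap i j P"
    unfolding Hs_kap_powr[OF P] k_def ..
  also have "\<dots> = (-3/2) * (-3/2 - 1) * w * fd kap i P * fd kap j P + (-3/2) * (w * k) * Hs kap i j P"
    using e1 by (simp add: w_def)
  also have "\<dots> = w * (15/4 * fd kap i P * fd kap j P - 3/2 * k * Hs kap i j P)"
    by (simp add: algebra_simps)
  finally have H: "Hs (\<lambda>x. kap x powr (-3/2)) i j P = w * (15/4 * fd kap i P * fd kap j P - 3/2 * k * Hs kap i j P)" .
  have "Hs (\<lambda>x. kap x powr (-3/2)) i j P = (if i = j then 3 * (kap (fst P) powr (-3/2)) powr (-1/3) else 0) \<longleftrightarrow>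
    w * (15/4 * fd kap i P * fd kap j P - 3/2 * k * Hs kap i j P) = w * (if i = j then 3 * k ^ 4 else 0)"
    unfolding H k_def[symmetric] e2 by simp
  also have "\<dots> \<longleftrightarrow> 15/4 * fd kap i P * fd kap j P - 3/2 * k * Hs kap i j P = (if i = j then 3 * k ^ 4 else 0)"
    using w by simp
  also have "\<dots> \<longleftrightarrow> Hs kap i j P = 5 / 2 * fd kap i P * fd kap j P / k - (if i = j then 2 * k ^ 3 else 0)"
    using k by (auto simp: field_simps power3_eq_cube power4_eq_xxxx)
  finally show ?thesis unfolding k_def .
qed

lemma smooth_kd: "smooth_on Dom (kd i)"
proof -
  have "smooth_on Dom (\<lambda>z. snd (fst z) $ i $ 1 * frechet_derivative kap (at (fst (fst z))) (axis 1 1)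
     + snd (fst z) $ i $ 2 * frechet_derivative kap (at (fst (fst z))) (axis 2 1))"
    by (intro smooth_on_add smooth_on_mult open_Dom smooth_nth smooth_on_linear[OF open_Dom bl_E]
      smooth_base smooth_on_frechet_derivative smooth_kap)
  then show ?thesis
  proof (rule smooth_on_cong[OF open_Dom, rotated])
    fix z assume "z \<in> Dom"
    then have U: "fst (fst z) \<in> U" by (simp add: Dom_def)
    note lin = has_derivative_linear[OF smooth_on_has_derivative[OF smooth_kap U]]
    show "snd (fst z) $ i $ 1 * frechet_derivative kap (at (fst (fst z))) (axis 1 1)
     + snd (fst z) $ i $ 2 * frechet_derivative kap (at (fst (fst z))) (axis 2 1) = kd i z"
      unfolding kd_def by (subst (3) vec2_expansion) (simp only: linear_add[OF lin] linear_scale[OF lin] real_scaleR_def)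
  qed
qed

lemma sufficiency_kap:
  assumes H: "\<And>i j P. P \<in> FP \<Longrightarrow> Hs kap i j P =
      5 / 2 * fd kap i P * fd kap j P / kap (fst P) - (if i = j then 2 * kap (fst P) ^ 3 else 0)"
  shows "\<exists>F. subbundle_frame S Dom F \<and> 2 \<le> length F \<and> frobenius S Dom F \<and>
     (\<forall>z\<in>S \<inter> Dom.
        cspan_at S F z \<subseteq> cspan_at S (singular_forms A g K c) z \<and>
        (\<forall>\<phi>\<in>cspan_at S F z \<inter> cspan_at S (embedding_forms A g c) z.
           \<forall>v\<in>tangent_space S z. \<phi> v = 0))"
proof -
  \<comment> \<open>The coefficient of \<open>\<theta>\<^sub>3\<close> is -\<i> r; working with r
    keeps the check of the first-order system in real arithmetic.\<close>
  define r where "r i z = kd i z / (2 * kp z * kp z)" for i z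
  have k0: "kp z > 0" if "z \<in> Dom" for z
    using kap_pos that by (simp add: Dom_def)
  have smr: "smooth_on Dom (r i)" for i
    unfolding r_def[abs_def]
    by (intro smooth_on_divide smooth_on_mult smooth_on_const smooth_kd smooth_base smooth_kap open_Dom)
      (use k0 in force)
  define a where "a i z = - \<i> * of_real (r i z)" for i z
  have sma: "smooth_on Dom (a i)" for i
    unfolding a_def[abs_def] by (intro smooth_on_mult smooth_on_const smooth_on_of_real smr open_Dom)
  have da: "frechet_derivative (a i) (at z) w = - \<i> * of_real (
      ((if i = 1 then - kd 2 z * al z w else kd 1 z * al z w) + Hs kap i 1 (fst z) * e1 z w + Hs kap i 2 (fst z) * e2 z w)
        / (2 * kp z * kp z)
      - kd i z * (kd 1 z * e1 z w + kd 2 z * e2 z w) / (kp z * kp z * kp z))"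
    if z: "z \<in> S" and w: "w \<in> tangent_space S z" for i z w
  proof -
    obtain D where D: "(kd i has_derivative D) (at z)" "\<And>v. v \<in> tangent_space S z \<Longrightarrow> D v =
       (if i = 1 then - kd 2 z * al z v else kd 1 z * al z v)
       + Hs kap i 1 (fst z) * e1 z v + Hs kap i 2 (fst z) * e2 z v"
      using kd_derivative[OF z] by blast
    note bd = base_derivative[OF z smooth_kap]
    let ?k = "\<lambda>u. frechet_derivative kap (at (fst (fst z))) (fst (fst u))"
    note kz = k0[OF SD(3)[OF z]]
    have "(r i has_derivative (\<lambda>u. D u / (2 * kp z * kp z) - kd i z * ?k u / (kp z * kp z * kp z))) (at z)"
      unfolding r_def[abs_def]
      by (rule has_derivative_eq_rhs[OF has_derivative_divide'[OF D(1) has_derivative_mult[OF has_derivative_mult[OF has_derivative_const bd(1)] bd(1)]]])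
        (use kz in \<open>auto simp: fun_eq_iff field_simps\<close>)
    then have "(a i has_derivative (\<lambda>u. - \<i> * of_real (D u / (2 * kp z * kp z) - kd i z * ?k u / (kp z * kp z * kp z)))) (at z)"
      unfolding a_def[abs_def]
      by (intro has_derivative_mult_right bounded_linear.has_derivative[OF bounded_linear_of_real])
    from fun_cong[OF frechet_derivative_at[OF this], of w] show ?thesis
      unfolding D(2)[OF w] bd(2) kd_def[symmetric] by (simp only: real_scaleR_def mult.commute[of "e1 z w"] mult.commute[of "e2 z w"])
  qed
  show ?thesis
  proof (rule sufficiency[of "a 1" "a 2"])
    show "smooth_on Dom (a 1)" "smooth_on Dom (a 2)" by (rule sma)+
  next
    fix z w assume z: "z \<in> S" and w: "w \<in> tangent_space S z"
    note kz = k0[OF SD(3)[OF z]]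
    note h = H[OF SD(1)[OF z]]
    have ne: "((2::2) = 1) = False" by simp
    have "((- kd 2 z * al z w) + Hs kap 1 1 (fst z) * e1 z w + Hs kap 1 2 (fst z) * e2 z w)
        / (2 * kp z * kp z) - kd 1 z * (kd 1 z * e1 z w + kd 2 z * e2 z w) / (kp z * kp z * kp z)
      = (kp z * r 1 z * r 1 z - kp z) * e1 z w + kp z * r 1 z * r 2 z * e2 z w - r 2 z * al z w"
      unfolding h kd_fd[symmetric] r_def using kz
      by (simp add: divide_simps power3_eq_cube) (simp add: algebra_simps)
    then have "frechet_derivative (a 1) (at z) w = - \<i> * of_real
        ((kp z * r 1 z * r 1 z - kp z) * e1 z w + kp z * r 1 z * r 2 z * e2 z w - r 2 z * al z w)"
      by (simp only: da[OF z w] simp_thms if_True)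
    then show "frechet_derivative (a 1) (at z) w =
      (\<i> * kp z + \<i> * kp z * a 1 z * a 1 z) * e1 z w + \<i> * kp z * a 1 z * a 2 z * e2 z w - a 2 z * al z w"
      by (simp add: a_def algebra_simps)
    have "((kd 1 z * al z w) + Hs kap 2 1 (fst z) * e1 z w + Hs kap 2 2 (fst z) * e2 z w)
        / (2 * kp z * kp z) - kd 2 z * (kd 1 z * e1 z w + kd 2 z * e2 z w) / (kp z * kp z * kp z)
      = kp z * r 1 z * r 2 z * e1 z w + (kp z * r 2 z * r 2 z - kp z) * e2 z w + r 1 z * al z w"
      unfolding h kd_fd[symmetric] r_def using kz
      by (simp add: divide_simps power3_eq_cube) (simp add: algebra_simps)
    then have "frechet_derivative (a 2) (at z) w = - \<i> * of_real
        (kp z * r 1 z * r 2 z * e1 z w + (kp z * r 2 z * r 2 z - kp z) * e2 z w + r 1 z * al z w)"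
      by (simp only: da[OF z w] ne if_False)
    then show "frechet_derivative (a 2) (at z) w =
      \<i> * kp z * a 1 z * a 2 z * e1 z w + (\<i> * kp z + \<i> * kp z * a 2 z * a 2 z) * e2 z w + a 1 z * al z w"
      by (simp add: a_def algebra_simps)
  next
    fix z assume z: "z \<in> S"
    note kz = k0[OF SD(3)[OF z]]
    have "kd i z = 2 * kp z * kp z * r i z" for i
      using kz by (simp add: r_def)
    then have "complex_of_real (kd i z) = 2 * \<i> * kp z * kp z * a i z" for i
      by (simp add: a_def)
    then show "complex_of_real (kd 1 z) = 2 * \<i> * kp z * kp z * a 1 z" "complex_of_real (kd 2 z) = 2 * \<i> * kp z * kp z * a 2 z"
      by blast+
  qed
qed

end

theorem theorem5:
  fixes X :: "'a topology" and A :: "'a chart set" and g :: "'a metric"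
    and K :: "'a \<Rightarrow> real" and k :: "'a \<Rightarrow> real" and q :: "'a frame \<Rightarrow> real"
    and q1 :: "2 \<Rightarrow> 'a frame \<Rightarrow> real" and q2 :: "2 \<Rightarrow> 2 \<Rightarrow> 'a frame \<Rightarrow> real"
  assumes "connected_oriented_surface X A"
    and "riemannian_metric A g"
    and "is_gauss_curvature A g K"
    and "\<And>p. p \<in> topspace X \<Longrightarrow> K p > 0"
    and "\<And>p. k p = sqrt (K p)"
    and "\<And>P. q P = k (fst P) powr (-3/2)"
    and "covariant_derivatives X A g q q1 q2"
  shows "darboux_integrable X A g K \<longleftrightarrow>
    (\<forall>P\<in>frame_bundle X A g.
       q2 1 1 P = 3 * q P powr (-1/3) \<and> q2 2 2 P = 3 * q P powr (-1/3) \<and>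
       q2 1 2 P = 0 \<and> q2 2 1 P = 0)"
proof -
  have chart: "curved_chart X A g c K" if "c \<in> A" for c
    by unfold_locales (use assms that in auto)
  \<comment> \<open>q depends on the base point alone, so at each frame the equation for q is the
    Hessian equation for k in any chart around it.\<close>
  have key: "q2 i j P = (if i = j then 3 * q P powr (-1/3) else 0) \<longleftrightarrow>
     surface_chart.Hs A g c (curved_chart.kap c K) i j (frame_coords c P) =
     5 / 2 * surface_chart.fd (curved_chart.kap c K) i (frame_coords c P) *
       surface_chart.fd (curved_chart.kap c K) j (frame_coords c P) / curved_chart.kap c K (fst (frame_coords c P)) -
     (if i = j then 2 * curved_chart.kap c K (fst (frame_coords c P)) ^ 3 else 0)"
    if c: "c \<in> A" and P: "P \<in> frames_over X A g c" for c P i j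
  proof -
    interpret curved_chart X A g c K by (rule chart[OF c])
    have q: "q P = kap (snd c (fst P)) powr (-3/2)" if "P \<in> frames_over X A g c" for P
      using that chart_inv_chart[OF c, of "fst P"] by (simp add: assms(5,6) kap_def frames_over_def)
    have Q: "q2 i j P = Hs (\<lambda>x. kap x powr (-3/2)) i j (frame_coords c P)"
      by (rule covariant_derivatives_eq[OF assms(7) smooth_kap_powr _ P]) (rule q)
    show ?thesis
      unfolding Q equation_for_kap[OF frame_coords_in[OF P], symmetric] q[OF P] by (simp add: frame_coords_def)
  qed
  show ?thesis (is "?D \<longleftrightarrow> (\<forall>P\<in>_. ?E P)")
  proof
    assume D: ?D
    show "\<forall>P\<in>frame_bundle X A g. ?E P"
    proof
      fix P assume P: "P \<in> frame_bundle X A g"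
      interpret surface X A g by unfold_locales (use assms in auto)
      obtain c where c: "c \<in> A" "fst P \<in> fst c"
        using topspace_cover[of "fst P"] P by (auto simp: frame_bundle_def)
      interpret curved_chart X A g c K by (rule chart[OF c(1)])
      have Pc: "P \<in> frames_over X A g c" using P c by (simp add: frames_over_def)
      \<comment> \<open>The claim concerns the surface factor, so any Euclidean frame may be paired
        with P.\<close>
      define Q :: euc_frame where "Q = (0, mat 1)"
      have Q: "Q \<in> euc_frame_bundle"
        by (simp add: Q_def euc_frame_bundle_def inner_vec_def mat_def sum_3 forall_3)
      define z0 where "z0 = (frame_coords c P, Q)"
      have "\<exists>V F. open V \<and> z0 \<in> V \<and> subbundle_frame S V F \<and> 2 \<le> length F \<and> frobenius S V F \<and>
           (\<forall>z\<in>S \<inter> V. cspan_at S F z \<subseteq> cspan_at S (singular_forms A g K c) z \<and>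
              (\<forall>\<phi>\<in>cspan_at S F z \<inter> cspan_at S (embedding_forms A g c) z. \<forall>v\<in>tangent_space S z. \<phi> v = 0))"
        using D P Q c unfolding darboux_integrable_def Let_def z0_def S_def by blast
      then obtain V F where V: "open V" "z0 \<in> V" "subbundle_frame S V F" "2 \<le> length F" "frobenius S V F"
        and sub: "\<And>z. z \<in> S \<inter> V \<Longrightarrow> cspan_at S F z \<subseteq> cspan_at S (singular_forms A g K c) z"
        and tr: "\<And>z \<phi> v. z \<in> S \<inter> V \<Longrightarrow> \<phi> \<in> cspan_at S F z \<Longrightarrow> \<phi> \<in> cspan_at S (embedding_forms A g c) z \<Longrightarrow>
          v \<in> tangent_space S z \<Longrightarrow> \<phi> v = 0"
        by blast
      have z0: "z0 \<in> S" using frame_coords_in[OF Pc] Q by (simp add: S_def z0_def)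
      have "Hs kap i j (fst z0) = 5 / 2 * fd kap i (fst z0) * fd kap j (fst z0) / kp z0
          - (if i = j then 2 * kp z0 ^ 3 else 0)" for i j
        by (rule necessity[OF z0 V(2,1,3,4,5)]) (rule sub tr; assumption)+
      then have "q2 i j P = (if i = j then 3 * q P powr (-1/3) else 0)" for i j
        unfolding key[OF c(1) Pc] by (simp add: z0_def)
      then show "?E P" by simp
    qed
  next
    assume E: "\<forall>P\<in>frame_bundle X A g. ?E P"
    show ?D
      unfolding darboux_integrable_def Let_def
    proof (intro ballI impI)
      fix P Q c assume P: "P \<in> frame_bundle X A g" and Q: "Q \<in> euc_frame_bundle" and c: "c \<in> A" "fst P \<in> fst c"
      interpret curved_chart X A g c K by (rule chart[OF c(1)])
      have Pc: "P \<in> frames_over X A g c" using P c by (simp add: frames_over_def)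
      \<comment> \<open>F is constructed over the whole chart, so the equation is used at every
        frame over the chart and not only at P.\<close>
      have H: "Hs kap i j w = 5 / 2 * fd kap i w * fd kap j w / kap (fst w) - (if i = j then 2 * kap (fst w) ^ 3 else 0)"
        if w: "w \<in> FP" for i j w
      proof -
        have R: "frame_at X A g c w \<in> frames_over X A g c" "frame_coords c (frame_at X A g c w) = w"
          using frame_at_in[OF w] by auto
        then have "?E (frame_at X A g c w)"
          using E by (simp add: frames_over_def)
        then have "q2 i j (frame_at X A g c w) = (if i = j then 3 * q (frame_at X A g c w) powr (-1/3) else 0)"
          using exhaust_2[of i] exhaust_2[of j] by auto
        then show ?thesis
          unfolding key[OF c(1) R(1)] R(2) .
      qed
      have "(frame_coords c P, Q) \<in> Dom"
        using frame_patchD(1)[OF frame_coords_in[OF Pc]] by (simp add: Dom_def)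
      then show "\<exists>V F. open V \<and> (frame_coords c P, Q) \<in> V \<and>
           subbundle_frame (FP \<times> euc_frame_bundle) V F \<and> 2 \<le> length F \<and> frobenius (FP \<times> euc_frame_bundle) V F \<and>
           (\<forall>z\<in>FP \<times> euc_frame_bundle \<inter> V.
              cspan_at (FP \<times> euc_frame_bundle) F z \<subseteq> cspan_at (FP \<times> euc_frame_bundle) (singular_forms A g K c) z \<and>
              (\<forall>\<phi>\<in>cspan_at (FP \<times> euc_frame_bundle) F z \<inter> cspan_at (FP \<times> euc_frame_bundle) (embedding_forms A g c) z.
                 \<forall>v\<in>tangent_space (FP \<times> euc_frame_bundle) z. \<phi> v = 0))"
        using sufficiency_kap[OF H] open_Dom unfolding S_def by blast
    qed
  qed
qed

end
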